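(* Let $F:\mathbb R^n\times\mathbb R^m\to\mathbb R^m$ be continuously differentiable, let $S(x)=\{y\in\mathbb R^m: 0\in F(x,y)+\widehat N_\Gamma(y)\}$ for $x\in\mathbb R^n$, let $(\bar x,\bar y)\in\mathrm{gph}\,S$ and put $\bar y^*:=-F(\bar x,\bar y)$. Assume that $M_q$ is metrically subregular at $(\bar y,0)$ and metrically regular in the vicinity of $\bar y$. Suppose that for every nonzero direction $u\in\bar K$ and every maximal index set $\mathcal J\in\bar{\mathcal J}(u)$ the mapping $y\mapsto(q_i(y))_{i\in\mathcal J}$ is 2-regular at $\bar y$ in direction $u$, and that $\mathcal N(\bar y)\neq\{0\}$. Consider the condition that for every $b\in\mathbb R^m$ the following implication holds: $$-\begin{pmatrix}\nabla_yF(\bar x,\bar y)^Tb\\ b\end{pmatrix}\in\bigcup_{\substack{(v,v^* )\in T_{\mathrm{gph}\,\widehat N_\Gamma}(\bar y,\bar y^* )\\ v\neq0}}\ \bigcup_{\substack{(\lambda,\mu)\in\bar{\mathcal M}(v,v^* )\\ \mathcal J\in\bar{\mathcal J}(v)}}\ \bigcup_{I^+(\lambda,\mu)\subset I^+\subset\mathcal I\subset\mathcal J}Q(v,\lambda,I^+,\mathcal I)\quad\Longrightarrow\quad b=0.$$ This condition implies that $S$ has the Aubin property around $(\bar x,\bar y)$. If, in addition, $\nabla_xF(\bar x,\bar y)$ is surjective, then this condition is not only sufficient but also necessary for $S$ to have the Aubin property around $(\bar x,\bar y)$.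
   Context: Setting. $q=(q_1,\dots,q_l):\mathbb R^m\to\mathbb R^l$ is twice continuously differentiable, $\Gamma=\{y\in\mathbb R^m: q_i(y)\le0,\ i=1,\dots,l\}$, $\mathcal I(y)=\{i: q_i(y)=0\}$ for $y\in\Gamma$. $\nabla q(y)$ is the $l\times m$ Jacobian with rows $\nabla q_i(y)$. $K^\circ$ denotes the negative polar of a cone $K$. Aubin property. $S:\mathbb R^n\rightrightarrows\mathbb R^m$ has the Aubin property around $(\bar x,\bar y)\in\mathrm{gph}\,S$ if there are neighborhoods $\mathcal U$ of $\bar x$, $\mathcal V$ of $\bar y$ and $\kappa\ge0$ such that $S(x_1)\cap\mathcal V\subset S(x_2)+\kappa\|x_1-x_2\|\mathcal B$ for all $x_1,x_2\in\mathcal U$, with $\mathcal B$ the closed unit ball. Variational notions. For $\Omega\subset\mathbb R^d$ and $\bar z\in\Omega$: $T_\Omega(\bar z)=\{u:\exists t_k\downarrow0,u_k\to u,\ \bar z+t_ku_k\in\Omega\ \forall k\}$ (contingent cone); $\widehat N_\Omega(\bar z)=(T_\Omega(\bar z))^\circ$ (regular normal cone). $\widehat N_\Gamma$ is regarded as the multifunction $y\mapsto\widehat N_\Gamma(y)$ (empty for $y\notin\Gamma$) with graph in $\mathbb R^m\times\mathbb R^m$. Regularity. A multifunction $\Psi:\mathbb R^d\rightrightarrows\mathbb R^s$ is metrically regular with modulus $\kappa>0$ near $(\bar u,\bar v)\in\mathrm{gph}\,\Psi$ if there are neighborhoods $U$ of $\bar u$, $V$ of $\bar v$ with $d(u,\Psi^{-1}(v))\le\kappa\,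 d(v,\Psi(u))$ for all $(u,v)\in U\times V$; it is metrically subregular at $(\bar u,\bar v)$ if for some $\kappa>0$ and neighborhood $U$ of $\bar u$, $d(u,\Psi^{-1}(\bar v))\le\kappa\, d(\bar v,\Psi(u))$ for all $u\in U$. $M_q(y):=q(y)-\mathbb R^l_-$ (so $M_q^{-1}(0)=\Gamma$). $M_q$ is metrically regular in the vicinity of $\bar y$ if there are a neighborhood $V$ of $\bar y$ and $\kappa>0$ such that for every $y\in\Gamma\cap V$, $y\neq\bar y$, $M_q$ is metrically regular near $(y,0)$ with modulus $\kappa$. 2-regularity. A map $g:\mathbb R^m\to\mathbb R^p$, twice Fréchet differentiable at $\bar y$, is 2-regular at $\bar y$ in direction $v$ if for every $\alpha\in\mathbb R^p$ the system $\nabla g(\bar y)u+v^T\nabla^2g(\bar y)w=\alpha$, $\nabla g(\bar y)w=0$ has a solution $(u,w)\in\mathbb R^m\times\mathbb R^m$, where $v^T\nabla^2g(\bar y)w$ is the vector with components $v^T\nabla^2g_i(\bar y)w$ (an empty family is 2-regular). Objects at the reference pair $(\bar y,\bar y^* )$, $\bar y\in\Gamma$, $\bar y^*\in\widehat N_\Gamma(\bar y)$. $\bar{\mathcal I}=\mathcal I(\bar y)$; $\mathcal N(\bar y)=\{v:\nabla q_i(\bar y)v=0,\ i\in\bar{\mathcal I}\}$; $T^{\rm lin}_\Gamma(\bar y)=\{v:\nabla q_i(\bar y)v\le0,\ i\in\bar{\mathcal I}\}$; $N_{\mathbb R^l_-}(q(\bar y))=\{\lambda\in\mathbb R^l_+:\lambda_i=0,\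 i\notin\bar{\mathcal I}\}$; $\bar\Lambda=\{\lambda\in N_{\mathbb R^l_-}(q(\bar y)):\nabla q(\bar y)^T\lambda=\bar y^*\}$; $\bar K=T_\Gamma(\bar y)\cap(\bar y^* )^\perp$. For $v\in T^{\rm lin}_\Gamma(\bar y)$: $\bar{\mathcal I}(v)=\{i\in\bar{\mathcal I}:\nabla q_i(\bar y)v=0\}$; $\bar\Lambda(v)$ is the solution set of $\max_{\lambda\in\bar\Lambda}v^T\nabla^2(\lambda^Tq)(\bar y)v$; $\bar\Xi(v)=\{z\in\mathbb R^m:\nabla q_i(\bar y)z+v^T\nabla^2q_i(\bar y)v\le0,\ i\in\bar{\mathcal I}\}$; for $z\in\bar\Xi(v)$, $\mathcal J(z)=\{i\in\bar{\mathcal I}(v):\nabla q_i(\bar y)z+v^T\nabla^2q_i(\bar y)v=0\}$; $\bar{\mathcal J}(v)=\{\mathcal J(z):z\in\bar\Xi(v)\}$; an element of $\bar{\mathcal J}(v)$ is maximal if it is maximal with respect to inclusion within $\bar{\mathcal J}(v)$. $\bar{\mathcal M}(v,v^* )=\{(\lambda,\mu):\lambda\in\bar\Lambda(v),\ \mu\in T_{N_{\mathbb R^l_-}(q(\bar y))}(\lambda),\ v^*=\nabla^2(\lambda^Tq)(\bar y)v+\nabla q(\bar y)^T\mu\}$. $I^+(\lambda)=\{i:\lambda_i>0\}$ and, for $(\lambda,\mu)\in\bar{\mathcal M}(v,v^* )$, $I^+(\lambda,\mu)=I^+(\lambda)\cup\{i:\lambda_i=0,\mu_i>0\}$. For $I^+\subset\mathcal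 I\subset\bar{\mathcal I}$: $\bar K_{I^+,\mathcal I}=\{w:\nabla q_i(\bar y)w=0,\ i\in I^+;\ \nabla q_i(\bar y)w\le0,\ i\in\mathcal I\setminus I^+\}$; $\bar K_{I^+,\mathcal I}(v)$ is the set of $w\in\bar K_{I^+,\mathcal I}$ for which there is $z\in\mathbb R^m$ with $\nabla q_i(\bar y)z+v^T\nabla^2q_i(\bar y)w=0$ for $i\in I^+$ and $\le0$ for $i\in\mathcal I\setminus I^+$; and $Q(v,\lambda,I^+,\mathcal I)=\{(w^*,w): w\in\bar K_{I^+,\mathcal I}(v),\ w^*+\nabla^2(\lambda^Tq)(\bar y)w\in(\bar K_{I^+,\mathcal I}(v))^\circ\}$. *)

theory Defs
  imports "HOL-Analysis.Analysis"
begin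

section \<open>Differentiability, gradients and Hessians\<close>

definition continuously_differentiable ::
    "('a::real_normed_vector \<Rightarrow> 'b::real_normed_vector) \<Rightarrow> bool" where
  "continuously_differentiable f \<longleftrightarrow>
     (\<exists>f' :: 'a \<Rightarrow> 'a \<Rightarrow>\<^sub>L 'b. (\<forall>x. (f has_derivative blinfun_apply (f' x)) (at x)) \<and>
        continuous_on UNIV f')"

definition twice_continuously_differentiable ::
    "('a::real_normed_vector \<Rightarrow> 'b::real_normed_vector) \<Rightarrow> bool" where
  "twice_continuously_differentiable f \<longleftrightarrow>
     (\<exists>f' :: 'a \<Rightarrow> 'a \<Rightarrow>\<^sub>L 'b. (\<forall>x. (f has_derivative blinfun_apply (f' x)) (at x)) \<and>
        continuously_differentiable f')"

definition gradient :: "(real^'m \<Rightarrow> real) \<Rightarrow> real^'m \<Rightarrow> real^'m" where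
  "gradient f y = (\<chi> j. frechet_derivative f (at y) (axis j 1))"

definition hessian :: "(real^'m \<Rightarrow> real) \<Rightarrow> real^'m \<Rightarrow> real^'m^'m" where
  "hessian f y = jacobian (gradient f) (at y)"

section \<open>Cones\<close>

definition negative_polar :: "'a::real_inner set \<Rightarrow> 'a set" where
  "negative_polar K = {y. \<forall>x\<in>K. y \<bullet> x \<le> 0}"

definition contingent_cone :: "'a::real_normed_vector set \<Rightarrow> 'a \<Rightarrow> 'a set" where
  "contingent_cone \<Omega> z =
     {u. \<exists>(t :: nat \<Rightarrow> real) (w :: nat \<Rightarrow> 'a).
           (\<forall>k. t k > 0) \<and> t \<longlonglongrightarrow> 0 \<and> w \<longlonglongrightarrow> u \<and> (\<forall>k. z + t k *\<^sub>R w k \<in> \<Omega>)}"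

definition regular_normal_cone :: "'a::real_inner set \<Rightarrow> 'a \<Rightarrow> 'a set" where
  "regular_normal_cone \<Omega> z =
     (if z \<in> \<Omega> then negative_polar (contingent_cone \<Omega> z) else {})"

section \<open>Multifunctions\<close>

definition gph :: "('a \<Rightarrow> 'b set) \<Rightarrow> ('a \<times> 'b) set" where
  "gph \<Psi> = {(u, v). v \<in> \<Psi> u}"

definition inverse_mf :: "('a \<Rightarrow> 'b set) \<Rightarrow> 'b \<Rightarrow> 'a set" where
  "inverse_mf \<Psi> v = {u. v \<in> \<Psi> u}"

text \<open>The distance to the empty set is infinite. This is why \<open>infdist\<close>, which is \<open>0\<close> for
  the empty set, is not used.\<close>

definition edist_set :: "'a::metric_space \<Rightarrow> 'a set \<Rightarrow> ereal" where
  "edist_set x A = (INF a\<in>A. ereal (dist x a))"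

definition aubin_property ::
    "('a::real_normed_vector \<Rightarrow> 'b::real_normed_vector set) \<Rightarrow> 'a \<Rightarrow> 'b \<Rightarrow> bool" where
  "aubin_property S x y \<longleftrightarrow> (x, y) \<in> gph S \<and>
     (\<exists>U V \<kappa>. open U \<and> x \<in> U \<and> open V \<and> y \<in> V \<and> (\<kappa>::real) \<ge> 0 \<and>
        (\<forall>x1\<in>U. \<forall>x2\<in>U. S x1 \<inter> V \<subseteq>
           {s + (\<kappa> * norm (x1 - x2)) *\<^sub>R b | s b. s \<in> S x2 \<and> b \<in> cball 0 1}))"

definition metrically_regular_near ::
    "('a::metric_space \<Rightarrow> 'b::metric_space set) \<Rightarrow> real \<Rightarrow> 'a \<Rightarrow> 'b \<Rightarrow> bool" where
  "metrically_regular_near \<Psi> \<kappa> u0 v0 \<longleftrightarrow> (u0, v0) \<in> gph \<Psi> \<and> \<kappa> > 0 \<and>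
     (\<exists>U V. open U \<and> u0 \<in> U \<and> open V \<and> v0 \<in> V \<and>
        (\<forall>u\<in>U. \<forall>v\<in>V. edist_set u (inverse_mf \<Psi> v) \<le> ereal \<kappa> * edist_set v (\<Psi> u)))"

definition metrically_subregular_at ::
    "('a::metric_space \<Rightarrow> 'b::metric_space set) \<Rightarrow> 'a \<Rightarrow> 'b \<Rightarrow> bool" where
  "metrically_subregular_at \<Psi> u0 v0 \<longleftrightarrow> (u0, v0) \<in> gph \<Psi> \<and>
     (\<exists>\<kappa>>0. \<exists>U. open U \<and> u0 \<in> U \<and>
        (\<forall>u\<in>U. edist_set u (inverse_mf \<Psi> v0) \<le> ereal \<kappa> * edist_set v0 (\<Psi> u)))"

section \<open>The constraint system\<close>

definition nonpos_orthant :: "(real^'l) set" where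
  "nonpos_orthant = {p. \<forall>i. p $ i \<le> 0}"

definition feasible_set :: "(real^'m \<Rightarrow> real^'l) \<Rightarrow> (real^'m) set" where
  "feasible_set q = {y. \<forall>i. q y $ i \<le> 0}"

definition constraint_mf :: "(real^'m \<Rightarrow> real^'l) \<Rightarrow> real^'m \<Rightarrow> (real^'l) set" where
  "constraint_mf q y = {q y - p | p. p \<in> nonpos_orthant}"

definition regular_in_vicinity :: "(real^'m \<Rightarrow> real^'l) \<Rightarrow> real^'m \<Rightarrow> bool" where
  "regular_in_vicinity q y0 \<longleftrightarrow>
     (\<exists>V \<kappa>. open V \<and> y0 \<in> V \<and> \<kappa> > 0 \<and>
        (\<forall>y \<in> feasible_set q \<inter> V. y \<noteq> y0 \<longrightarrow> metrically_regular_near (constraint_mf q) \<kappa> y 0))"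

definition active :: "(real^'m \<Rightarrow> real^'l) \<Rightarrow> real^'m \<Rightarrow> 'l set" where
  "active q y = {i. q y $ i = 0}"

abbreviation grad_comp :: "(real^'m \<Rightarrow> real^'l) \<Rightarrow> 'l \<Rightarrow> real^'m \<Rightarrow> real^'m" where
  "grad_comp q i y \<equiv> gradient (\<lambda>y. q y $ i) y"

abbreviation hess_comp :: "(real^'m \<Rightarrow> real^'l) \<Rightarrow> 'l \<Rightarrow> real^'m \<Rightarrow> real^'m^'m" where
  "hess_comp q i y \<equiv> hessian (\<lambda>y. q y $ i) y"

abbreviation hess_lagr :: "(real^'m \<Rightarrow> real^'l) \<Rightarrow> real^'l \<Rightarrow> real^'m \<Rightarrow> real^'m^'m" where
  "hess_lagr q lam y \<equiv> hessian (\<lambda>y. lam \<bullet> q y) y"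

text \<open>A map into \<open>\<real>\<^sup>p\<close> is represented by the family \<open>g\<close> of its components over an index set
  \<open>J\<close>, because \<open>p = card J\<close> varies with \<open>J\<close>. It is understood that the components are twice
  differentiable at \<open>y\<close>.\<close>

definition two_regular :: "'i set \<Rightarrow> ('i \<Rightarrow> real^'m \<Rightarrow> real) \<Rightarrow> real^'m \<Rightarrow> real^'m \<Rightarrow> bool" where
  "two_regular J g y v \<longleftrightarrow>
     (\<forall>\<alpha> :: 'i \<Rightarrow> real. \<exists>u w.
        (\<forall>i\<in>J. gradient (g i) y \<bullet> u + v \<bullet> (hessian (g i) y *v w) = \<alpha> i) \<and>
        (\<forall>i\<in>J. gradient (g i) y \<bullet> w = 0))"

section \<open>Objects at the reference pair\<close>

definition active_null_space :: "(real^'m \<Rightarrow> real^'l) \<Rightarrow> real^'m \<Rightarrow> (real^'m) set" where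
  "active_null_space q y = {v. \<forall>i\<in>active q y. grad_comp q i y \<bullet> v = 0}"

text \<open>The normal cone to the nonpositive orthant at \<open>q y\<close>, where \<open>y\<close> is feasible.\<close>

definition multiplier_cone :: "(real^'m \<Rightarrow> real^'l) \<Rightarrow> real^'m \<Rightarrow> (real^'l) set" where
  "multiplier_cone q y = {lam. (\<forall>i. lam $ i \<ge> 0) \<and> (\<forall>i. i \<notin> active q y \<longrightarrow> lam $ i = 0)}"

definition multipliers :: "(real^'m \<Rightarrow> real^'l) \<Rightarrow> real^'m \<Rightarrow> real^'m \<Rightarrow> (real^'l) set" where
  "multipliers q y ys =
     {lam \<in> multiplier_cone q y. transpose (jacobian q (at y)) *v lam = ys}"

definition critical_cone :: "(real^'m \<Rightarrow> real^'l) \<Rightarrow> real^'m \<Rightarrow> real^'m \<Rightarrow> (real^'m) set" where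
  "critical_cone q y ys = contingent_cone (feasible_set q) y \<inter> {u. ys \<bullet> u = 0}"

text \<open>The following objects depending on a direction \<open>v\<close> are only of interest for \<open>v\<close> in the
  linearized tangent cone; this holds for every \<open>v\<close> in the contingent cone to the feasible set.\<close>

definition active_dir :: "(real^'m \<Rightarrow> real^'l) \<Rightarrow> real^'m \<Rightarrow> real^'m \<Rightarrow> 'l set" where
  "active_dir q y v = {i \<in> active q y. grad_comp q i y \<bullet> v = 0}"

definition multipliers_dir ::
    "(real^'m \<Rightarrow> real^'l) \<Rightarrow> real^'m \<Rightarrow> real^'m \<Rightarrow> real^'m \<Rightarrow> (real^'l) set" where
  "multipliers_dir q y ys v =
     {lam \<in> multipliers q y ys. \<forall>lam' \<in> multipliers q y ys.
        v \<bullet> (hess_lagr q lam' y *v v) \<le> v \<bullet> (hess_lagr q lam y *v v)}"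

definition second_order_set :: "(real^'m \<Rightarrow> real^'l) \<Rightarrow> real^'m \<Rightarrow> real^'m \<Rightarrow> (real^'m) set" where
  "second_order_set q y v =
     {z. \<forall>i\<in>active q y. grad_comp q i y \<bullet> z + v \<bullet> (hess_comp q i y *v v) \<le> 0}"

definition active_second ::
    "(real^'m \<Rightarrow> real^'l) \<Rightarrow> real^'m \<Rightarrow> real^'m \<Rightarrow> real^'m \<Rightarrow> 'l set" where
  "active_second q y v z =
     {i \<in> active_dir q y v. grad_comp q i y \<bullet> z + v \<bullet> (hess_comp q i y *v v) = 0}"

definition index_sets :: "(real^'m \<Rightarrow> real^'l) \<Rightarrow> real^'m \<Rightarrow> real^'m \<Rightarrow> 'l set set" where
  "index_sets q y v = active_second q y v ` second_order_set q y v"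

definition maximal_index_sets ::
    "(real^'m \<Rightarrow> real^'l) \<Rightarrow> real^'m \<Rightarrow> real^'m \<Rightarrow> 'l set set" where
  "maximal_index_sets q y v =
     {J \<in> index_sets q y v. \<forall>J' \<in> index_sets q y v. J \<subseteq> J' \<longrightarrow> J' = J}"

definition multiplier_pairs ::
    "(real^'m \<Rightarrow> real^'l) \<Rightarrow> real^'m \<Rightarrow> real^'m \<Rightarrow> real^'m \<Rightarrow> real^'m \<Rightarrow>
     ((real^'l) \<times> (real^'l)) set" where
  "multiplier_pairs q y ys v vs =
     {(lam, mu). lam \<in> multipliers_dir q y ys v \<and>
        mu \<in> contingent_cone (multiplier_cone q y) lam \<and>
        vs = hess_lagr q lam y *v v + transpose (jacobian q (at y)) *v mu}"

definition I_plus :: "real^'l \<Rightarrow> real^'l \<Rightarrow> 'l set" where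
  "I_plus lam mu = {i. lam $ i > 0} \<union> {i. lam $ i = 0 \<and> mu $ i > 0}"

definition K_cone ::
    "(real^'m \<Rightarrow> real^'l) \<Rightarrow> real^'m \<Rightarrow> 'l set \<Rightarrow> 'l set \<Rightarrow> (real^'m) set" where
  "K_cone q y Ip I =
     {w. (\<forall>i\<in>Ip. grad_comp q i y \<bullet> w = 0) \<and> (\<forall>i\<in>I - Ip. grad_comp q i y \<bullet> w \<le> 0)}"

definition K_cone_dir ::
    "(real^'m \<Rightarrow> real^'l) \<Rightarrow> real^'m \<Rightarrow> real^'m \<Rightarrow> 'l set \<Rightarrow> 'l set \<Rightarrow> (real^'m) set" where
  "K_cone_dir q y v Ip I =
     {w \<in> K_cone q y Ip I. \<exists>z.
        (\<forall>i\<in>Ip. grad_comp q i y \<bullet> z + v \<bullet> (hess_comp q i y *v w) = 0) \<and>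
        (\<forall>i\<in>I - Ip. grad_comp q i y \<bullet> z + v \<bullet> (hess_comp q i y *v w) \<le> 0)}"

definition Q_set ::
    "(real^'m \<Rightarrow> real^'l) \<Rightarrow> real^'m \<Rightarrow> real^'m \<Rightarrow> real^'l \<Rightarrow> 'l set \<Rightarrow> 'l set \<Rightarrow>
     ((real^'m) \<times> (real^'m)) set" where
  "Q_set q y v lam Ip I =
     {(ws, w). w \<in> K_cone_dir q y v Ip I \<and>
        ws + hess_lagr q lam y *v w \<in> negative_polar (K_cone_dir q y v Ip I)}"

section \<open>The solution map of the parametric variational system\<close>

definition solution_map ::
    "((real^'n) \<times> (real^'m) \<Rightarrow> real^'m) \<Rightarrow> (real^'m \<Rightarrow> real^'l) \<Rightarrow> real^'n \<Rightarrow> (real^'m) set" where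
  "solution_map F q x =
     {y. 0 \<in> (\<lambda>s. F (x, y) + s) ` regular_normal_cone (feasible_set q) y}"

end

theory Submission
  imports Defs
begin

text \<open>Write \<open>G\<close> for the graph of the regular normal cone mapping. The Aubin property follows if no
  nonzero vector of the form \<open>- (adjoint b, b)\<close> is a limit of regular normals to \<open>G\<close>; when the
  derivative with respect to the parameter is surjective this is also necessary. So the theorem
  amounts to the equality of the set of these limits with the union of the sets \<open>Q\<close>.

  Let \<open>y\<close> be a feasible point close to the reference point and different from it, and let \<open>v\<close> be
  the direction in which it is approached. The index set of the constraints active at \<open>y\<close> is
  contained in a maximal index set for \<open>v\<close>, and 2-regularity in direction \<open>v\<close> makes the active
  gradients linearly independent at \<open>y\<close>. Therefore the regular normals to \<open>G\<close> over \<open>y\<close> are explicitly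
  known in terms of a critical cone, and, again by 2-regularity, these cones and their polars converge
  to the cone \<open>K(v)\<close> and its polar. Multipliers stay bounded by metric regularity, and for a limit
  multiplier \<open>\<lambda>\<close> the pair \<open>(\<lambda>, 0)\<close> always serves as the pair required in the union. Conversely, each
  index set \<open>I\<close> in the union is the set of active constraints on a suitable feasible curve, obtained
  from Brouwer's theorem. Finally, regular normals over the reference point itself are limits of
  regular normals over other points, since for \<open>v\<close> in the null space both \<open>v\<close> and \<open>- v\<close> are critical
  directions, and therefore these normals are orthogonal to a tangent to \<open>G\<close> in direction \<open>v\<close>.\<close>

section \<open>Polyhedral cones\<close>

text \<open>At the reference point the active gradients may be dependent and the multipliers
  unbounded, so nothing is computed there directly. At distance t in direction v, 2-regularity gives
  the active gradients a right inverse of norm O(1/t): an error o(t) in the linearized constraints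
  at y = ybar + t p can be removed by an o(1) change of the vector. This explains the auxiliary z in
  K(v). With H_i the Hessian of constraint i, grad_i(y) (w + t z) = grad_i(ybar) w + t (grad_i(ybar)
  z + v H_i w) + o(t), and the definition asks for the right sign at both orders. Conversely, the z
  found in limits come from vectors w / t, which may be unbounded; only solvability passes to the
  limit, because the solvable right-hand sides of a linear system form a finitely generated, hence
  closed, cone. The pair (\<lambda>, 0) arises because the limit multiplier \<lambda> is supported
  on the constraints active along the sequence: kept fixed along it, \<lambda> gives normals whose
  difference quotients tend to the Hessian of the Lagrangian applied to v, with no gradient term
  left over.\<close>

lemma sum_in_convex_cone:
  assumes "convex_cone S" "\<And>i. i \<in> A \<Longrightarrow> f i \<in> S"
  shows "sum f A \<in> S"
  using assms(2)
  by (induction A rule: infinite_finite_induct)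
    (auto intro: convex_cone_add[OF assms(1)] simp: convex_cone_contains_0[OF assms(1)])

text \<open>Farkas' lemma. A finitely generated cone is closed, so a \<open>y\<close> outside it
  could be strictly separated, and the negated separating vector would violate \<open>polar\<close>.
  The coefficients are total functions vanishing off \<open>A\<close>, ready to be read as
  multiplier vectors.\<close>

lemma farkas:
  fixes c :: "'i \<Rightarrow> 'a::euclidean_space"
  assumes "finite A" and polar: "\<And>d. (\<And>i. i \<in> A \<Longrightarrow> c i \<bullet> d \<le> 0) \<Longrightarrow> y \<bullet> d \<le> 0"
  shows "\<exists>l. (\<forall>i. 0 \<le> l i) \<and> (\<forall>i. i \<notin> A \<longrightarrow> l i = 0) \<and> y = (\<Sum>i\<in>A. l i *\<^sub>R c i)"
proof -
  let ?C = "convex_cone hull (c ` A)"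
  have "y \<in> ?C"
  proof (rule ccontr)
    assume "y \<notin> ?C"
    moreover have "closed ?C" using \<open>finite A\<close> by (simp add: closed_convex_cone_hull)
    moreover have "convex ?C" by (rule convex_convex_cone_hull)
    ultimately obtain a b where ab: "a \<bullet> y < b" "\<And>x. x \<in> ?C \<Longrightarrow> a \<bullet> x > b"
      using separating_hyperplane_closed_point by metis
    have b: "b < 0" using ab(2)[OF convex_cone_hull_contains_0] by simp
    have pos: "a \<bullet> x \<ge> 0" if "x \<in> ?C" for x
    proof (rule ccontr)
      assume "\<not> 0 \<le> a \<bullet> x"
      \<comment> \<open>Rescaling \<open>x\<close> by this factor stays in the cone and attains the
        value \<open>b\<close> exactly, against strict separation.\<close>
      then have "b / (a \<bullet> x) \<ge> 0" using b by (simp add: divide_nonpos_neg)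
      then have "a \<bullet> ((b / (a \<bullet> x)) *\<^sub>R x) > b"
        using ab(2) convex_cone_hull_mul[OF that] by blast
      then show False using \<open>\<not> 0 \<le> a \<bullet> x\<close> by simp
    qed
    have "y \<bullet> (- a) \<le> 0"
    proof (rule polar)
      fix i assume "i \<in> A"
      then show "c i \<bullet> (- a) \<le> 0" using pos[of "c i"] by (simp add: hull_inc inner_commute)
    qed
    then show False using ab(1) b by (simp add: inner_commute)
  qed
  moreover have "?C \<subseteq> {y. \<exists>l. (\<forall>i. 0 \<le> l i) \<and> (\<forall>i. i \<notin> A \<longrightarrow> l i = 0) \<and> y = (\<Sum>i\<in>A. l i *\<^sub>R c i)}"
    (is "_ \<subseteq> ?D")
  proof (rule hull_minimal)
    show "c ` A \<subseteq> ?D"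
    proof safe
      fix i assume "i \<in> A"
      then show "\<exists>l. (\<forall>i. 0 \<le> l i) \<and> (\<forall>i. i \<notin> A \<longrightarrow> l i = 0) \<and> c i = (\<Sum>i\<in>A. l i *\<^sub>R c i)"
        using \<open>finite A\<close> by (intro exI[of _ "\<lambda>j. if j = i then 1 else 0"]) (auto simp: if_distrib[of "\<lambda>x. x *\<^sub>R _"] cong: if_cong)
    qed
    show "convex_cone ?D"
      unfolding convex_cone_iff
    proof (intro conjI allI impI ballI)
      show "0 \<in> ?D" by (auto intro!: exI[of _ "\<lambda>_. 0"])
    next
      fix x y assume "x \<in> ?D" "y \<in> ?D"
      then obtain l m where "\<forall>i. 0 \<le> l i" "\<forall>i. i \<notin> A \<longrightarrow> l i = 0" "x = (\<Sum>i\<in>A. l i *\<^sub>R c i)"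
         "\<forall>i. 0 \<le> m i" "\<forall>i. i \<notin> A \<longrightarrow> m i = 0" "y = (\<Sum>i\<in>A. m i *\<^sub>R c i)" by blast
      then show "x + y \<in> ?D"
        by (auto intro!: exI[of _ "\<lambda>i. l i + m i"] simp: sum.distrib scaleR_left_distrib)
    next
      fix x and t :: real assume "x \<in> ?D" "0 \<le> t"
      then obtain l where "\<forall>i. 0 \<le> l i" "\<forall>i. i \<notin> A \<longrightarrow> l i = 0" "x = (\<Sum>i\<in>A. l i *\<^sub>R c i)" by blast
      then show "t *\<^sub>R x \<in> ?D" using \<open>0 \<le> t\<close>
        by (auto intro!: exI[of _ "\<lambda>i. t * l i"] simp: scaleR_sum_right)
    qed
  qed
  ultimately show ?thesis by blast
qed

lemma closed_solvable_rhs: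
  fixes c :: "'i::finite \<Rightarrow> 'a::euclidean_space"
  shows "closed {s :: real^'i. \<exists>z. (\<forall>i\<in>E. c i \<bullet> z + s $ i = 0) \<and> (\<forall>i\<in>L. c i \<bullet> z + s $ i \<le> 0)}"
    (is "closed ?P")
proof -
  define col where "col b = (\<chi> i. - (c i \<bullet> b))" for b
  \<comment> \<open>Generators: \<open>z\<close> is free, so its columns occur with both signs; off
    \<open>E\<close> the entry \<open>s $ i\<close> may be decreased; off \<open>E\<close> and
    \<open>L\<close> it is arbitrary.\<close>
  define S where "S = col ` Basis \<union> uminus ` col ` Basis \<union>
     (\<lambda>i. - axis i 1) ` (- E) \<union> (\<lambda>i. axis i 1) ` (- (E \<union> L))"
  have "finite S" unfolding S_def by simp
  have cone: "convex_cone ?P"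
    unfolding convex_cone_iff
  proof (intro conjI allI impI ballI)
    show "0 \<in> ?P" by (auto intro!: exI[of _ "0::'a"])
  next
    fix x y assume "x \<in> ?P" "y \<in> ?P"
    then obtain z z' where z: "\<forall>i\<in>E. c i \<bullet> z + x $ i = 0" "\<forall>i\<in>L. c i \<bullet> z + x $ i \<le> 0"
       "\<forall>i\<in>E. c i \<bullet> z' + y $ i = 0" "\<forall>i\<in>L. c i \<bullet> z' + y $ i \<le> 0" by blast
    have "c i \<bullet> (z + z') + (x + y) $ i = 0" if "i \<in> E" for i
      using z(1,3)[rule_format, OF that] by (simp add: inner_add_right)
    moreover have "c i \<bullet> (z + z') + (x + y) $ i \<le> 0" if "i \<in> L" for i
      using z(2,4)[rule_format, OF that] by (simp add: inner_add_right)
    ultimately show "x + y \<in> ?P" by blast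
  next
    fix x and t :: real assume "x \<in> ?P" "0 \<le> t"
    then obtain z where z: "\<forall>i\<in>E. c i \<bullet> z + x $ i = 0" "\<forall>i\<in>L. c i \<bullet> z + x $ i \<le> 0" by blast
    have "c i \<bullet> (t *\<^sub>R z) + (t *\<^sub>R x) $ i = t * (c i \<bullet> z + x $ i)" for i
      by (simp add: algebra_simps)
    then show "t *\<^sub>R x \<in> ?P" using z \<open>0 \<le> t\<close>
      by (auto intro!: exI[of _ "t *\<^sub>R z"] simp: mult_nonneg_nonpos)
  qed
  have "S \<subseteq> ?P"
  proof -
    have "col b \<in> ?P" for b unfolding col_def by (auto intro!: exI[of _ b])
    moreover have "- col b \<in> ?P" for b unfolding col_def by (auto intro!: exI[of _ "-b"])
    moreover have "- axis i 1 \<in> ?P" if "i \<notin> E" for i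
      using that by (auto intro!: exI[of _ "0::'a"] simp: axis_def)
    moreover have "axis i 1 \<in> ?P" if "i \<notin> E \<union> L" for i
      using that by (auto intro!: exI[of _ "0::'a"] simp: axis_def)
    ultimately show ?thesis unfolding S_def by blast
  qed
  then have sub: "convex_cone hull S \<subseteq> ?P" using cone by (intro hull_minimal)
  have "?P \<subseteq> convex_cone hull S"
  proof
    fix s assume "s \<in> ?P"
    then obtain z where z: "\<forall>i\<in>E. c i \<bullet> z + s $ i = 0" "\<forall>i\<in>L. c i \<bullet> z + s $ i \<le> 0" by blast
    have hull: "convex_cone (convex_cone hull S)" by (rule convex_cone_convex_cone_hull)
    have 1: "(\<Sum>b\<in>Basis. (z \<bullet> b) *\<^sub>R col b) \<in> convex_cone hull S"
    proof (rule sum_in_convex_cone[OF hull])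
      fix b :: 'a assume b: "b \<in> Basis"
      show "(z \<bullet> b) *\<^sub>R col b \<in> convex_cone hull S"
      proof (cases "z \<bullet> b \<ge> 0")
        case True
        then show ?thesis using b by (intro convex_cone_hull_mul hull_inc) (auto simp: S_def)
      next
        case False
        then have "(- (z \<bullet> b)) *\<^sub>R (- col b) \<in> convex_cone hull S"
          using b by (intro convex_cone_hull_mul hull_inc) (auto simp: S_def)
        then show ?thesis by simp
      qed
    qed
    define r where "r i = s $ i + c i \<bullet> z" for i
    have 2: "(\<Sum>i\<in>UNIV. r i *\<^sub>R axis i 1) \<in> convex_cone hull S"
    proof (rule sum_in_convex_cone[OF hull])
      fix i
      consider "i \<in> E" | "i \<notin> E" "r i \<le> 0" | "i \<notin> E \<union> L" "r i \<ge> 0"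
        using z by (force simp: r_def)
      then show "r i *\<^sub>R axis i 1 \<in> convex_cone hull S"
      proof cases
        case 1 then show ?thesis using z by (simp add: r_def convex_cone_hull_contains_0 add.commute)
      next
        case 2
        then have "(- r i) *\<^sub>R (- axis i 1) \<in> convex_cone hull S"
          by (intro convex_cone_hull_mul hull_inc) (auto simp: S_def)
        then show ?thesis by simp
      next
        case 3
        then show ?thesis by (intro convex_cone_hull_mul hull_inc) (auto simp: S_def)
      qed
    qed
    have "s = (\<Sum>b\<in>Basis. (z \<bullet> b) *\<^sub>R col b) + (\<Sum>i\<in>UNIV. r i *\<^sub>R axis i 1)"
    proof (subst vec_eq_iff, intro allI)
      fix j
      have "(\<Sum>b\<in>Basis. (z \<bullet> b) * (c j \<bullet> b)) = c j \<bullet> z"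
        by (simp add: euclidean_inner[of "c j" z] mult.commute)
      then show "s $ j = ((\<Sum>b\<in>Basis. (z \<bullet> b) *\<^sub>R col b) + (\<Sum>i\<in>UNIV. r i *\<^sub>R axis i 1)) $ j"
        by (simp add: col_def r_def axis_def sum_negf if_distrib[where f="\<lambda>x. _ * x"] cong: if_cong)
    qed
    then show "s \<in> convex_cone hull S"
      using convex_cone_hull_add[OF 1 2] by simp
  qed
  with sub have "?P = convex_cone hull S" by blast
  then show ?thesis using closed_convex_cone_hull[OF \<open>finite S\<close>] by simp
qed

text \<open>Typically used with \<open>z k\<close> of order 1/t for t tending to 0: solvability
  survives in the limit although the solutions do not.\<close>

lemma solvable_rhs_limit:
  fixes c :: "'i::finite \<Rightarrow> 'a::euclidean_space" and s :: "nat \<Rightarrow> 'i \<Rightarrow> real"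
  assumes lim: "\<And>i. i \<in> E \<union> L \<Longrightarrow> (\<lambda>k. s k i) \<longlonglongrightarrow> s' i"
    and sol: "\<And>k. (\<forall>i\<in>E. c i \<bullet> z k + s k i = 0) \<and> (\<forall>i\<in>L. c i \<bullet> z k + s k i \<le> 0)"
  shows "\<exists>z. (\<forall>i\<in>E. c i \<bullet> z + s' i = 0) \<and> (\<forall>i\<in>L. c i \<bullet> z + s' i \<le> 0)"
proof -
  let ?P = "{s :: real^'i. \<exists>z. (\<forall>i\<in>E. c i \<bullet> z + s $ i = 0) \<and> (\<forall>i\<in>L. c i \<bullet> z + s $ i \<le> 0)}"
  \<comment> \<open>Entries outside \<open>E \<union> L\<close> carry no convergence assumption and
    are replaced by 0.\<close>
  let ?r = "\<lambda>s. (\<chi> i. if i \<in> E \<union> L then s i else 0) :: real^'i"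
  have r: "(\<lambda>k. ?r (s k)) \<longlonglongrightarrow> ?r s'"
    by (intro vec_tendstoI) (auto intro: lim)
  have mem: "?r (s k) \<in> ?P" for k
    using sol[of k] by (auto intro!: exI[of _ "z k"])
  have "?r s' \<in> ?P"
    by (rule closed_sequentially[OF closed_solvable_rhs mem r])
  then show ?thesis by auto
qed

text \<open>Linear programming duality for maximizing \<open>y \<bullet> z\<close>: the given
  \<open>l\<close> bounds the value, closedness of the solvable right-hand sides makes it attained,
  and Farkas' lemma over the constraints active at a maximizer gives a multiplier with complementary
  slackness.\<close>

lemma linear_program_multiplier:
  fixes c :: "'i::finite \<Rightarrow> 'a::euclidean_space" and h :: "'i \<Rightarrow> real"
  assumes feas: "\<exists>z. \<forall>i\<in>A. c i \<bullet> z + h i \<le> 0"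
    and l: "\<And>i. l i \<ge> 0" and y: "y = (\<Sum>i\<in>A. l i *\<^sub>R c i)"
  obtains z m where "\<And>i. i \<in> A \<Longrightarrow> c i \<bullet> z + h i \<le> 0" "\<And>i. m i \<ge> 0" "\<And>i. i \<notin> A \<Longrightarrow> m i = 0"
    "\<And>i. m i > 0 \<Longrightarrow> c i \<bullet> z + h i = 0" "y = (\<Sum>i\<in>A. m i *\<^sub>R c i)"
proof -
  let ?X = "{z. \<forall>i\<in>A. c i \<bullet> z + h i \<le> 0}"
  let ?V = "(\<lambda>z. y \<bullet> z) ` ?X"
  have bd: "y \<bullet> z \<le> - (\<Sum>i\<in>A. l i * h i)" if "z \<in> ?X" for z
  proof -
    have "y \<bullet> z = (\<Sum>i\<in>A. l i * (c i \<bullet> z))" unfolding y by (simp add: inner_sum_left)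
    also have "\<dots> \<le> (\<Sum>i\<in>A. l i * (- h i))"
      using that l by (intro sum_mono mult_left_mono) (auto simp: algebra_simps)
    finally show ?thesis by (simp add: sum_negf)
  qed
  have ne: "?V \<noteq> {}" and bdd: "bdd_above ?V" using feas bd by (auto simp: bdd_above_def)
  obtain v where v: "\<And>n. v n \<in> ?V" "v \<longlonglongrightarrow> Sup ?V"
    using closure_contains_Sup[OF ne bdd] unfolding closure_sequential by blast
  have "\<forall>n. \<exists>z. z \<in> ?X \<and> v n = y \<bullet> z" using v(1) by blast
  from choice[OF this] obtain z where z: "\<And>n. z n \<in> ?X" "\<And>n. v n = y \<bullet> z n" by blast
  \<comment> \<open>The extra index \<open>None\<close> encodes the bound
    \<open>y \<bullet> z \<ge> v n\<close>, so that attainment of the supremum becomes solvability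
    in the limit.\<close>
  define c' where "c' = case_option (- y) c"
  define s where "s n = case_option (v n) h" for n
  have "\<exists>z. (\<forall>i\<in>{}. c' i \<bullet> z + case_option (Sup ?V) h i = 0) \<and>
      (\<forall>i\<in>insert None (Some ` A). c' i \<bullet> z + case_option (Sup ?V) h i \<le> 0)"
  proof (rule solvable_rhs_limit[where z = z and s = s])
    fix i assume "i \<in> {} \<union> insert None (Some ` A)"
    then show "(\<lambda>k. s k i) \<longlonglongrightarrow> case_option (Sup ?V) h i" unfolding s_def by (cases i) (auto intro: v)
  next
    fix k
    show "(\<forall>i\<in>{}. c' i \<bullet> z k + s k i = 0) \<and> (\<forall>i\<in>insert None (Some ` A). c' i \<bullet> z k + s k i \<le> 0)"
      using z[of k] by (auto simp: c'_def s_def)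
  qed
  then obtain z0 where z0: "z0 \<in> ?X" "y \<bullet> z0 \<ge> Sup ?V" by (auto simp: c'_def)
  let ?J = "{i\<in>A. c i \<bullet> z0 + h i = 0}"
  have "\<exists>m. (\<forall>i. 0 \<le> m i) \<and> (\<forall>i. i \<notin> ?J \<longrightarrow> m i = 0) \<and> y = (\<Sum>i\<in>?J. m i *\<^sub>R c i)"
  proof (rule farkas)
    \<comment> \<open>Constraints outside \<open>?J\<close> are strict at \<open>z0\<close> and
      survive a short step along \<open>d\<close>. So \<open>d\<close> is a feasible direction, and
      the linear form cannot increase along it.\<close>
    fix d assume d: "\<And>i. i \<in> ?J \<Longrightarrow> c i \<bullet> d \<le> 0"
    have "\<forall>\<^sub>F e in at_right 0. c i \<bullet> (z0 + e *\<^sub>R d) + h i \<le> 0" if "i \<in> A" for i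
    proof (cases "i \<in> ?J")
      case True
      show ?thesis
        using eventually_at_right_less[of 0] 
      proof eventually_elim
        case (elim e)
        then have "e * (c i \<bullet> d) \<le> 0" using d[OF True] by (simp add: mult_nonneg_nonpos)
        then show ?case using True by (simp add: inner_add_right)
      qed
    next
      case False
      then have "c i \<bullet> z0 + h i < 0" using z0 that by force
      moreover have "((\<lambda>e. c i \<bullet> (z0 + e *\<^sub>R d) + h i) \<longlongrightarrow> c i \<bullet> (z0 + 0 *\<^sub>R d) + h i) (at_right 0)"
        by (intro tendsto_intros)
      ultimately have "\<forall>\<^sub>F e in at_right 0. c i \<bullet> (z0 + e *\<^sub>R d) + h i < 0"
        by (auto dest!: order_tendstoD)
      then show ?thesis by eventually_elim simp
    qed
    then have "\<forall>\<^sub>F e in at_right 0. \<forall>i\<in>A. c i \<bullet> (z0 + e *\<^sub>R d) + h i \<le> 0"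
      by (intro eventually_ball_finite) auto
    then have "\<forall>\<^sub>F e in at_right (0::real). e > 0 \<and> z0 + e *\<^sub>R d \<in> ?X"
      using eventually_at_right_less[of 0] by eventually_elim auto
    then obtain e where e: "e > 0" "z0 + e *\<^sub>R d \<in> ?X"
      using eventually_happens'[OF trivial_limit_at_right_real] by blast
    then have "y \<bullet> (z0 + e *\<^sub>R d) \<le> Sup ?V" using bdd by (intro cSup_upper) auto
    then have "e * (y \<bullet> d) \<le> 0" using z0(2) by (simp add: inner_add_right)
    then show "y \<bullet> d \<le> 0" using e(1) by (simp add: mult_le_0_iff)
  qed simp
  then obtain m where m: "\<And>i. 0 \<le> m i" "\<And>i. i \<notin> ?J \<Longrightarrow> m i = 0" "y = (\<Sum>i\<in>?J. m i *\<^sub>R c i)" by blast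
  show ?thesis
  proof (rule that)
    show "c i \<bullet> z0 + h i \<le> 0" if "i \<in> A" for i using z0(1) that by blast
    show "m i \<ge> 0" for i by (rule m(1))
    show "m i = 0" if "i \<notin> A" for i using m(2) that by blast
    show "c i \<bullet> z0 + h i = 0" if "m i > 0" for i using m(2)[of i] that by force
    show "y = (\<Sum>i\<in>A. m i *\<^sub>R c i)" unfolding m(3) using m(2) by (intro sum.mono_neutral_left) auto
  qed
qed

section \<open>Sequences, expansions and zeros\<close>

lemma constant_subsequence:
  fixes f :: "nat \<Rightarrow> 'c::finite"
  obtains r c where "strict_mono (r :: nat \<Rightarrow> nat)" "\<And>k. f (r k) = c"
proof -
  have "infinite (UNIV :: nat set)" by simp
  then have "\<exists>c\<in>UNIV. infinite {n. n \<in> UNIV \<and> f n = c}"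
    using pigeonhole_infinite_rel[of UNIV "UNIV :: 'c set" "\<lambda>n c. f n = c"] by auto
  then obtain c where "infinite {n. f n = c}" by auto
  from infinite_enumerate[OF this] obtain r :: "nat \<Rightarrow> nat"
    where r: "strict_mono r" "\<forall>k. r k \<in> {n. f n = c}" by blast
  show ?thesis by (rule that[OF r(1)]) (use r(2) in simp)
qed

text \<open>\<open>v\<close> is merely bounded because the mean value theorem below produces
  directions \<open>s k *\<^sub>R v k\<close> that need not converge.\<close>

lemma derivative_remainder_seq:
  fixes f :: "'a::real_normed_vector \<Rightarrow> 'b::real_normed_vector"
  assumes f: "(f has_derivative f') (at x)"
    and t: "\<And>k. t k > 0" "t \<longlonglongrightarrow> 0" and v: "bounded (range v)"
  shows "(\<lambda>k. (1 / t k) *\<^sub>R (f (x + t k *\<^sub>R v k) - f x - f' (t k *\<^sub>R v k))) \<longlonglongrightarrow> 0"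
proof (rule tendstoI)
  fix e :: real assume "e > 0"
  obtain B where B: "B > 0" "\<And>k. norm (v k) \<le> B" using v by (auto simp: bounded_pos)
  have "e / (2 * B) > 0" using \<open>e > 0\<close> B by simp
  then obtain d where d: "d > 0"
    "\<And>y. norm (y - x) < d \<Longrightarrow> norm (f y - f x - f' (y - x)) \<le> e / (2 * B) * norm (y - x)"
    using f unfolding has_derivative_at_alt by blast
  have "\<forall>\<^sub>F k in sequentially. t k < d / B"
    using t(2) d(1) B(1) by (intro order_tendstoD(2)) auto
  then show "\<forall>\<^sub>F k in sequentially.
      dist ((1 / t k) *\<^sub>R (f (x + t k *\<^sub>R v k) - f x - f' (t k *\<^sub>R v k))) 0 < e"
  proof eventually_elim
    case (elim k)
    have n: "norm (t k *\<^sub>R v k) \<le> t k * B" using t(1)[of k] B(2)[of k] by simp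
    also have "\<dots> < d" using elim B(1) by (simp add: field_simps)
    finally have "norm (f (x + t k *\<^sub>R v k) - f x - f' (t k *\<^sub>R v k)) \<le> e / (2 * B) * norm (t k *\<^sub>R v k)"
      using d(2)[of "x + t k *\<^sub>R v k"] by simp
    also have "\<dots> \<le> e / (2 * B) * (t k * B)" using n \<open>e > 0\<close> B by (intro mult_left_mono) auto
    also have "\<dots> < e * t k" using \<open>e > 0\<close> B t(1)[of k] by simp
    finally show ?case using t(1)[of k] by (simp add: pos_divide_less_eq del: scaleR_diff_right)
  qed
qed

lemma derivative_seq:
  fixes f :: "'a::real_normed_vector \<Rightarrow> 'b::real_normed_vector"
  assumes f: "(f has_derivative f') (at x)"
    and t: "\<And>k. t k > 0" "t \<longlonglongrightarrow> 0" and v: "v \<longlonglongrightarrow> v'"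
  shows "(\<lambda>k. (1 / t k) *\<^sub>R (f (x + t k *\<^sub>R v k) - f x)) \<longlonglongrightarrow> f' v'"
proof -
  interpret bounded_linear f' using f by (rule has_derivative_bounded_linear)
  have "bounded (range v)" using v by (simp add: convergent_imp_bounded)
  from tendsto_add[OF derivative_remainder_seq[OF f t this] tendsto[OF v]]
  show ?thesis using t(1) by (simp add: scaleR scaleR_diff_right less_imp_neq[THEN not_sym])
qed

text \<open>Second order Taylor expansion from differentiability of the gradient at the single point
  \<open>x\<close>. Subtracting the quadratic model before applying the mean value theorem turns the
  error into the first order remainder of \<open>g\<close>.\<close>

lemma second_order_seq:
  fixes f :: "'a::real_inner \<Rightarrow> real"
  assumes f: "\<And>y. (f has_derivative (\<lambda>h. g y \<bullet> h)) (at y)"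
    and g: "(g has_derivative g') (at x)"
    and t: "\<And>k. t k > 0" "t \<longlonglongrightarrow> 0" and v: "v \<longlonglongrightarrow> v'"
  shows "(\<lambda>k. (f (x + t k *\<^sub>R v k) - f x - t k * (g x \<bullet> v k)) / (t k)\<^sup>2) \<longlonglongrightarrow> (v' \<bullet> g' v') / 2"
proof -
  interpret bounded_linear g' using g by (rule has_derivative_bounded_linear)
  let ?q = "\<lambda>h. (h \<bullet> g' h) / 2"
  have "\<exists>s\<in>{0..1}. f (x + h) - f x - g x \<bullet> h - ?q h = (g (x + s *\<^sub>R h) - g x - g' (s *\<^sub>R h)) \<bullet> h" for h
  proof -
    let ?p = "\<lambda>s. f (x + s *\<^sub>R h) - s * (g x \<bullet> h) - s\<^sup>2 * ?q h"
    have "\<exists>s\<in>{0..1}. ?p 1 - ?p 0 = (\<lambda>r. r * ((g (x + s *\<^sub>R h) - g x - g' (s *\<^sub>R h)) \<bullet> h)) (1 - 0)"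
    proof (rule mvt_very_simple)
      fix s :: real
      have 1: "((\<lambda>s. f (x + s *\<^sub>R h)) has_derivative (\<lambda>r. g (x + s *\<^sub>R h) \<bullet> (r *\<^sub>R h))) (at s within {0..1})"
        by (rule has_derivative_compose[where g = f, OF _ f]) (auto intro!: derivative_eq_intros)
      show "(?p has_derivative (\<lambda>r. r * ((g (x + s *\<^sub>R h) - g x - g' (s *\<^sub>R h)) \<bullet> h))) (at s within {0..1})"
        by (rule derivative_eq_intros 1 refl ext)+
          (simp add: algebra_simps scaleR power2_eq_square inner_commute[of h])
    qed simp
    then show ?thesis by (simp add: algebra_simps)
  qed
  then have "\<forall>k. \<exists>s. s \<in> {0..1} \<and> f (x + t k *\<^sub>R v k) - f x - g x \<bullet> (t k *\<^sub>R v k) - ?q (t k *\<^sub>R v k)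
      = (g (x + t k *\<^sub>R s *\<^sub>R v k) - g x - g' (t k *\<^sub>R s *\<^sub>R v k)) \<bullet> (t k *\<^sub>R v k)"
    unfolding Bex_def by (subst (1 2) scaleR_left_commute) blast
  from choice[OF this] obtain s where s: "\<And>k. s k \<in> {0..1}"
    "\<And>k. f (x + t k *\<^sub>R v k) - f x - g x \<bullet> (t k *\<^sub>R v k) - ?q (t k *\<^sub>R v k)
      = (g (x + t k *\<^sub>R s k *\<^sub>R v k) - g x - g' (t k *\<^sub>R s k *\<^sub>R v k)) \<bullet> (t k *\<^sub>R v k)" by blast
  have "bounded (range v)" using v by (simp add: convergent_imp_bounded)
  then obtain B where "\<And>k. norm (v k) \<le> B" by (auto simp: bounded_iff)
  then have "norm (s k *\<^sub>R v k) \<le> B" for k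
    using s(1)[of k] mult_left_le_one_le[of "norm (v k)" "s k"] by (auto intro: order_trans)
  then have "bounded (range (\<lambda>k. s k *\<^sub>R v k))" by (auto simp: bounded_iff)
  note r = tendsto_inner[OF derivative_remainder_seq[OF g t this] v]
  have "(\<lambda>k. ?q (v k)) \<longlonglongrightarrow> ?q v'" by (intro tendsto_intros v tendsto) simp
  from tendsto_add[OF r this]
  have "(\<lambda>k. ((1 / t k) *\<^sub>R (g (x + t k *\<^sub>R s k *\<^sub>R v k) - g x - g' (t k *\<^sub>R s k *\<^sub>R v k))) \<bullet> v k
      + ?q (v k)) \<longlonglongrightarrow> ?q v'" by simp
  also have "(\<lambda>k. ((1 / t k) *\<^sub>R (g (x + t k *\<^sub>R s k *\<^sub>R v k) - g x - g' (t k *\<^sub>R s k *\<^sub>R v k))) \<bullet> v k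
      + ?q (v k)) = (\<lambda>k. (f (x + t k *\<^sub>R v k) - f x - t k * (g x \<bullet> v k)) / (t k)\<^sup>2)"
  proof
    fix k
    have "t k \<noteq> 0" using t(1)[of k] by simp
    have "f (x + t k *\<^sub>R v k) - f x - t k * (g x \<bullet> v k) = (t k)\<^sup>2 * ?q (v k)
      + t k * ((g (x + t k *\<^sub>R s k *\<^sub>R v k) - g x - g' (t k *\<^sub>R s k *\<^sub>R v k)) \<bullet> v k)"
      using s(2)[of k] by (simp add: scaleR power2_eq_square)
    then show "((1 / t k) *\<^sub>R (g (x + t k *\<^sub>R s k *\<^sub>R v k) - g x - g' (t k *\<^sub>R s k *\<^sub>R v k))) \<bullet> v k
      + ?q (v k) = (f (x + t k *\<^sub>R v k) - f x - t k * (g x \<bullet> v k)) / (t k)\<^sup>2"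
      using \<open>t k \<noteq> 0\<close> by (simp add: add_divide_distrib power2_eq_square)
  qed
  finally show ?thesis .
qed

text \<open>By the mean value theorem in direction \<open>a\<close>, the second difference divided
  by \<open>(t k)\<^sup>2\<close> tends to \<open>a \<bullet> g' b\<close>. The difference is
  symmetric in \<open>a\<close> and \<open>b\<close>, hence so is the limit.\<close>

lemma derivative_of_gradient_symmetric:
  fixes f :: "'a::real_inner \<Rightarrow> real"
  assumes f: "\<And>y. (f has_derivative (\<lambda>h. g y \<bullet> h)) (at y)"
    and g: "(g has_derivative g') (at x)"
  shows "a \<bullet> g' b = b \<bullet> g' a"
proof -
  interpret bounded_linear g' using g by (rule has_derivative_bounded_linear)
  define t where "t k = 1 / real (Suc k)" for k
  have t: "\<And>k. t k > 0" "t \<longlonglongrightarrow> 0"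
    unfolding t_def using LIMSEQ_inverse_real_of_nat by (auto simp: field_simps)
  have half: "(\<lambda>k. (f (x + t k *\<^sub>R a + t k *\<^sub>R b) - f (x + t k *\<^sub>R a) - f (x + t k *\<^sub>R b) + f x) / (t k)\<^sup>2)
      \<longlonglongrightarrow> a \<bullet> g' b" for a b
  proof -
    have "\<exists>s\<in>{0..1}. f (x + t k *\<^sub>R a + t k *\<^sub>R b) - f (x + t k *\<^sub>R a) - f (x + t k *\<^sub>R b) + f x
       = (g (x + t k *\<^sub>R (s *\<^sub>R a + b)) - g (x + t k *\<^sub>R s *\<^sub>R a)) \<bullet> (t k *\<^sub>R a)" for k
    proof -
      let ?p = "\<lambda>s. f (x + t k *\<^sub>R (s *\<^sub>R a + b)) - f (x + t k *\<^sub>R s *\<^sub>R a)"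
      have "\<exists>s\<in>{0..1}. ?p 1 - ?p 0 =
        (\<lambda>r. r * ((g (x + t k *\<^sub>R (s *\<^sub>R a + b)) - g (x + t k *\<^sub>R s *\<^sub>R a)) \<bullet> (t k *\<^sub>R a))) (1 - 0)"
      proof (rule mvt_very_simple)
        fix s :: real
        have 1: "((\<lambda>s. f (x + t k *\<^sub>R (s *\<^sub>R a + b))) has_derivative
            (\<lambda>r. g (x + t k *\<^sub>R (s *\<^sub>R a + b)) \<bullet> (t k *\<^sub>R r *\<^sub>R a))) (at s within {0..1})"
          by (rule has_derivative_compose[where g = f, OF _ f]) (auto intro!: derivative_eq_intros)
        have 2: "((\<lambda>s. f (x + t k *\<^sub>R s *\<^sub>R a)) has_derivative
            (\<lambda>r. g (x + t k *\<^sub>R s *\<^sub>R a) \<bullet> (t k *\<^sub>R r *\<^sub>R a))) (at s within {0..1})"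
          by (rule has_derivative_compose[where g = f, OF _ f]) (auto intro!: derivative_eq_intros)
        show "(?p has_derivative (\<lambda>r. r * ((g (x + t k *\<^sub>R (s *\<^sub>R a + b)) - g (x + t k *\<^sub>R s *\<^sub>R a))
            \<bullet> (t k *\<^sub>R a)))) (at s within {0..1})"
          by (rule derivative_eq_intros 1 2 refl ext)+ (simp add: algebra_simps)
      qed simp
      then show ?thesis by (simp add: algebra_simps)
    qed
    then have "\<forall>k. \<exists>s. s \<in> {0..1} \<and>
       f (x + t k *\<^sub>R a + t k *\<^sub>R b) - f (x + t k *\<^sub>R a) - f (x + t k *\<^sub>R b) + f x
       = (g (x + t k *\<^sub>R (s *\<^sub>R a + b)) - g (x + t k *\<^sub>R s *\<^sub>R a)) \<bullet> (t k *\<^sub>R a)" by blast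
    from choice[OF this] obtain s where s: "\<And>k. s k \<in> {0..1}"
      "\<And>k. f (x + t k *\<^sub>R a + t k *\<^sub>R b) - f (x + t k *\<^sub>R a) - f (x + t k *\<^sub>R b) + f x
       = (g (x + t k *\<^sub>R (s k *\<^sub>R a + b)) - g (x + t k *\<^sub>R s k *\<^sub>R a)) \<bullet> (t k *\<^sub>R a)" by blast
    have sa: "norm (s k *\<^sub>R a) \<le> norm a" for k
      using s(1)[of k] mult_left_le_one_le[of "norm a" "s k"] by auto
    then have 1: "bounded (range (\<lambda>k. s k *\<^sub>R a))" by (auto simp: bounded_iff)
    have "norm (s k *\<^sub>R a + b) \<le> norm a + norm b" for k using sa[of k] norm_triangle_mono by blast
    then have 2: "bounded (range (\<lambda>k. s k *\<^sub>R a + b))" by (auto simp: bounded_iff)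
    have "(\<lambda>k. a \<bullet> ((1 / t k) *\<^sub>R (g (x + t k *\<^sub>R (s k *\<^sub>R a + b)) - g x - g' (t k *\<^sub>R (s k *\<^sub>R a + b)))
       - (1 / t k) *\<^sub>R (g (x + t k *\<^sub>R s k *\<^sub>R a) - g x - g' (t k *\<^sub>R s k *\<^sub>R a)) + g' b))
       \<longlonglongrightarrow> a \<bullet> (0 - 0 + g' b)"
      by (intro tendsto_intros derivative_remainder_seq[OF g t 1] derivative_remainder_seq[OF g t 2])
    also have "(\<lambda>k. a \<bullet> ((1 / t k) *\<^sub>R (g (x + t k *\<^sub>R (s k *\<^sub>R a + b)) - g x - g' (t k *\<^sub>R (s k *\<^sub>R a + b)))
       - (1 / t k) *\<^sub>R (g (x + t k *\<^sub>R s k *\<^sub>R a) - g x - g' (t k *\<^sub>R s k *\<^sub>R a)) + g' b))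
      = (\<lambda>k. (f (x + t k *\<^sub>R a + t k *\<^sub>R b) - f (x + t k *\<^sub>R a) - f (x + t k *\<^sub>R b) + f x) / (t k)\<^sup>2)"
    proof
      fix k
      have "t k \<noteq> 0" using t(1)[of k] by simp
      have "(1 / t k) *\<^sub>R (g (x + t k *\<^sub>R (s k *\<^sub>R a + b)) - g x - g' (t k *\<^sub>R (s k *\<^sub>R a + b)))
        - (1 / t k) *\<^sub>R (g (x + t k *\<^sub>R s k *\<^sub>R a) - g x - g' (t k *\<^sub>R s k *\<^sub>R a)) + g' b
        = (1 / t k) *\<^sub>R (g (x + t k *\<^sub>R (s k *\<^sub>R a + b)) - g (x + t k *\<^sub>R s k *\<^sub>R a))"
        using \<open>t k \<noteq> 0\<close> by (simp add: scaleR add scaleR_diff_right scaleR_add_right)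
      then show "a \<bullet> ((1 / t k) *\<^sub>R (g (x + t k *\<^sub>R (s k *\<^sub>R a + b)) - g x - g' (t k *\<^sub>R (s k *\<^sub>R a + b)))
       - (1 / t k) *\<^sub>R (g (x + t k *\<^sub>R s k *\<^sub>R a) - g x - g' (t k *\<^sub>R s k *\<^sub>R a)) + g' b)
      = (f (x + t k *\<^sub>R a + t k *\<^sub>R b) - f (x + t k *\<^sub>R a) - f (x + t k *\<^sub>R b) + f x) / (t k)\<^sup>2"
        unfolding s(2)[of k] using \<open>t k \<noteq> 0\<close> by (simp add: inner_commute[of a] power2_eq_square)
    qed
    finally show ?thesis by simp
  qed
  have eq: "(\<lambda>k. (f (x + t k *\<^sub>R a + t k *\<^sub>R b) - f (x + t k *\<^sub>R a) - f (x + t k *\<^sub>R b) + f x) / (t k)\<^sup>2)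
     = (\<lambda>k. (f (x + t k *\<^sub>R b + t k *\<^sub>R a) - f (x + t k *\<^sub>R b) - f (x + t k *\<^sub>R a) + f x) / (t k)\<^sup>2)"
    by (simp add: algebra_simps)
  show ?thesis by (rule LIMSEQ_unique[OF half[of a b]]) (subst eq, rule half)
qed

text \<open>A zero of \<open>f t\<close> is a fixed point of a - f t a. On the ball of radius e with
  |C| e < 1 this map is, for small t, close to a - F a, whose norm is at most |C| e^2 < e. So it
  maps the ball into itself and Brouwer's theorem applies.\<close>

lemma small_zeros:
  fixes f :: "real \<Rightarrow> 'a::euclidean_space \<Rightarrow> 'a"
  assumes cont: "\<And>t. continuous_on UNIV (f t)"
    and lim: "\<And>t a a'. (\<And>k. t k > 0) \<Longrightarrow> t \<longlonglongrightarrow> 0 \<Longrightarrow> a \<longlonglongrightarrow> a' \<Longrightarrow> (\<lambda>k::nat. f (t k) (a k)) \<longlonglongrightarrow> F a'"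
    and F: "\<And>a. norm (F a - a) \<le> C * (norm a)\<^sup>2"
  obtains t a where "\<And>k. t k > 0" "t \<longlonglongrightarrow> 0" "a \<longlonglongrightarrow> 0" "\<And>k::nat. f (t k) (a k) = 0"
proof -
  have ex: "\<exists>t>0. t < e \<and> (\<exists>a. norm a \<le> e \<and> f t a = 0)" if e: "e > 0" "\<bar>C\<bar> * e < 1" for e
  proof -
    \<comment> \<open>The convergence in \<open>lim\<close> is joint in \<open>t\<close> and
      \<open>a\<close>; compactness of the ball turns it into a bound uniform in
      \<open>a\<close>.\<close>
    have "\<exists>d>0. \<forall>t a. 0 < t \<and> t < d \<and> norm a \<le> e \<longrightarrow> norm (f t a - a) \<le> e"
    proof (rule ccontr)
      assume "\<not> ?thesis"
      then have "\<forall>n::nat. \<exists>ta. 0 < fst ta \<and> fst ta < 1 / real (Suc n) \<and> norm (snd ta) \<le> e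
          \<and> norm (f (fst ta) (snd ta) - snd ta) > e"
        by (force simp: not_le)
      from choice[OF this] obtain ta where ta: "\<And>n::nat. 0 < fst (ta n) \<and> fst (ta n) < 1 / real (Suc n)
          \<and> norm (snd (ta n)) \<le> e \<and> norm (f (fst (ta n)) (snd (ta n)) - snd (ta n)) > e" by blast
      have "\<And>n. (snd \<circ> ta) n \<in> cball 0 e" using ta by simp
      then obtain a r where a: "a \<in> cball 0 e" "strict_mono r" "(snd \<circ> ta \<circ> r) \<longlonglongrightarrow> a"
        using compact_cball compact_def by metis
      have "(\<lambda>n. fst (ta n)) \<longlonglongrightarrow> 0"
        by (rule tendsto_sandwich[OF _ _ tendsto_const LIMSEQ_inverse_real_of_nat])
          (use ta in \<open>auto intro!: always_eventually less_imp_le simp: inverse_eq_divide\<close>)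
      then have "(\<lambda>k. fst (ta (r k))) \<longlonglongrightarrow> 0" using LIMSEQ_subseq_LIMSEQ[OF _ a(2)] by (auto simp: o_def)
      moreover have a3: "(\<lambda>k. snd (ta (r k))) \<longlonglongrightarrow> a" using a(3) by (simp add: o_def)
      ultimately have "(\<lambda>k. f (fst (ta (r k))) (snd (ta (r k)))) \<longlonglongrightarrow> F a" using ta by (intro lim) auto
      then have "(\<lambda>k. norm (f (fst (ta (r k))) (snd (ta (r k))) - snd (ta (r k)))) \<longlonglongrightarrow> norm (F a - a)"
        by (intro tendsto_intros a3)
      then have ge: "e \<le> norm (F a - a)"
        by (rule tendsto_lowerbound) (use ta in \<open>auto intro!: always_eventually less_imp_le\<close>)
      have "norm (F a - a) \<le> \<bar>C\<bar> * e * e"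
      proof -
        have "norm (F a - a) \<le> \<bar>C\<bar> * (norm a)\<^sup>2"
          using F[of a] by (rule order_trans) (simp add: mult_right_mono)
        also have "\<dots> \<le> \<bar>C\<bar> * e\<^sup>2" using a(1) by (intro mult_left_mono power_mono) auto
        finally show ?thesis by (simp add: power2_eq_square)
      qed
      also have "\<dots> < 1 * e" using e by (intro mult_strict_right_mono) auto
      finally show False using ge by simp
    qed
    then obtain d where d: "d > 0" "\<And>t a. 0 < t \<Longrightarrow> t < d \<Longrightarrow> norm a \<le> e \<Longrightarrow> norm (f t a - a) \<le> e" by blast
    define t where "t = min (d / 2) (e / 2)"
    have t: "0 < t" "t < d" "t < e" using d e by (auto simp: t_def)
    have "continuous_on (cball 0 e) (\<lambda>a. a - f t a)"
      by (intro continuous_intros continuous_on_subset[OF cont]) auto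
    moreover have "(\<lambda>a. a - f t a) \<in> cball 0 e \<rightarrow> cball 0 e"
      using d(2)[OF t(1,2)] by (auto simp: norm_minus_commute)
    ultimately obtain a where "a \<in> cball 0 e" "a - f t a = a"
      using brouwer[of "cball 0 e" "\<lambda>a. a - f t a"] e(1) by auto
    then show ?thesis using t by auto
  qed
  \<comment> \<open>Meets both requirements on the radius: \<open>\<bar>C\<bar> * e n < 1\<close>,
    and \<open>e n\<close> tends to 0.\<close>
  define e where "e n = 1 / (real (Suc n) + \<bar>C\<bar>)" for n
  have e: "e n > 0" "\<bar>C\<bar> * e n < 1" for n by (auto simp: e_def field_simps add_pos_nonneg)
  have e0: "e \<longlonglongrightarrow> 0"
  proof (rule tendsto_sandwich[OF _ _ tendsto_const LIMSEQ_inverse_real_of_nat])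
    show "\<forall>\<^sub>F n in sequentially. 0 \<le> e n" using e(1) by (auto intro!: always_eventually less_imp_le)
    show "\<forall>\<^sub>F n in sequentially. e n \<le> inverse (real (Suc n))"
      by (auto simp: e_def inverse_eq_divide intro!: always_eventually divide_left_mono add_pos_nonneg)
  qed
  have "\<forall>n. \<exists>ta. fst ta > 0 \<and> fst ta < e n \<and> norm (snd ta) \<le> e n \<and> f (fst ta) (snd ta) = 0"
    using ex[OF e] by auto
  from choice[OF this] obtain ta where ta: "\<And>n. fst (ta n) > 0 \<and> fst (ta n) < e n \<and> norm (snd (ta n)) \<le> e n
    \<and> f (fst (ta n)) (snd (ta n)) = 0" by blast
  show ?thesis
  proof (rule that)
    show "fst (ta n) > 0" "f (fst (ta n)) (snd (ta n)) = 0" for n using ta by auto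
    show "(\<lambda>n. fst (ta n)) \<longlonglongrightarrow> 0"
      by (rule tendsto_sandwich[OF _ _ tendsto_const e0]) (use ta in \<open>auto intro!: always_eventually less_imp_le\<close>)
    show "(\<lambda>n. snd (ta n)) \<longlonglongrightarrow> 0"
      by (rule Lim_null_comparison[OF _ e0]) (use ta in auto)
  qed
qed

text \<open>Once the operator norm of the difference to the identity is at most 1/2,
  \<open>c k\<close> shrinks no vector by more than the factor 2; it is then injective and, being
  square, surjective.\<close>

lemma matrix_near_identity:
  fixes c :: "nat \<Rightarrow> real^'l^'l"
  assumes "c \<longlonglongrightarrow> mat 1"
  shows "\<forall>\<^sub>F k in sequentially. surj ((*v) (c k)) \<and> (\<forall>a. norm a \<le> 2 * norm (c k *v a))"
proof -
  \<comment> \<open>The number of entries: entries of size at most 1 / (2 N) give operator norm at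
    most 1/2.\<close>
  define N where "N = real CARD('l) * real CARD('l)"
  have N: "N > 0" by (simp add: N_def)
  have "\<forall>\<^sub>F k in sequentially. norm (c k - mat 1) < 1 / (2 * N)"
    using tendstoD[OF assms, of "1 / (2 * N)"] N by (simp add: dist_norm)
  then show ?thesis
  proof eventually_elim
    case (elim k)
    have "\<bar>(c k - mat 1) $ i $ j\<bar> \<le> 1 / (2 * N)" for i j
      using elim component_le_norm_cart[of "(c k - mat 1) $ i" j] Finite_Cartesian_Product.norm_nth_le[of "c k - mat 1" i]
      by linarith
    then have "onorm ((*v) (c k - mat 1)) \<le> N * (1 / (2 * N))"
      unfolding N_def by (rule onorm_le_matrix_component)
    then have on: "onorm ((*v) (c k - mat 1)) \<le> 1 / 2" using N by simp
    have near: "norm (c k *v a - a) \<le> 1 / 2 * norm a" for a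
      using onorm[OF matrix_vector_mul_bounded_linear[of "c k - mat 1"], of a] on mult_right_mono[OF on, of "norm a"]
      by (simp add: matrix_vector_mult_diff_rdistrib)
    have bd: "norm a \<le> 2 * norm (c k *v a)" for a
      using near[of a] norm_triangle_ineq3[of "c k *v a" a] by linarith
    have inj: "inj ((*v) (c k))"
    proof (rule injI)
      fix a a' assume "c k *v a = c k *v a'"
      then show "a = a'" using bd[of "a - a'"] by (simp add: matrix_vector_mult_diff_distrib)
    qed
    have "surj ((*v) (c k))" using linear_inj_imp_surj[OF _ inj] matrix_vector_mul_linear by blast
    with bd show ?case by blast
  qed
qed

section \<open>Tangents and regular normals\<close>

lemma bounded_subsequence:
  fixes p :: "nat \<Rightarrow> 'a::heine_borel"
  assumes "bounded (range p)"
  obtains l r where "strict_mono (r :: nat \<Rightarrow> nat)" "(\<lambda>k. p (r k)) \<longlonglongrightarrow> l"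
  using bounded_imp_convergent_subsequence[OF assms] by (auto simp: o_def)

lemma tendsto_zero_subsequences:
  fixes p :: "nat \<Rightarrow> 'a::euclidean_space"
  assumes bdd: "bounded (range p)"
    and sub: "\<And>r l. strict_mono (r :: nat \<Rightarrow> nat) \<Longrightarrow> (\<lambda>k. p (r k)) \<longlonglongrightarrow> l \<Longrightarrow> l = 0"
  shows "p \<longlonglongrightarrow> 0"
proof (rule ccontr)
  assume "\<not> p \<longlonglongrightarrow> 0"
  then obtain e where e: "e > 0" "\<not> (\<forall>\<^sub>F k in sequentially. dist (p k) 0 < e)"
    unfolding tendsto_iff by blast
  then have "infinite {k. norm (p k) \<ge> e}"
    by (simp add: eventually_sequentially infinite_nat_iff_unbounded_le not_less)
  from infinite_enumerate[OF this] obtain r :: "nat \<Rightarrow> nat"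
    where r: "strict_mono r" "\<forall>k. r k \<in> {k. norm (p k) \<ge> e}" by blast
  have "bounded (range (\<lambda>k. p (r k)))" by (rule bounded_subset[OF bdd]) auto
  then obtain l s where s: "strict_mono (s :: nat \<Rightarrow> nat)" "(\<lambda>k. p (r (s k))) \<longlonglongrightarrow> l"
    by (rule bounded_subsequence)
  have "l = 0" using sub[of "r \<circ> s" l] r s by (auto simp: strict_mono_o)
  then have "(\<lambda>k. norm (p (r (s k)))) \<longlonglongrightarrow> 0" using tendsto_norm[OF s(2)] by simp
  then have "e \<le> 0" by (rule tendsto_lowerbound) (use r in auto)
  then show False using e by simp
qed

lemma contingent_coneI:
  assumes "\<And>k. t k > 0" "t \<longlonglongrightarrow> 0" "w \<longlonglongrightarrow> u" "\<And>k. z + t k *\<^sub>R w k \<in> \<Omega>"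
  shows "u \<in> contingent_cone \<Omega> z"
  using assms unfolding contingent_cone_def by blast

lemma contingent_coneE:
  assumes "u \<in> contingent_cone \<Omega> z"
  obtains t w where "\<And>k. t k > 0" "t \<longlonglongrightarrow> 0" "w \<longlonglongrightarrow> u" "\<And>k. z + t k *\<^sub>R w k \<in> \<Omega>"
  using assms unfolding contingent_cone_def by blast

lemma contingent_coneI_eventually:
  assumes "\<And>k. t k > 0" "t \<longlonglongrightarrow> 0" "w \<longlonglongrightarrow> u" "\<forall>\<^sub>F k in sequentially. z + t k *\<^sub>R w k \<in> \<Omega>"
  shows "u \<in> contingent_cone \<Omega> z"
proof -
  obtain N where N: "\<And>k. k \<ge> N \<Longrightarrow> z + t k *\<^sub>R w k \<in> \<Omega>"
    using assms(4) unfolding eventually_sequentially by blast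
  show ?thesis
    by (rule contingent_coneI[of "\<lambda>k. t (k + N)" "\<lambda>k. w (k + N)"])
      (use assms N in \<open>auto intro: LIMSEQ_ignore_initial_segment\<close>)
qed

lemma contingent_coneI_points:
  assumes t: "\<And>k. t k > 0" "t \<longlonglongrightarrow> 0" and g: "\<forall>\<^sub>F k in sequentially. g k \<in> \<Omega>"
    and lim: "(\<lambda>k. (1 / t k) *\<^sub>R (g k - z)) \<longlonglongrightarrow> u"
  shows "u \<in> contingent_cone \<Omega> z"
proof (rule contingent_coneI_eventually[OF t lim])
  show "\<forall>\<^sub>F k in sequentially. z + t k *\<^sub>R (1 / t k) *\<^sub>R (g k - z) \<in> \<Omega>"
    using g by eventually_elim (use t in \<open>simp add: less_imp_neq[THEN not_sym]\<close>)
qed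

lemma tendsto_along_direction:
  fixes z :: "'a::real_normed_vector"
  assumes "\<And>k. t k > 0" "t \<longlonglongrightarrow> 0" "w \<longlonglongrightarrow> u" 
  shows "(\<lambda>k. z + t k *\<^sub>R w k) \<longlonglongrightarrow> z"
proof -
  have "(\<lambda>k. z + t k *\<^sub>R w k) \<longlonglongrightarrow> z + 0 *\<^sub>R u" by (intro tendsto_intros assms)
  then show ?thesis by simp
qed

lemma regular_normal_dot:
  assumes "n \<in> regular_normal_cone \<Omega> z" "u \<in> contingent_cone \<Omega> z"
  shows "n \<bullet> u \<le> 0"
  using assms by (auto simp: regular_normal_cone_def negative_polar_def split: if_splits)

lemma regular_normalI:
  assumes "z \<in> \<Omega>" "\<And>u. u \<in> contingent_cone \<Omega> z \<Longrightarrow> n \<bullet> u \<le> 0"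
  shows "n \<in> regular_normal_cone \<Omega> z"
  using assms by (auto simp: regular_normal_cone_def negative_polar_def)

text \<open>First order optimality condition over \<open>G\<close>. Below it produces regular
  normals from penalized extremal problems.\<close>

lemma regular_normal_of_maximizer:
  fixes G :: "'a::real_inner set"
  assumes z: "z \<in> G" and d: "(f has_derivative (\<lambda>h. n \<bullet> h)) (at z)" and "e > 0"
    and max: "\<And>g. g \<in> G \<Longrightarrow> dist g z < e \<Longrightarrow> f g \<le> f z"
  shows "n \<in> regular_normal_cone G z"
proof (rule regular_normalI[OF z])
  fix u assume "u \<in> contingent_cone G z"
  then obtain t w where t: "\<And>k. t k > 0" "t \<longlonglongrightarrow> 0" "w \<longlonglongrightarrow> u" "\<And>k. z + t k *\<^sub>R w k \<in> G"
    by (rule contingent_coneE) blast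
  have "(\<lambda>k. (1 / t k) *\<^sub>R (f (z + t k *\<^sub>R w k) - f z)) \<longlonglongrightarrow> n \<bullet> u"
    by (rule derivative_seq[OF d t(1-3)])
  moreover have "\<forall>\<^sub>F k in sequentially. dist (z + t k *\<^sub>R w k) z < e"
    using tendsto_along_direction[OF t(1-3)] \<open>e > 0\<close> by (rule tendstoD)
  then have "\<forall>\<^sub>F k in sequentially. (1 / t k) *\<^sub>R (f (z + t k *\<^sub>R w k) - f z) \<le> 0"
  proof eventually_elim
    case (elim k)
    have "f (z + t k *\<^sub>R w k) \<le> f z" by (rule max[OF t(4) elim])
    then show ?case using t(1)[of k] by (simp add: divide_le_0_iff)
  qed
  ultimately show "n \<bullet> u \<le> 0" by (rule tendsto_upperbound) simp
qed

text \<open>The points are obtained by maximizing the linear form over the set, with a quadratic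
  penalty for the distance to points along the tangent direction.\<close>

lemma regular_normal_along_tangent:
  fixes G :: "'a::euclidean_space set"
  assumes closed: "closed (G \<inter> cball z \<rho>)" and "\<rho> > 0"
    and n: "n \<in> regular_normal_cone G z" and u: "u \<in> contingent_cone G z" and orth: "n \<bullet> u = 0"
  obtains t g m where "\<And>k. t k > 0" "t \<longlonglongrightarrow> 0" "\<And>k::nat. g k \<in> G"
    "\<And>k. m k \<in> regular_normal_cone G (g k)" "(\<lambda>k. (1 / t k) *\<^sub>R (g k - z)) \<longlonglongrightarrow> u" "m \<longlonglongrightarrow> n"
proof -
  obtain t0 w0 where t0: "\<And>k. t0 k > 0" "t0 \<longlonglongrightarrow> 0" "w0 \<longlonglongrightarrow> u" "\<And>k. z + t0 k *\<^sub>R w0 k \<in> G"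
    using u by (rule contingent_coneE) blast
  \<comment> \<open>This quantity bounds how far the maximizers below lie from \<open>z\<close>.
    Below \<open>\<rho>\<close> they are interior to the ball, so cutting \<open>G\<close> off there
    does not affect the normals.\<close>
  have "(\<lambda>k. norm (t0 k *\<^sub>R w0 k) + norm n * t0 k) \<longlonglongrightarrow> norm (0 *\<^sub>R u) + norm n * 0"
    by (intro tendsto_intros t0)
  then have "\<forall>\<^sub>F k in sequentially. norm (t0 k *\<^sub>R w0 k) + norm n * t0 k < \<rho>"
    using \<open>\<rho> > 0\<close> by (intro order_tendstoD(2)) auto
  then obtain N where N: "\<And>k. k \<ge> N \<Longrightarrow> norm (t0 k *\<^sub>R w0 k) + norm n * t0 k < \<rho>"
    unfolding eventually_sequentially by blast
  define t w where "t k = t0 (k + N)" and "w k = w0 (k + N)" for k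
  have t: "\<And>k. t k > 0" "t \<longlonglongrightarrow> 0" "w \<longlonglongrightarrow> u" "\<And>k. z + t k *\<^sub>R w k \<in> G"
    "\<And>k. norm (t k *\<^sub>R w k) + norm n * t k < \<rho>"
    unfolding t_def w_def using t0 N by (auto intro: LIMSEQ_ignore_initial_segment)
  let ?p = "\<lambda>k. z + t k *\<^sub>R w k"
  let ?C = "G \<inter> cball z \<rho>"
  have pC: "?p k \<in> ?C" for k
  proof -
    have "0 \<le> norm n * t k" using t(1)[of k] by simp
    then show ?thesis using t(4)[of k] t(5)[of k] by (simp add: dist_norm)
  qed
  \<comment> \<open>The weight 1 / t balances the linear gain: it forces a maximizer to lie within
    \<open>norm n * t k\<close> of \<open>?p k\<close>.\<close>
  define f where "f k g = n \<bullet> (g - z) - (g - ?p k) \<bullet> (g - ?p k) / t k" for k g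
  have "compact ?C" using closed by (simp add: compact_eq_bounded_closed bounded_Int)
  moreover have "?C \<noteq> {}" using pC by blast
  ultimately have "\<forall>k. \<exists>g. g \<in> ?C \<and> (\<forall>g'\<in>?C. f k g' \<le> f k g)"
  proof (intro allI)
    fix k assume C: "compact ?C" "?C \<noteq> {}"
    have "continuous_on ?C (f k)" unfolding f_def by (intro continuous_intros) (use t(1) less_imp_neq in force)
    then show "\<exists>g. g \<in> ?C \<and> (\<forall>g'\<in>?C. f k g' \<le> f k g)"
      using continuous_attains_sup[OF C] by blast
  qed
  from choice[OF this] obtain g where g: "\<And>k. g k \<in> ?C" "\<And>k g'. g' \<in> ?C \<Longrightarrow> f k g' \<le> f k (g k)" by blast
  have pen: "(norm (g k - ?p k))\<^sup>2 / t k \<le> n \<bullet> (g k - ?p k)" for k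
    
  proof -
    have "f k (g k) = n \<bullet> (g k - z) - (norm (g k - ?p k))\<^sup>2 / t k"
      by (simp only: f_def power2_norm_eq_inner)
    moreover have "f k (?p k) = n \<bullet> (?p k - z)" by (simp add: f_def)
    ultimately have "(norm (g k - ?p k))\<^sup>2 / t k \<le> n \<bullet> (g k - z) - n \<bullet> (?p k - z)"
      using g(2)[OF pC, of k k] by linarith
    also have "\<dots> = n \<bullet> (g k - ?p k)" by (simp add: inner_diff_right inner_add_right)
    finally show ?thesis .
  qed
  have sq: "(norm (g k - ?p k))\<^sup>2 \<le> t k * (n \<bullet> (g k - ?p k))" for k
    using pen[of k] t(1)[of k] by (simp add: pos_divide_le_eq mult.commute)
  have dist: "norm (g k - ?p k) \<le> norm n * t k" for k
  proof -
    have "norm (g k - ?p k) * norm (g k - ?p k) \<le> (norm n * t k) * norm (g k - ?p k)"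
    proof -
      have "t k * (n \<bullet> (g k - ?p k)) \<le> t k * (norm n * norm (g k - ?p k))"
        using t(1)[of k] by (intro mult_left_mono norm_cauchy_schwarz) simp
      then show ?thesis using sq[of k] by (simp add: power2_eq_square mult_ac)
    qed
    then show ?thesis using t(1)[of k] by (cases "g k - ?p k = 0") (simp_all add: less_imp_le)
  qed
  define s where "s k = (1 / t k) *\<^sub>R (g k - ?p k)" for k
  have gz: "g k - z = t k *\<^sub>R (w k + s k)" for k
    using t(1)[of k] by (simp add: s_def scaleR_add_right)
  have s_le: "norm (s k) \<le> norm n" for k
    using dist[of k] t(1)[of k] by (simp add: s_def pos_divide_le_eq)
  have s2: "(norm (s k))\<^sup>2 \<le> n \<bullet> s k" for k
  proof -
    have "(norm (s k))\<^sup>2 = (norm (g k - ?p k))\<^sup>2 / (t k)\<^sup>2"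
      using t(1)[of k] by (simp add: s_def power_divide)
    also have "\<dots> \<le> t k * (n \<bullet> (g k - ?p k)) / (t k)\<^sup>2" using sq by (intro divide_right_mono) auto
    also have "\<dots> = n \<bullet> s k" using t(1)[of k] by (simp add: s_def power2_eq_square)
    finally show ?thesis .
  qed
  \<comment> \<open>If \<open>s\<close> clusters at l, then u + l is tangent, so n l <= 0 by
    orthogonality of n and u; on the other hand \<open>s2\<close> gives |l|^2 <= n l.\<close>
  have s0: "s \<longlonglongrightarrow> 0"
  proof (rule tendsto_zero_subsequences)
    show "bounded (range s)" using s_le by (auto simp: bounded_iff)
    fix r :: "nat \<Rightarrow> nat" and l assume r: "strict_mono r" "(\<lambda>k. s (r k)) \<longlonglongrightarrow> l"
    note sub = LIMSEQ_subseq_LIMSEQ[OF _ r(1), unfolded o_def]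
    have "u + l \<in> contingent_cone G z"
    proof (rule contingent_coneI)
      show "(\<lambda>k. t (r k)) \<longlonglongrightarrow> 0" by (rule sub[OF t(2)])
      show "(\<lambda>k. w (r k) + s (r k)) \<longlonglongrightarrow> u + l" by (intro tendsto_intros r sub[OF t(3)])
      show "z + t (r k) *\<^sub>R (w (r k) + s (r k)) \<in> G" for k using gz[of "r k"] g(1)[of "r k"]
        by (metis IntD1 add.commute diff_add_cancel)
    qed (rule t(1))
    then have "n \<bullet> l \<le> 0" using regular_normal_dot[OF n] orth by (fastforce simp: inner_add_right)
    moreover have "(norm l)\<^sup>2 \<le> n \<bullet> l"
      by (rule LIMSEQ_le[of "\<lambda>k. (norm (s (r k)))\<^sup>2" _ "\<lambda>k. n \<bullet> s (r k)"])
        (auto intro!: tendsto_intros r s2)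
    ultimately have "(norm l)\<^sup>2 \<le> 0" by linarith
    then show "l = 0" by simp
  qed
  \<comment> \<open>The gradient of \<open>f k\<close> at \<open>g k\<close>; the factor 2 comes
    from the square in the penalty.\<close>
  define m where "m k = n - 2 *\<^sub>R s k" for k
  show ?thesis
  proof (rule that[OF t(1,2)])
    show "g k \<in> G" for k using g by blast
    have "(\<lambda>k. w k + s k) \<longlonglongrightarrow> u + 0" by (intro tendsto_intros t s0)
    then show "(\<lambda>k. (1 / t k) *\<^sub>R (g k - z)) \<longlonglongrightarrow> u"
      unfolding gz using t(1) by (simp add: less_imp_neq[THEN not_sym])
    have "m \<longlonglongrightarrow> n - 2 *\<^sub>R 0" unfolding m_def by (intro tendsto_intros s0)
    then show "m \<longlonglongrightarrow> n" by simp
    show "m k \<in> regular_normal_cone G (g k)" for k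
    proof (rule regular_normal_of_maximizer)
      show "g k \<in> G" using g by blast
      show "(f k has_derivative (\<lambda>h. m k \<bullet> h)) (at (g k))"
        unfolding f_def
        using t(1)[of k]
        by (auto intro!: derivative_eq_intros ext
          simp: m_def s_def inner_diff_left inner_commute[of _ "g k - _"] add_divide_distrib)
      have "dist (g k) z < \<rho>"
      proof -
        have "norm (g k - z) \<le> norm (t k *\<^sub>R w k) + norm (g k - ?p k)"
          using norm_triangle_ineq[of "t k *\<^sub>R w k" "g k - ?p k"] by simp
        then show ?thesis using dist[of k] t(5)[of k] by (simp add: dist_norm)
      qed
      then show "\<rho> - dist (g k) z > 0" by simp
      fix g' assume g': "g' \<in> G" "dist g' (g k) < \<rho> - dist (g k) z"
      then have "g' \<in> ?C" using dist_triangle[of g' z "g k"] by (simp add: dist_commute)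
      then show "f k g' \<le> f k (g k)" by (rule g(2))
    qed
  qed
qed

section \<open>Limits of polar cones\<close>

text \<open>Polarity reverses inclusions: approximating \<open>K'\<close> from inside by the
  \<open>K k\<close> bounds the limits of their polars from outside.\<close>

lemma polar_in_limit:
  fixes K :: "nat \<Rightarrow> 'a::real_inner set"
  assumes x: "\<forall>\<^sub>F k in sequentially. x k \<in> negative_polar (K k)" "x \<longlonglongrightarrow> x'"
    and inner: "\<And>w. w \<in> K' \<Longrightarrow> \<exists>v. (\<forall>\<^sub>F k in sequentially. v k \<in> K k) \<and> v \<longlonglongrightarrow> w"
  shows "x' \<in> negative_polar K'"
  unfolding negative_polar_def
proof safe
  fix w assume "w \<in> K'"
  then obtain v where v: "\<forall>\<^sub>F k in sequentially. v k \<in> K k" "v \<longlonglongrightarrow> w" using inner by blast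
  have "\<forall>\<^sub>F k in sequentially. x k \<bullet> v k \<le> 0"
    using x(1) v(1) by eventually_elim (auto simp: negative_polar_def)
  then show "x' \<bullet> w \<le> 0" by (rule tendsto_upperbound[OF tendsto_inner[OF x(2) v(2)]]) simp
qed

text \<open>Moreau decomposition: \<open>x\<close> minus its projection onto \<open>K k\<close> lies
  in the polar of \<open>K k\<close>. The projections tend to 0, since a cluster point l lies in
  \<open>K'\<close>, where x l <= 0, and satisfies |l|^2 = x l.\<close>

lemma polar_approximable:
  fixes K :: "nat \<Rightarrow> 'a::euclidean_space set"
  assumes K: "\<And>k. convex_cone (K k)" "\<And>k. closed (K k)"
    and outer: "\<And>r w w'. strict_mono (r :: nat \<Rightarrow> nat) \<Longrightarrow> (\<And>k. w k \<in> K (r k)) \<Longrightarrow> w \<longlonglongrightarrow> w' \<Longrightarrow> w' \<in> K'"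
    and x: "x \<in> negative_polar K'"
  obtains y where "\<And>k. y k \<in> negative_polar (K k)" "y \<longlonglongrightarrow> x"
proof -
  define p where "p k = closest_point (K k) x" for k
  have cv: "convex (K k)" for k using K(1) by (simp add: convex_cone_def)
  have 0: "0 \<in> K k" for k using K(1) by (rule convex_cone_contains_0)
  have pK: "p k \<in> K k" for k unfolding p_def using K(2) 0 by (intro closest_point_in_set) auto
  have dot: "(x - p k) \<bullet> (v - p k) \<le> 0" if "v \<in> K k" for v k
    unfolding p_def by (rule closest_point_dot[OF cv K(2) that])
  have le0: "(x - p k) \<bullet> v \<le> 0" if "v \<in> K k" for v k
    using dot[OF convex_cone_add[OF K(1) that pK]] by simp
  have orth: "(x - p k) \<bullet> p k = 0" for k
    using dot[OF 0, of k] le0[OF pK, of k] by simp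
  have sq: "(norm (p k))\<^sup>2 = x \<bullet> p k" for k
    using orth[of k] by (simp add: inner_diff_left power2_norm_eq_inner)
  have le: "norm (p k) \<le> norm x" for k
  proof -
    have "norm (p k) * norm (p k) \<le> norm x * norm (p k)"
      using sq[of k] norm_cauchy_schwarz[of x "p k"] by (simp add: power2_eq_square)
    then show ?thesis by (cases "p k = 0") auto
  qed
  have "p \<longlonglongrightarrow> 0"
  proof (rule tendsto_zero_subsequences)
    show "bounded (range p)" using le by (auto simp: bounded_iff)
    fix r :: "nat \<Rightarrow> nat" and l assume r: "strict_mono r" "(\<lambda>k. p (r k)) \<longlonglongrightarrow> l"
    have "l \<in> K'" by (rule outer[OF r(1) _ r(2)]) (rule pK)
    then have "x \<bullet> l \<le> 0" using x by (simp add: negative_polar_def)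
    moreover have "(norm l)\<^sup>2 = x \<bullet> l"
    proof (rule LIMSEQ_unique)
      show "(\<lambda>k. (norm (p (r k)))\<^sup>2) \<longlonglongrightarrow> (norm l)\<^sup>2" by (intro tendsto_intros r)
      show "(\<lambda>k. (norm (p (r k)))\<^sup>2) \<longlonglongrightarrow> x \<bullet> l" unfolding sq by (intro tendsto_intros r)
    qed
    ultimately have "(norm l)\<^sup>2 \<le> 0" by simp
    then show "l = 0" by simp
  qed
  then have "(\<lambda>k. x - p k) \<longlonglongrightarrow> x - 0" by (intro tendsto_intros)
  then show ?thesis using that[of "\<lambda>k. x - p k"] le0 by (simp add: negative_polar_def)
qed

section \<open>Gradients and Hessians of twice continuously differentiable maps\<close>

lemma linear_axis_sum:
  fixes D :: "real^'m \<Rightarrow> 'b::real_vector"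
  assumes "linear D"
  shows "D h = (\<Sum>j\<in>UNIV. h $ j *\<^sub>R D (axis j 1))"
proof -
  have "D h = D (\<Sum>j\<in>UNIV. h $ j *\<^sub>R axis j 1)"
    using basis_expansion[of h] by (simp add: scalar_mult_eq_scaleR)
  then show ?thesis using assms by (simp add: linear_sum linear_scale)
qed

lemma gradient_inner:
  fixes f :: "real^'m \<Rightarrow> real"
  assumes "(f has_derivative D) (at y)"
  shows "gradient f y \<bullet> h = D h"
proof -
  have "frechet_derivative f (at y) = D" using assms by (metis frechet_derivative_at)
  then have "gradient f y \<bullet> h = (\<Sum>j\<in>UNIV. h $ j *\<^sub>R D (axis j 1))"
    by (simp add: gradient_def inner_vec_def mult.commute)
  then show ?thesis using linear_axis_sum[OF has_derivative_linear[OF assms], of h] by simp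
qed

lemma has_derivative_gradient:
  fixes f :: "real^'m \<Rightarrow> real"
  assumes "(f has_derivative D) (at y)"
  shows "(f has_derivative (\<lambda>h. gradient f y \<bullet> h)) (at y)"
  using assms by (simp add: gradient_inner[OF assms])

lemma jacobian_mult:
  fixes f :: "real^'m \<Rightarrow> real^'k"
  assumes "(f has_derivative D) (at y)"
  shows "jacobian f (at y) *v h = D h"
proof -
  have "(f has_derivative (\<lambda>h. jacobian f (at y) *v h)) (at y)"
    using assms jacobian_works differentiableI by blast
  then show ?thesis using has_derivative_unique[OF assms] by metis
qed

lemma transpose_mult_inner:
  fixes A :: "real^'m^'k"
  shows "(transpose A *v b) \<bullet> h = b \<bullet> (A *v h)"
  by (simp add: dot_lmul_matrix flip: vector_transpose_matrix)

locale c2_system =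
  fixes q :: "real^'m \<Rightarrow> real^'l"
  assumes C2: "twice_continuously_differentiable q"
begin

abbreviation grad :: "'l \<Rightarrow> real^'m \<Rightarrow> real^'m" where "grad i y \<equiv> grad_comp q i y"
abbreviation hess :: "'l \<Rightarrow> real^'m \<Rightarrow> real^'m^'m" where "hess i y \<equiv> hess_comp q i y"

lemma q_deriv_all: "\<exists>D. (q has_derivative D) (at y)"
  using C2 unfolding twice_continuously_differentiable_def by blast

lemma q_deriv: "((\<lambda>y. q y $ i) has_derivative (\<lambda>h. grad i y \<bullet> h)) (at y)"
proof -
  obtain D where "(q has_derivative D) (at y)" using q_deriv_all by blast
  then have "((\<lambda>y. q y $ i) has_derivative (\<lambda>h. D h $ i)) (at y)"
    by (rule bounded_linear.has_derivative[OF bounded_linear_vec_nth])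
  then show ?thesis by (rule has_derivative_gradient)
qed

lemma jacobian_q: "(jacobian q (at y) *v h) $ i = grad i y \<bullet> h"
proof -
  obtain D where D: "(q has_derivative D) (at y)" using q_deriv_all by blast
  have "((\<lambda>y. q y $ i) has_derivative (\<lambda>h. D h $ i)) (at y)"
    by (rule bounded_linear.has_derivative[OF bounded_linear_vec_nth D])
  then show ?thesis using jacobian_mult[OF D] gradient_inner by metis
qed

lemma q_continuous: "continuous_on S q"
  using q_deriv_all by (metis continuous_at_imp_continuous_on has_derivative_continuous)

definition adj :: "real^'m \<Rightarrow> real^'l \<Rightarrow> real^'m" where
  "adj y lam = (\<Sum>i\<in>UNIV. lam $ i *\<^sub>R grad i y)"

lemma adj_inner: "adj y lam \<bullet> h = (\<Sum>i\<in>UNIV. lam $ i * (grad i y \<bullet> h))"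
  by (simp add: adj_def inner_sum_left)

lemma transpose_jacobian: "transpose (jacobian q (at y)) *v lam = adj y lam"
proof (rule vector_eq_rdot[THEN iffD1], intro allI)
  fix h
  have "(transpose (jacobian q (at y)) *v lam) \<bullet> h = lam \<bullet> (jacobian q (at y) *v h)"
    by (rule transpose_mult_inner)
  also have "\<dots> = (\<Sum>i\<in>UNIV. lam $ i * (jacobian q (at y) *v h) $ i)" by (simp add: inner_vec_def)
  finally show "(transpose (jacobian q (at y)) *v lam) \<bullet> h = adj y lam \<bullet> h"
    by (simp only: jacobian_q adj_inner)
qed

text \<open>Each entry of the gradient is a bounded linear functional of the operator-valued
  derivative of \<open>q\<close>, so differentiability and continuity descend from there. Continuity
  is stated entrywise because \<open>D y\<close> is a plain function, not an element of a normed
  space.\<close>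

lemma gradient_C1:
  "\<exists>D. (\<forall>y. (grad i has_derivative D y) (at y)) \<and> (\<forall>h j. continuous_on UNIV (\<lambda>y. D y h $ j))"
proof -
  obtain f' f'' where f': "\<And>y. (q has_derivative blinfun_apply (f' y)) (at y)"
    and f'': "\<And>y. (f' has_derivative blinfun_apply (f'' y)) (at y)" "continuous_on UNIV f''"
    using C2 unfolding twice_continuously_differentiable_def continuously_differentiable_def by blast
  have g: "grad i = (\<lambda>y. \<chi> j. f' y (axis j 1) $ i)"
  proof
    fix y
    have "((\<lambda>y. q y $ i) has_derivative (\<lambda>h. f' y h $ i)) (at y)"
      by (rule bounded_linear.has_derivative[OF bounded_linear_vec_nth f'])
    note D = gradient_inner[OF this]
    have "grad i y $ j = f' y (axis j 1) $ i" for j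
      using D[of "axis j 1"] by (simp add: inner_axis)
    then show "grad i y = (\<chi> j. f' y (axis j 1) $ i)" by (simp add: vec_eq_iff)
  qed
  let ?D = "\<lambda>y h. \<chi> j. f'' y h (axis j 1) $ i"
  have "(grad i has_derivative ?D y) (at y)" for y
  proof -
    have "((\<lambda>y. f' y (axis j 1) $ i) has_derivative (\<lambda>h. f'' y h (axis j 1) $ i)) (at y)" for j
      by (rule bounded_linear.has_derivative[OF bounded_linear_vec_nth],
        rule bounded_linear.has_derivative[OF blinfun.bounded_linear_left f''(1)])
    then show ?thesis unfolding g
      by (subst has_derivative_componentwise_within) (auto simp: Basis_vec_def inner_axis)
  qed
  moreover have "continuous_on UNIV (\<lambda>y. ?D y h $ j)" for h j
    by (simp, intro continuous_intros f''(2))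
  ultimately show ?thesis by (intro exI[of _ ?D]) blast
qed

lemma grad_deriv: "(grad i has_derivative (\<lambda>h. hess i y *v h)) (at y)"
proof -
  obtain D where "(grad i has_derivative D) (at y)" using gradient_C1 by blast
  then have "grad i differentiable (at y)" by (rule differentiableI)
  then show ?thesis unfolding hessian_def jacobian_works .
qed

lemma hess_tendsto:
  assumes y: "y \<longlonglongrightarrow> y'" and h: "h \<longlonglongrightarrow> h'"
  shows "(\<lambda>k. hess i (y k) *v h k) \<longlonglongrightarrow> hess i y' *v h'"
proof -
  obtain D where D: "\<And>y. (grad i has_derivative D y) (at y)"
    "\<And>h j. continuous_on UNIV (\<lambda>y. D y h $ j)" using gradient_C1 by blast
  have eq: "D y h = hess i y *v h" for y h
    using has_derivative_unique[OF D(1) grad_deriv, of y] by metis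
  have "(\<lambda>k. D (y k) (axis a 1) $ j) \<longlonglongrightarrow> D y' (axis a 1) $ j" for a j
    using D(2)[of "axis a 1" j] y continuous_on_tendsto_compose by fastforce
  then have c: "(\<lambda>k. hess i (y k) $ j $ a) \<longlonglongrightarrow> hess i y' $ j $ a" for a j
    unfolding eq by (simp add: matrix_vector_mult_basis column_def)
  show ?thesis
    unfolding matrix_vector_mult_def
    by (intro vec_tendstoI) (simp, intro tendsto_sum tendsto_mult c tendsto_vec_nth[OF h])
qed

lemma grad_tendsto:
  assumes "y \<longlonglongrightarrow> y'" shows "(\<lambda>k. grad i (y k)) \<longlonglongrightarrow> grad i y'"
proof -
  have "isCont (grad i) y'" using grad_deriv has_derivative_continuous by blast
  then show ?thesis using assms isCont_tendsto_compose by blast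
qed

lemma q_tendsto: assumes "y \<longlonglongrightarrow> y'" shows "(\<lambda>k. q (y k)) \<longlonglongrightarrow> q y'"
  using q_continuous[of UNIV] assms continuous_on_tendsto_compose by fastforce

lemma adj_tendsto:
  assumes "y \<longlonglongrightarrow> y'" "l \<longlonglongrightarrow> l'" shows "(\<lambda>k. adj (y k) (l k)) \<longlonglongrightarrow> adj y' l'"
  unfolding adj_def by (intro tendsto_intros grad_tendsto assms)

lemma hess_sym: "a \<bullet> (hess i y *v b) = b \<bullet> (hess i y *v a)"
  by (rule derivative_of_gradient_symmetric[OF q_deriv grad_deriv])

lemma hess_lagr_eq: "hess_lagr q lam y *v w = (\<Sum>i\<in>UNIV. lam $ i *\<^sub>R (hess i y *v w))"
proof -
  have "((\<lambda>y. lam \<bullet> q y) has_derivative (\<lambda>h. \<Sum>i\<in>UNIV. lam $ i * (grad i y \<bullet> h))) (at y)" for y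
  proof -
    have "lam \<bullet> q y = (\<Sum>i\<in>UNIV. lam $ i * q y $ i)" for y by (simp add: inner_vec_def)
    then show ?thesis by (simp only:) (intro has_derivative_sum has_derivative_mult_right q_deriv)
  qed
  from gradient_inner[OF this]
  have g: "gradient (\<lambda>y. lam \<bullet> q y) = (\<lambda>y. adj y lam)"
    by (intro ext vector_eq_rdot[THEN iffD1]) (simp add: adj_inner)
  have "((\<lambda>y. adj y lam) has_derivative (\<lambda>h. \<Sum>i\<in>UNIV. lam $ i *\<^sub>R (hess i y *v h))) (at y)"
    unfolding adj_def by (intro has_derivative_sum has_derivative_scaleR_right grad_deriv)
  from jacobian_mult[OF this] show ?thesis unfolding hessian_def g .
qed

lemma hess_lagr_sym: "a \<bullet> (hess_lagr q lam y *v b) = b \<bullet> (hess_lagr q lam y *v a)"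
  unfolding hess_lagr_eq by (simp add: inner_sum_right hess_sym[of a])

lemma hess_lagr_inner: "a \<bullet> (hess_lagr q lam y *v b) = (\<Sum>i\<in>UNIV. lam $ i * (a \<bullet> (hess i y *v b)))"
  unfolding hess_lagr_eq by (simp add: inner_sum_right)

lemma hess_lagr_tendsto:
  assumes "l \<longlonglongrightarrow> l'" "y \<longlonglongrightarrow> y'" "h \<longlonglongrightarrow> h'"
  shows "(\<lambda>k. hess_lagr q (l k) (y k) *v h k) \<longlonglongrightarrow> hess_lagr q l' y' *v h'"
  unfolding hess_lagr_eq by (intro tendsto_intros hess_tendsto assms)

lemma q_seq:
  assumes "\<And>k. t k > 0" "t \<longlonglongrightarrow> 0" "v \<longlonglongrightarrow> v'"
  shows "(\<lambda>k. (q (y + t k *\<^sub>R v k) $ i - q y $ i) / t k) \<longlonglongrightarrow> grad i y \<bullet> v'"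
  using derivative_seq[OF q_deriv[of i y] assms] by simp

lemma grad_seq:
  assumes "\<And>k. t k > 0" "t \<longlonglongrightarrow> 0" "v \<longlonglongrightarrow> v'"
  shows "(\<lambda>k. (1 / t k) *\<^sub>R (grad i (y + t k *\<^sub>R v k) - grad i y)) \<longlonglongrightarrow> hess i y *v v'"
  by (rule derivative_seq[OF grad_deriv assms])

lemma q_seq2:
  assumes "\<And>k. t k > 0" "t \<longlonglongrightarrow> 0" "v \<longlonglongrightarrow> v'"
  shows "(\<lambda>k. (q (y + t k *\<^sub>R v k) $ i - q y $ i - t k * (grad i y \<bullet> v k)) / (t k)\<^sup>2)
    \<longlonglongrightarrow> (v' \<bullet> (hess i y *v v')) / 2"
  by (rule second_order_seq[OF q_deriv grad_deriv assms])

lemma adj_seq: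
  assumes "\<And>k. t k > 0" "t \<longlonglongrightarrow> 0" "v \<longlonglongrightarrow> v'"
  shows "(\<lambda>k. (1 / t k) *\<^sub>R (adj (y + t k *\<^sub>R v k) lam - adj y lam)) \<longlonglongrightarrow> hess_lagr q lam y *v v'"
proof -
  have "(\<lambda>k. \<Sum>i\<in>UNIV. lam $ i *\<^sub>R ((1 / t k) *\<^sub>R (grad i (y + t k *\<^sub>R v k) - grad i y)))
    \<longlonglongrightarrow> hess_lagr q lam y *v v'"
    unfolding hess_lagr_eq by (intro tendsto_intros grad_seq assms)
  moreover have "(\<Sum>i\<in>UNIV. lam $ i *\<^sub>R ((1 / t k) *\<^sub>R (grad i (y + t k *\<^sub>R v k) - grad i y)))
    = (1 / t k) *\<^sub>R (adj (y + t k *\<^sub>R v k) lam - adj y lam)" for k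
    unfolding adj_def sum_subtractf[symmetric] scaleR_sum_right
    by (intro sum.cong refl) (simp add: scaleR_diff_right)
  ultimately show ?thesis by simp
qed

lemma adj_linear:
  "adj y (a + b) = adj y a + adj y b" "adj y (a - b) = adj y a - adj y b" "adj y (c *\<^sub>R a) = c *\<^sub>R adj y a"
  by (simp_all add: adj_def scaleR_add_left scaleR_diff_left sum.distrib sum_subtractf scaleR_sum_right)

end

section \<open>The feasible set\<close>

lemma edist_setD:
  assumes "edist_set x A \<le> ereal c" "c < c'"
  shows "\<exists>a\<in>A. dist x a < c'"
proof (rule ccontr)
  assume "\<not> ?thesis"
  then have "ereal c' \<le> edist_set x A"
    unfolding edist_set_def by (intro INF_greatest) (auto simp: not_less)
  also have "\<dots> \<le> ereal c" by fact
  finally show False using assms by simp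
qed

lemma edist_set_le: "a \<in> A \<Longrightarrow> edist_set x A \<le> ereal (dist x a)"
  unfolding edist_set_def by (rule INF_lower)

lemma mem_constraint_mf: "b \<in> constraint_mf q u \<longleftrightarrow> (\<forall>i. q u $ i \<le> b $ i)"
proof
  assume "\<forall>i. q u $ i \<le> b $ i"
  then show "b \<in> constraint_mf q u"
    unfolding constraint_mf_def nonpos_orthant_def by (auto intro!: exI[of _ "q u - b"])
qed (auto simp: constraint_mf_def nonpos_orthant_def)

lemma solvable_near:
  assumes le: "edist_set u (inverse_mf (constraint_mf q) v) \<le> ereal \<kappa> * edist_set v (constraint_mf q u)"
    and "\<kappa> > 0" and b: "b \<in> constraint_mf q u" and "\<delta> > 0"
  shows "\<exists>u'. v \<in> constraint_mf q u' \<and> dist u u' < \<kappa> * dist v b + \<delta>"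
proof -
  have "edist_set u (inverse_mf (constraint_mf q) v) \<le> ereal (\<kappa> * dist v b)"
    using le ereal_mult_left_mono[OF edist_set_le[OF b, of v], of "ereal \<kappa>"] \<open>\<kappa> > 0\<close> by simp
  then show ?thesis using edist_setD[of u _ "\<kappa> * dist v b" "\<kappa> * dist v b + \<delta>"] \<open>\<delta> > 0\<close>
    by (auto simp: inverse_mf_def)
qed

text \<open>What subregularity at \<open>(y, 0)\<close> and regularity near it have in common, so
  that the reference point and its neighbors are treated alike. \<open>b\<close> ranges over all
  residuals at \<open>u\<close>, and \<open>\<delta>\<close> stands in for attainment of the
  distance.\<close>

definition error_bound :: "(real^'m \<Rightarrow> real^'l) \<Rightarrow> real^'m \<Rightarrow> bool" where
  "error_bound q y \<longleftrightarrow> (\<exists>\<kappa>>0. \<exists>U. open U \<and> y \<in> U \<and> (\<forall>u\<in>U. \<forall>b\<in>constraint_mf q u. \<forall>\<delta>>0.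
     \<exists>u'\<in>feasible_set q. dist u u' < \<kappa> * norm b + \<delta>))"

lemma subregular_error_bound:
  assumes "metrically_subregular_at (constraint_mf q) y 0"
  shows "error_bound q y" "y \<in> feasible_set q"
proof -
  obtain \<kappa> U where k: "\<kappa> > 0" "open U" "y \<in> U"
    "\<And>u. u \<in> U \<Longrightarrow> edist_set u (inverse_mf (constraint_mf q) 0) \<le> ereal \<kappa> * edist_set 0 (constraint_mf q u)"
    using assms unfolding metrically_subregular_at_def by blast
  show "error_bound q y" unfolding error_bound_def
  proof (intro exI[of _ \<kappa>] conjI exI[of _ U] ballI allI impI k)
    fix u b and \<delta> :: real assume "u \<in> U" "b \<in> constraint_mf q u" "\<delta> > 0"
    then show "\<exists>u'\<in>feasible_set q. dist u u' < \<kappa> * norm b + \<delta>"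
      using solvable_near[OF k(4) k(1)] by (auto simp: mem_constraint_mf feasible_set_def)
  qed
  show "y \<in> feasible_set q"
    using assms unfolding metrically_subregular_at_def gph_def
    by (auto simp: mem_constraint_mf feasible_set_def)
qed

lemma regular_error_bound:
  assumes "metrically_regular_near (constraint_mf q) \<kappa> y 0"
  shows "error_bound q y"
proof -
  obtain U V where k: "\<kappa> > 0" "open U" "y \<in> U" "open V" "0 \<in> V"
    "\<And>u v. u \<in> U \<Longrightarrow> v \<in> V \<Longrightarrow> edist_set u (inverse_mf (constraint_mf q) v) \<le> ereal \<kappa> * edist_set v (constraint_mf q u)"
    using assms unfolding metrically_regular_near_def by blast
  show "error_bound q y" unfolding error_bound_def
  proof (intro exI[of _ \<kappa>] conjI exI[of _ U] ballI allI impI k)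
    fix u b and \<delta> :: real assume "u \<in> U" "b \<in> constraint_mf q u" "\<delta> > 0"
    then show "\<exists>u'\<in>feasible_set q. dist u u' < \<kappa> * norm b + \<delta>"
      using solvable_near[OF k(6)[OF _ k(5)] k(1)] by (auto simp: mem_constraint_mf feasible_set_def)
  qed
qed

lemma active_subset_near:
  fixes q :: "real^'m \<Rightarrow> real^'l"
  assumes "continuous_on UNIV q" "y \<longlonglongrightarrow> y'" "y' \<in> feasible_set q"
  shows "\<forall>\<^sub>F k in sequentially. \<forall>i. i \<notin> active q y' \<longrightarrow> q (y k) $ i < 0"
proof -
  have "\<forall>\<^sub>F k in sequentially. i \<notin> active q y' \<longrightarrow> q (y k) $ i < 0" for i
  proof (cases "i \<in> active q y'")
    case False
    then have "q y' $ i < 0" using assms(3) by (auto simp: feasible_set_def active_def order_less_le)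
    moreover have "(\<lambda>k. q (y k) $ i) \<longlonglongrightarrow> q y' $ i"
      by (intro tendsto_vec_nth continuous_on_tendsto_compose[OF assms(1,2)]) auto
    ultimately have "\<forall>\<^sub>F k in sequentially. q (y k) $ i < 0" by (rule order_tendstoD(2)[rotated])
    then show ?thesis by eventually_elim simp
  qed simp
  then show ?thesis by (simp add: eventually_all_finite)
qed

context c2_system
begin

lemma tangent_linearized:
  assumes "u \<in> contingent_cone (feasible_set q) y" "i \<in> active q y"
  shows "grad i y \<bullet> u \<le> 0"
proof -
  obtain t w where t: "\<And>k. t k > 0" "t \<longlonglongrightarrow> 0" "w \<longlonglongrightarrow> u" "\<And>k. y + t k *\<^sub>R w k \<in> feasible_set q"
    using assms(1) by (rule contingent_coneE) blast
  have "(q (y + t k *\<^sub>R w k) $ i - q y $ i) / t k \<le> 0" for k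
    using t(1)[of k] t(4)[of k] assms(2) by (simp add: feasible_set_def active_def divide_le_0_iff)
  then show ?thesis by (intro tendsto_upperbound[OF q_seq[OF t(1-3)]]) auto
qed

lemma adj_inner_active:
  assumes "\<And>i. i \<notin> A \<Longrightarrow> lam $ i = 0"
  shows "adj y lam \<bullet> h = (\<Sum>i\<in>A. lam $ i * (grad i y \<bullet> h))"
  unfolding adj_inner using assms by (intro sum.mono_neutral_right) auto

lemma multiplier_normal:
  assumes y: "y \<in> feasible_set q" and lam: "lam \<in> multiplier_cone q y"
  shows "adj y lam \<in> regular_normal_cone (feasible_set q) y"
proof (rule regular_normalI[OF y])
  fix u assume u: "u \<in> contingent_cone (feasible_set q) y"
  have "adj y lam \<bullet> u = (\<Sum>i\<in>active q y. lam $ i * (grad i y \<bullet> u))"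
    using lam by (intro adj_inner_active) (simp add: multiplier_cone_def)
  also have "\<dots> \<le> 0"
    using lam tangent_linearized[OF u] by (intro sum_nonpos) (simp add: multiplier_cone_def mult_nonneg_nonpos)
  finally show "adj y lam \<bullet> u \<le> 0" .
qed

text \<open>Abadie's condition from the error bound: y + t v violates the constraints by o(t), so
  some feasible point lies within o(t) of it.\<close>

lemma linearized_tangent:
  assumes eb: "error_bound q y" and y: "y \<in> feasible_set q"
    and v: "\<And>i. i \<in> active q y \<Longrightarrow> grad i y \<bullet> v \<le> 0"
  shows "v \<in> contingent_cone (feasible_set q) y"
proof -
  obtain \<kappa> U where k: "\<kappa> > 0" "open U" "y \<in> U" "\<And>u b \<delta>. u \<in> U \<Longrightarrow> b \<in> constraint_mf q u \<Longrightarrow> \<delta> > 0 \<Longrightarrow>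
     \<exists>u'\<in>feasible_set q. dist u u' < \<kappa> * norm b + \<delta>" using eb unfolding error_bound_def by blast
  define t where "t k = 1 / real (Suc k)" for k
  have t: "\<And>k. t k > 0" "t \<longlonglongrightarrow> 0"
    unfolding t_def using LIMSEQ_inverse_real_of_nat by (auto simp: field_simps)
  let ?u = "\<lambda>k. y + t k *\<^sub>R v"
  \<comment> \<open>The positive part of the constraint values is the residual of smallest norm at
    \<open>?u k\<close>.\<close>
  define b where "b k = (\<chi> i. max 0 (q (?u k) $ i))" for k
  have ut: "?u \<longlonglongrightarrow> y" by (rule tendsto_along_direction[OF t tendsto_const])
  have "(\<lambda>k. b k $ i / t k) \<longlonglongrightarrow> 0" for i
  proof (cases "i \<in> active q y")
    case True
    then have eq: "b k $ i / t k = max 0 ((q (?u k) $ i - q y $ i) / t k)" for k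
      using t(1)[of k] by (simp add: b_def active_def max_def divide_le_0_iff not_le zero_le_divide_iff)
    have "(\<lambda>k. b k $ i / t k) \<longlonglongrightarrow> max 0 (grad i y \<bullet> v)"
      unfolding eq by (intro tendsto_intros q_seq[OF t tendsto_const])
    then show ?thesis using v[OF True] by (simp add: max_def split: if_splits)
  next
    case False
    have "\<forall>\<^sub>F k in sequentially. b k $ i / t k = 0"
      using active_subset_near[OF q_continuous ut y] by eventually_elim (use False in \<open>simp add: b_def max_absorb1 less_imp_le\<close>)
    then show ?thesis by (simp add: tendsto_eventually)
  qed
  then have b0: "(\<lambda>k. (1 / t k) *\<^sub>R b k) \<longlonglongrightarrow> 0"
    by (intro vec_tendstoI) simp
  have "\<forall>\<^sub>F k in sequentially. ?u k \<in> U" using ut k(2,3) by (rule topological_tendstoD)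
  then obtain N where N: "\<And>k. k \<ge> N \<Longrightarrow> ?u k \<in> U" unfolding eventually_sequentially by blast
  have "\<forall>k. \<exists>u'. k \<ge> N \<longrightarrow> u' \<in> feasible_set q \<and> dist (?u k) u' < \<kappa> * norm (b k) + (t k)\<^sup>2"
  proof
    fix k
    have "b k \<in> constraint_mf q (?u k)" by (simp add: mem_constraint_mf b_def)
    then show "\<exists>u'. k \<ge> N \<longrightarrow> u' \<in> feasible_set q \<and> dist (?u k) u' < \<kappa> * norm (b k) + (t k)\<^sup>2"
      using k(4)[OF N, of k "b k" "(t k)\<^sup>2"] t(1)[of k] by (auto simp: less_imp_neq[THEN not_sym])
  qed
  from choice[OF this] obtain u' where u': "\<And>k. k \<ge> N \<Longrightarrow> u' k \<in> feasible_set q"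
    "\<And>k. k \<ge> N \<Longrightarrow> dist (?u k) (u' k) < \<kappa> * norm (b k) + (t k)\<^sup>2" by blast
  show ?thesis
  proof (rule contingent_coneI_points[OF t])
    show "\<forall>\<^sub>F k in sequentially. u' k \<in> feasible_set q"
      using u'(1) eventually_sequentially by blast
    have lim: "(\<lambda>k. \<kappa> * norm ((1 / t k) *\<^sub>R b k) + t k) \<longlonglongrightarrow> \<kappa> * norm (0::real^'l) + 0"
      by (intro tendsto_intros b0 t(2))
    have "(\<lambda>k. (1 / t k) *\<^sub>R (u' k - ?u k)) \<longlonglongrightarrow> 0"
    proof (rule Lim_null_comparison)
      show "(\<lambda>k. \<kappa> * norm ((1 / t k) *\<^sub>R b k) + t k) \<longlonglongrightarrow> 0" using lim by simp
      show "\<forall>\<^sub>F k in sequentially. norm ((1 / t k) *\<^sub>R (u' k - ?u k)) \<le> \<kappa> * norm ((1 / t k) *\<^sub>R b k) + t k"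
        using eventually_ge_at_top[of N]
      proof eventually_elim
        case (elim k)
        have "norm (u' k - ?u k) \<le> \<kappa> * norm (b k) + (t k)\<^sup>2"
          using u'(2)[OF elim] by (simp add: dist_norm norm_minus_commute)
        then have "norm (u' k - ?u k) / t k \<le> (\<kappa> * norm (b k) + (t k)\<^sup>2) / t k"
          using t(1)[of k] by (intro divide_right_mono) auto
        then show ?case using t(1)[of k] by (simp add: add_divide_distrib power2_eq_square)
      qed
    qed
    from tendsto_add[OF this tendsto_const[of v]]
    have "(\<lambda>k. (1 / t k) *\<^sub>R (u' k - ?u k) + v) \<longlonglongrightarrow> v" by simp
    moreover have "(1 / t k) *\<^sub>R (u' k - ?u k) + v = (1 / t k) *\<^sub>R (u' k - y)" for k
      using t(1)[of k] by (simp add: scaleR_diff_right scaleR_add_right)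
    ultimately show "(\<lambda>k. (1 / t k) *\<^sub>R (u' k - y)) \<longlonglongrightarrow> v" by simp
  qed
qed

text \<open>By \<open>linearized_tangent\<close> a normal is nonpositive on the polyhedral
  linearized cone, and Farkas' lemma then supplies the multiplier.\<close>

lemma normal_multiplier:
  assumes eb: "error_bound q y" and y: "y \<in> feasible_set q" and n: "n \<in> regular_normal_cone (feasible_set q) y"
  shows "\<exists>lam\<in>multiplier_cone q y. adj y lam = n"
proof -
  have "\<exists>l. (\<forall>i. 0 \<le> l i) \<and> (\<forall>i. i \<notin> active q y \<longrightarrow> l i = 0) \<and> n = (\<Sum>i\<in>active q y. l i *\<^sub>R grad i y)"
    by (rule farkas) (use regular_normal_dot[OF n] linearized_tangent[OF eb y] in auto)
  then obtain l where l: "\<And>i. 0 \<le> l i" "\<And>i. i \<notin> active q y \<Longrightarrow> l i = 0"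
    "n = (\<Sum>i\<in>active q y. l i *\<^sub>R grad i y)" by blast
  have "adj y (\<chi> i. l i) = n" unfolding adj_def l(3) using l(2) by (auto intro: sum.mono_neutral_right)
  then show ?thesis using l by (intro bexI[of _ "\<chi> i. l i"]) (auto simp: multiplier_cone_def)
qed

text \<open>Regularity solves q(u) <= - t lam with |u - y| below \<kappa> t |lam| + t^2. A limit w'
  of (u - y) / t satisfies grad_i w' <= - lam_i on the active set, and testing
  \<open>adj y lam\<close> with - w' gives |lam|^2 <= |adj y lam| \<kappa> |lam|.\<close>

lemma regular_multiplier_bound:
  assumes reg: "metrically_regular_near (constraint_mf q) \<kappa> y 0" and y: "y \<in> feasible_set q"
    and lam: "lam \<in> multiplier_cone q y"
  shows "norm lam \<le> \<kappa> * norm (adj y lam)"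
proof -
  obtain U V where k: "\<kappa> > 0" "open U" "y \<in> U" "open V" "0 \<in> V"
    "\<And>u v. u \<in> U \<Longrightarrow> v \<in> V \<Longrightarrow> edist_set u (inverse_mf (constraint_mf q) v) \<le> ereal \<kappa> * edist_set v (constraint_mf q u)"
    using reg unfolding metrically_regular_near_def by blast
  have "((\<lambda>t. (- t) *\<^sub>R lam) \<longlongrightarrow> (- 0) *\<^sub>R lam) (at_right 0)" by (intro tendsto_intros)
  then have "((\<lambda>t. (- t) *\<^sub>R lam) \<longlongrightarrow> 0) (at_right 0)" by simp
  then have "\<forall>\<^sub>F t in at_right 0. (- t) *\<^sub>R lam \<in> V" using k(4,5) by (rule topological_tendstoD)
  then obtain e where e: "e > 0" "\<And>t. 0 < t \<Longrightarrow> t < e \<Longrightarrow> (- t) *\<^sub>R lam \<in> V"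
    unfolding eventually_at_right_field by auto
  \<comment> \<open>Starting at \<open>Suc (Suc k)\<close> keeps \<open>t k\<close> strictly below
    \<open>e\<close>.\<close>
  define t where "t k = e * inverse (real (Suc (Suc k)))" for k
  have t: "t k > 0" "t k < e" for k using e(1) by (auto simp: t_def field_simps add_pos_nonneg)
  have "(\<lambda>k. e * inverse (real (Suc (Suc k)))) \<longlonglongrightarrow> e * 0"
    by (rule tendsto_mult[OF tendsto_const LIMSEQ_Suc[OF LIMSEQ_inverse_real_of_nat]])
  then have t0: "t \<longlonglongrightarrow> 0" unfolding t_def by simp
  have "\<forall>k. \<exists>u. (- t k) *\<^sub>R lam \<in> constraint_mf q u \<and> dist y u < \<kappa> * dist ((- t k) *\<^sub>R lam) 0 + (t k)\<^sup>2"
  proof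
    fix n
    show "\<exists>u. (- t n) *\<^sub>R lam \<in> constraint_mf q u \<and> dist y u < \<kappa> * dist ((- t n) *\<^sub>R lam) 0 + (t n)\<^sup>2"
      by (rule solvable_near[OF k(6)[OF k(3) e(2)[OF t]] k(1)])
        (use y t(1)[of n] in \<open>auto simp: mem_constraint_mf feasible_set_def\<close>)
  qed
  from choice[OF this] obtain u where u: "\<And>k. (- t k) *\<^sub>R lam \<in> constraint_mf q (u k)"
    "\<And>k. dist y (u k) < \<kappa> * dist ((- t k) *\<^sub>R lam) 0 + (t k)\<^sup>2" by blast
  define w where "w k = (1 / t k) *\<^sub>R (u k - y)" for k
  have uw: "u k = y + t k *\<^sub>R w k" for k using t(1)[of k] by (simp add: w_def)
  have wle: "norm (w k) \<le> \<kappa> * norm lam + t k" for k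
  proof -
    have "norm (u k - y) \<le> t k * (\<kappa> * norm lam + t k)"
      using u(2)[of k] t(1)[of k] by (simp add: dist_norm norm_minus_commute power2_eq_square algebra_simps)
    then show ?thesis using t(1)[of k] by (simp add: w_def pos_divide_le_eq mult.commute)
  qed
  have "norm (w k) \<le> \<kappa> * norm lam + e" for k using wle[of k] t(2)[of k] by linarith
  then have "bounded (range w)" by (auto simp: bounded_iff)
  then obtain w' r where r: "strict_mono (r :: nat \<Rightarrow> nat)" "(\<lambda>k. w (r k)) \<longlonglongrightarrow> w'"
    by (rule bounded_subsequence)
  have tr: "(\<lambda>k. t (r k)) \<longlonglongrightarrow> 0" using LIMSEQ_subseq_LIMSEQ[OF t0 r(1)] by (simp add: o_def)
  have "norm w' \<le> \<kappa> * norm lam + 0"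
    by (rule LIMSEQ_le[OF tendsto_norm[OF r(2)] tendsto_add[OF tendsto_const tr]]) (use wle in blast)
  moreover have gw: "grad i y \<bullet> w' \<le> - lam $ i" if "i \<in> active q y" for i
  proof (rule tendsto_upperbound[OF q_seq[of "\<lambda>k. t (r k)", OF t(1) tr r(2)]])
    have "(q (y + t k *\<^sub>R w k) $ i - q y $ i) / t k \<le> - lam $ i" for k
      using u(1)[of k, unfolded uw] that t(1)[of k]
      by (simp add: mem_constraint_mf active_def pos_divide_le_eq pos_le_divide_eq mult.commute)
    then show "\<forall>\<^sub>F k in sequentially. (q (y + t (r k) *\<^sub>R w (r k)) $ i - q y $ i) / t (r k) \<le> - lam $ i"
      by (intro always_eventually allI)
  qed simp
  have "(norm lam)\<^sup>2 = (\<Sum>i\<in>active q y. lam $ i * lam $ i)"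
    unfolding power2_norm_eq_inner inner_vec_def inner_real_def using lam
    by (intro sum.mono_neutral_right) (auto simp: multiplier_cone_def)
  also have "\<dots> \<le> (\<Sum>i\<in>active q y. lam $ i * (grad i y \<bullet> (- w')))"
    using lam gw by (intro sum_mono mult_left_mono) (force simp: multiplier_cone_def)+
  also have "\<dots> = adj y lam \<bullet> (- w')"
    using lam by (intro adj_inner_active[symmetric]) (simp add: multiplier_cone_def)
  also have "\<dots> \<le> norm (adj y lam) * norm w'" using norm_cauchy_schwarz[of "adj y lam" "- w'"] by simp
  also have "\<dots> \<le> norm (adj y lam) * (\<kappa> * norm lam)" using calculation(1) \<open>norm w' \<le> _\<close> by (intro mult_left_mono) auto
  finally have "norm lam * norm lam \<le> (\<kappa> * norm (adj y lam)) * norm lam"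
    by (simp add: power2_eq_square mult_ac)
  then show ?thesis using k(1) by (cases "lam = 0") auto
qed

end

section \<open>Consequences of 2-regularity\<close>

lemma two_regular_subset: "two_regular J g y v \<Longrightarrow> I \<subseteq> J \<Longrightarrow> two_regular I g y v"
  unfolding two_regular_def by (meson subsetD)

lemma two_regular_right_inverse:
  fixes g :: "'i \<Rightarrow> real^'m \<Rightarrow> real"
  assumes "two_regular J g y v"
  obtains U W where "\<And>i j. i \<in> J \<Longrightarrow> gradient (g i) y \<bullet> U j + v \<bullet> (hessian (g i) y *v W j) = (if i = j then 1 else 0)"
    "\<And>i j. i \<in> J \<Longrightarrow> gradient (g i) y \<bullet> W j = 0"
proof -
  have "\<forall>j. \<exists>uw. (\<forall>i\<in>J. gradient (g i) y \<bullet> fst uw + v \<bullet> (hessian (g i) y *v snd uw) = (if i = j then 1 else 0)) \<and>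
        (\<forall>i\<in>J. gradient (g i) y \<bullet> snd uw = 0)"
    using assms unfolding two_regular_def by simp
  from choice[OF this] obtain uw where "\<And>j. (\<forall>i\<in>J. gradient (g i) y \<bullet> fst (uw j) + v \<bullet> (hessian (g i) y *v snd (uw j)) = (if i = j then 1 else 0)) \<and>
        (\<forall>i\<in>J. gradient (g i) y \<bullet> snd (uw j) = 0)" by blast
  then show ?thesis by (intro that[of "\<lambda>j. fst (uw j)" "\<lambda>j. snd (uw j)"]) auto
qed

context c2_system
begin

lemma hess_sum: "hess i y *v (\<Sum>j\<in>A. f j) = (\<Sum>j\<in>A. hess i y *v f j)"
  by (induction A rule: infinite_finite_induct) (simp_all add: matrix_vector_right_distrib)

lemma quadratic_bound: "\<exists>C\<ge>0. \<forall>x. \<bar>x \<bullet> (hess i y *v x)\<bar> \<le> C * (norm x)\<^sup>2"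
proof (intro exI conjI allI)
  show "0 \<le> onorm ((*v) (hess i y))" by (rule onorm_pos_le) simp
  fix x
  have "\<bar>x \<bullet> (hess i y *v x)\<bar> \<le> norm x * norm (hess i y *v x)" by (rule Cauchy_Schwarz_ineq2)
  also have "\<dots> \<le> norm x * (onorm ((*v) (hess i y)) * norm x)"
    by (intro mult_left_mono onorm) simp_all
  finally show "\<bar>x \<bullet> (hess i y *v x)\<bar> \<le> onorm ((*v) (hess i y)) * (norm x)\<^sup>2"
    by (simp add: power2_eq_square mult_ac)
qed

lemma maximal_superset:
  assumes "J \<in> index_sets q y v"
  obtains J' where "J' \<in> maximal_index_sets q y v" "J \<subseteq> J'"
proof -
  have "finite (index_sets q y v)" by simp
  from finite_has_maximal2[OF this assms] obtain J' where
    "J' \<in> index_sets q y v" "J \<subseteq> J'" "\<forall>K\<in>index_sets q y v. J' \<subseteq> K \<longrightarrow> J' = K" by blast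
  then show ?thesis by (intro that[of J']) (auto simp: maximal_index_sets_def)
qed

text \<open>Otherwise one could move the vector \<open>z\<close> defining \<open>J\<close> along \<open>d\<close> until a further constraint
  becomes active. Adding a multiple of \<open>v\<close> takes care of the constraints decreasing along \<open>v\<close>.\<close>

lemma maximal_kernel:
  assumes v: "\<And>i. i \<in> active q y \<Longrightarrow> grad i y \<bullet> v \<le> 0"
    and J: "J \<in> maximal_index_sets q y v"
    and d: "\<And>j. j \<in> J \<Longrightarrow> grad j y \<bullet> d = 0" and i: "i \<in> active_dir q y v"
  shows "grad i y \<bullet> d = 0"
proof -
  obtain z where z: "z \<in> second_order_set q y v" "J = active_second q y v z"
    using J unfolding maximal_index_sets_def index_sets_def by blast
  have nonpos: "grad i y \<bullet> d \<le> 0"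
    if d: "\<And>j. j \<in> J \<Longrightarrow> grad j y \<bullet> d = 0" and i: "i \<in> active_dir q y v" for d i
  proof (rule ccontr)
    assume pos: "\<not> grad i y \<bullet> d \<le> 0"
    define s where "s j = grad j y \<bullet> z + v \<bullet> (hess j y *v v)" for j
    define P where "P = {j\<in>active_dir q y v. grad j y \<bullet> d > 0}"
    \<comment> \<open>The step length along \<open>d\<close> at which the first constraint with
      positive slope becomes active.\<close>
    define \<rho> where "\<rho> = Min ((\<lambda>j. - s j / (grad j y \<bullet> d)) ` P)"
    have P: "finite P" "P \<noteq> {}" using i pos by (auto simp: P_def)
    have s: "s j \<le> 0" if "j \<in> active q y" for j using z(1) that by (simp add: s_def second_order_set_def)
    have sJ: "s j = 0" if "j \<in> J" for j using z(2) that by (simp add: s_def active_second_def)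
    have sub: "active_dir q y v \<subseteq> active q y" by (auto simp: active_dir_def)
    have "\<rho> \<in> (\<lambda>j. - s j / (grad j y \<bullet> d)) ` P" unfolding \<rho>_def using P by (intro Min_in) auto
    then obtain i1 where i1: "i1 \<in> P" "\<rho> = - s i1 / (grad i1 y \<bullet> d)" by blast
    have \<rho>0: "\<rho> \<ge> 0"
    proof -
      have "s i1 \<le> 0" "grad i1 y \<bullet> d > 0" using i1(1) s sub by (auto simp: P_def)
      then show ?thesis unfolding i1(2) by (intro divide_nonneg_pos) auto
    qed
    have le: "s j + \<rho> * (grad j y \<bullet> d) \<le> 0" if j: "j \<in> active_dir q y v" for j
    proof (cases "j \<in> P")
      case True
      then have "\<rho> \<le> - s j / (grad j y \<bullet> d)" unfolding \<rho>_def using P by (intro Min_le) auto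
      moreover have "grad j y \<bullet> d > 0" using True by (simp add: P_def)
      ultimately have "\<rho> * (grad j y \<bullet> d) \<le> - s j" using pos_le_divide_eq by blast
      then show ?thesis by simp
    next
      case False
      then have "\<rho> * (grad j y \<bullet> d) \<le> 0" using \<rho>0 j by (auto simp: P_def mult_nonneg_nonpos)
      then show ?thesis using s[of j] j sub by auto
    qed
    have i1J: "i1 \<notin> J" using d i1(1) by (auto simp: P_def)
    have eq: "s i1 + \<rho> * (grad i1 y \<bullet> d) = 0" using i1 by (simp add: P_def)
    let ?N = "active q y - active_dir q y v"
    \<comment> \<open>The sum dominates each of its quotients, so adding
      \<open>R *\<^sub>R v\<close> compensates all constraints in \<open>?N\<close> at once, while
      those in \<open>active_dir\<close> do not change.\<close>
    define R where "R = (\<Sum>j\<in>?N. \<bar>s j + \<rho> * (grad j y \<bullet> d)\<bar> / \<bar>grad j y \<bullet> v\<bar>)"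
    define z' where "z' = z + \<rho> *\<^sub>R d + R *\<^sub>R v"
    have z'eq: "grad j y \<bullet> z' + v \<bullet> (hess j y *v v)
       = s j + \<rho> * (grad j y \<bullet> d) + R * (grad j y \<bullet> v)" for j
      by (simp add: z'_def s_def inner_add_right)
    have dir: "grad j y \<bullet> v = 0" if "j \<in> active_dir q y v" for j using that by (simp add: active_dir_def)
    have "grad j y \<bullet> z' + v \<bullet> (hess j y *v v) \<le> 0" if j: "j \<in> active q y" for j
    proof (cases "j \<in> active_dir q y v")
      case True
      then show ?thesis unfolding z'eq using le dir by simp
    next
      case False
      then have neg: "grad j y \<bullet> v < 0" using v[OF j] j by (auto simp: active_dir_def)
      have "\<bar>s j + \<rho> * (grad j y \<bullet> d)\<bar> / \<bar>grad j y \<bullet> v\<bar> \<le> R"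
        unfolding R_def using j False by (intro member_le_sum) auto
      then have "\<bar>s j + \<rho> * (grad j y \<bullet> d)\<bar> \<le> R * - (grad j y \<bullet> v)"
        using neg pos_divide_le_eq[of "\<bar>grad j y \<bullet> v\<bar>"] by simp
      then show ?thesis unfolding z'eq by linarith
    qed
    then have "z' \<in> second_order_set q y v" by (simp add: second_order_set_def)
    then have J': "active_second q y v z' \<in> index_sets q y v" by (simp add: index_sets_def)
    have "J \<subseteq> active_second q y v z'"
      unfolding active_second_def z'eq using z(2) sJ d dir by (auto simp: active_second_def)
    moreover have "i1 \<in> active_second q y v z'"
      unfolding active_second_def z'eq using eq dir i1(1) by (auto simp: P_def)
    ultimately show False using J J' i1J unfolding maximal_index_sets_def by blast
  qed
  \<comment> \<open>The hypothesis on \<open>d\<close> is symmetric under sign change, which gives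
    the opposite inequality.\<close>
  have "grad i y \<bullet> (- d) \<le> 0" by (rule nonpos) (use d i in auto)
  with nonpos[OF d i] show ?thesis by simp
qed

text \<open>The constraints in \<open>J\<close> are evaluated at \<open>y + t (v + t z / 2 + W a + t U a)\<close>, where \<open>(U, W)\<close> is
  the right inverse given by 2-regularity. Divided by \<open>t\<^sup>2\<close> they differ from \<open>a\<close> by \<open>O(|a|\<^sup>2) + o(1)\<close>, so
  that one can prescribe the values \<open>0\<close> for \<open>I\<close> and \<open>- t\<^sup>3\<close> for \<open>J - I\<close>. By the preceding lemma \<open>W a\<close> does
  not affect the first order term of the constraints in \<open>active_dir\<close> outside \<open>J\<close>.\<close>

lemma feasible_curve:
  assumes y: "y \<in> feasible_set q"
    and v: "\<And>i. i \<in> active q y \<Longrightarrow> grad i y \<bullet> v \<le> 0"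
    and J: "J \<in> maximal_index_sets q y v" and reg: "two_regular J (\<lambda>i y. q y $ i) y v"
    and I: "I \<subseteq> J"
  obtains t p where "\<And>k. t k > 0" "t \<longlonglongrightarrow> 0" "p \<longlonglongrightarrow> v"
    "\<And>k::nat. y + t k *\<^sub>R p k \<in> feasible_set q" "\<And>k. active q (y + t k *\<^sub>R p k) = I"
proof -
  obtain z where z: "z \<in> second_order_set q y v" "J = active_second q y v z"
    using J unfolding maximal_index_sets_def index_sets_def by blast
  obtain U W where U: "\<And>i j. i \<in> J \<Longrightarrow> grad i y \<bullet> U j + v \<bullet> (hess i y *v W j) = (if i = j then 1 else 0)"
    and W: "\<And>i j. i \<in> J \<Longrightarrow> grad i y \<bullet> W j = 0" by (rule two_regular_right_inverse[OF reg]) blast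
  have W': "grad i y \<bullet> W j = 0" if "i \<in> active_dir q y v" for i j
    by (rule maximal_kernel[OF v J W that])
  define UA WA where "UA a = (\<Sum>j\<in>UNIV. a $ j *\<^sub>R U j)" and "WA a = (\<Sum>j\<in>UNIV. a $ j *\<^sub>R W j)" for a :: "real^'l"
  have contUA: "continuous_on UNIV UA" "continuous_on UNIV WA"
    unfolding UA_def WA_def by (intro continuous_intros)+
  \<comment> \<open>The half matches the factor 1/2 in Taylor's formula: for a = 0 the second order
    term of constraint i is half of grad_i z + v H_i v, which vanishes on \<open>J\<close>.\<close>
  define p where "p t a = v + (t / 2) *\<^sub>R z + WA a + t *\<^sub>R UA a" for t and a :: "real^'l"
  \<comment> \<open>Outside \<open>J\<close> the identity keeps the map square, as Brouwer's theorem
    requires. On \<open>J - I\<close> the summand \<open>t\<close> makes the constraint value at a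
    zero equal to - t^3.\<close>
  define f where "f t a = (\<chi> i. if i \<in> J then q (y + t *\<^sub>R p t a) $ i / t\<^sup>2 + (if i \<in> I then 0 else t) else a $ i)" for t a
  define F where "F a = (\<chi> i. if i \<in> J then a $ i + (WA a \<bullet> (hess i y *v WA a)) / 2 else a $ i)" for a :: "real^'l"
  have act: "active_dir q y v \<subseteq> active q y" "J \<subseteq> active_dir q y v"
    using z(2) by (auto simp: active_dir_def active_second_def)
  have WA0: "grad i y \<bullet> WA a = 0" if "i \<in> active_dir q y v" for i a
    using W'[OF that] by (simp add: WA_def inner_sum_right)
  have p_lim: "(\<lambda>k. p (t k) (a k)) \<longlonglongrightarrow> v + WA a'" if "t \<longlonglongrightarrow> 0" "a \<longlonglongrightarrow> a'" for t a a'
  proof -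
    have c: "(\<lambda>k. UA (a k)) \<longlonglongrightarrow> UA a'" "(\<lambda>k. WA (a k)) \<longlonglongrightarrow> WA a'"
      using contUA that(2) by (auto intro: continuous_on_tendsto_compose)
    have "(\<lambda>k. p (t k) (a k)) \<longlonglongrightarrow> v + (0 / 2) *\<^sub>R z + WA a' + 0 *\<^sub>R UA a'"
      unfolding p_def by (intro tendsto_intros c that) simp
    then show ?thesis by simp
  qed
  have q_lim: "(\<lambda>k. q (y + t k *\<^sub>R p (t k) (a k)) $ i / (t k)\<^sup>2) \<longlonglongrightarrow>
      ((v + WA a') \<bullet> (hess i y *v (v + WA a'))) / 2 + (grad i y \<bullet> z) / 2 + grad i y \<bullet> UA a'"
    if i: "i \<in> active_dir q y v" and t: "\<And>k. t k > 0" "t \<longlonglongrightarrow> 0" and a: "a \<longlonglongrightarrow> a'" for i t a a'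
  proof -
    have c: "(\<lambda>k. UA (a k)) \<longlonglongrightarrow> UA a'" using contUA a by (auto intro: continuous_on_tendsto_compose)
    have gp: "grad i y \<bullet> p (t k) (a k) = t k * ((grad i y \<bullet> z) / 2 + grad i y \<bullet> UA (a k))" for k
      using i WA0[OF i] by (simp add: p_def inner_add_right active_dir_def algebra_simps)
    have "(q (y + t k *\<^sub>R p (t k) (a k)) $ i - q y $ i - t k * (grad i y \<bullet> p (t k) (a k))) / (t k)\<^sup>2
       + ((grad i y \<bullet> z) / 2 + grad i y \<bullet> UA (a k)) = q (y + t k *\<^sub>R p (t k) (a k)) $ i / (t k)\<^sup>2" for k
      unfolding gp using t(1)[of k] i by (simp add: active_dir_def active_def field_simps power2_eq_square)
    moreover have "(\<lambda>k. (q (y + t k *\<^sub>R p (t k) (a k)) $ i - q y $ i - t k * (grad i y \<bullet> p (t k) (a k))) / (t k)\<^sup>2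
       + ((grad i y \<bullet> z) / 2 + grad i y \<bullet> UA (a k))) \<longlonglongrightarrow>
       ((v + WA a') \<bullet> (hess i y *v (v + WA a'))) / 2 + ((grad i y \<bullet> z) / 2 + grad i y \<bullet> UA a')"
      by (intro tendsto_add q_seq2 t p_lim a tendsto_inner tendsto_const c)
    ultimately show ?thesis by (simp add: add.assoc)
  qed
  have UA1: "grad i y \<bullet> UA a + v \<bullet> (hess i y *v WA a) = a $ i" if "i \<in> J" for i a
  proof -
    have "grad i y \<bullet> UA a + v \<bullet> (hess i y *v WA a)
      = (\<Sum>j\<in>UNIV. a $ j * (grad i y \<bullet> U j + v \<bullet> (hess i y *v W j)))"
      by (simp add: UA_def WA_def hess_sum inner_sum_right matrix_vector_mult_scaleR algebra_simps sum.distrib)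
    then show ?thesis using U[OF that] by (simp add: if_distrib[where f="\<lambda>x. _ * x"] cong: if_cong)
  qed
  have "\<exists>C. \<forall>a. norm (F a - a) \<le> C * (norm a)\<^sup>2"
  proof -
    have "\<forall>i. \<exists>C\<ge>0. \<forall>x. \<bar>x \<bullet> (hess i y *v x)\<bar> \<le> C * (norm x)\<^sup>2"
      using quadratic_bound by blast
    from choice[OF this] obtain C where
      C: "\<And>i. C i \<ge> 0" "\<And>i x. \<bar>x \<bullet> (hess i y *v x)\<bar> \<le> C i * (norm x)\<^sup>2"
      by blast
    define B where "B = (\<Sum>j\<in>UNIV. norm (W j))"
    have WB: "norm (WA a) \<le> B * norm a" for a
      unfolding WA_def B_def sum_distrib_right
      by (rule sum_norm_le)
        (simp add: mult.commute[of "\<bar>_\<bar>"] mult_left_mono component_le_norm_cart)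
    have "norm (F a - a) \<le> (\<Sum>i\<in>UNIV. C i * B\<^sup>2) * (norm a)\<^sup>2" for a
    proof -
      have "norm (F a - a) \<le> (\<Sum>i\<in>UNIV. \<bar>(F a - a) $ i\<bar>)" by (rule norm_le_l1_cart)
      also have "\<dots> \<le> (\<Sum>i\<in>UNIV. C i * B\<^sup>2 * (norm a)\<^sup>2)"
      proof (rule sum_mono)
        fix i
        have "\<bar>(F a - a) $ i\<bar> \<le> \<bar>WA a \<bullet> (hess i y *v WA a)\<bar>" by (simp add: F_def)
        also have "\<dots> \<le> C i * (norm (WA a))\<^sup>2" by (rule C)
        also have "\<dots> \<le> C i * (B * norm a)\<^sup>2" using C(1) WB by (intro mult_left_mono power_mono) auto
        finally show "\<bar>(F a - a) $ i\<bar> \<le> C i * B\<^sup>2 * (norm a)\<^sup>2" by (simp add: power_mult_distrib mult.assoc)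
      qed
      finally show ?thesis by (simp add: sum_distrib_right)
    qed
    then show ?thesis by blast
  qed
  then obtain C where C: "\<And>a. norm (F a - a) \<le> C * (norm a)\<^sup>2" by blast
  have "continuous_on UNIV (f t)" for t
  proof -
    have "continuous_on UNIV (\<lambda>a. y + t *\<^sub>R p t a)" unfolding p_def by (intro continuous_intros contUA)
    then have 1: "continuous_on UNIV (\<lambda>a. q (y + t *\<^sub>R p t a))"
      by (rule continuous_on_compose2[OF q_continuous[of UNIV] _ subset_UNIV])
    have 2: "continuous_on UNIV (\<lambda>a. q (y + t *\<^sub>R p t a) $ i / t\<^sup>2)" for i
      unfolding divide_inverse by (intro continuous_intros 1)
    have "continuous_on UNIV (\<lambda>a. if i \<in> J then q (y + t *\<^sub>R p t a) $ i / t\<^sup>2 + (if i \<in> I then 0 else t) else a $ i)" for i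
      by (cases "i \<in> J") (auto intro!: continuous_intros 2)
    then show ?thesis unfolding f_def by (rule continuous_on_vec_lambda)
  qed
  moreover have "(\<lambda>k. f (t k) (a k)) \<longlonglongrightarrow> F a'" if t: "\<And>k. t k > 0" "t \<longlonglongrightarrow> 0" and a: "a \<longlonglongrightarrow> a'" for t a a'
  proof (rule vec_tendstoI)
    fix i
    show "(\<lambda>k. f (t k) (a k) $ i) \<longlonglongrightarrow> F a' $ i"
    proof (cases "i \<in> J")
      case True
      then have i: "i \<in> active_dir q y v" using act by blast
      have e: "grad i y \<bullet> z + v \<bullet> (hess i y *v v) = 0" using True z(2) by (simp add: active_second_def)
      have "(\<lambda>k. if i \<in> I then 0 else t k) \<longlonglongrightarrow> 0" using t(2) by (cases "i \<in> I") auto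
      from tendsto_add[OF q_lim[OF i t a] this]
      have "(\<lambda>k. f (t k) (a k) $ i) \<longlonglongrightarrow>
        ((v + WA a') \<bullet> (hess i y *v (v + WA a'))) / 2 + (grad i y \<bullet> z) / 2 + grad i y \<bullet> UA a'"
        using True by (simp add: f_def)
      \<comment> \<open>The terms v H v / 2 and grad z / 2 cancel, the cross term and the gradient
        of \<open>UA a'\<close> add up to \<open>a' $ i\<close> by 2-regularity, and only the
        quadratic term in \<open>WA a'\<close> remains.\<close>
      also have "((v + WA a') \<bullet> (hess i y *v (v + WA a'))) / 2 + (grad i y \<bullet> z) / 2 + grad i y \<bullet> UA a'
         = F a' $ i"
        using UA1[OF True, of a'] True e hess_sym[of v i y "WA a'"]
        by (simp add: F_def matrix_vector_right_distrib inner_add_left inner_add_right field_simps)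
      finally show ?thesis .
    next
      case False
      then show ?thesis by (simp add: f_def F_def) (rule tendsto_vec_nth[OF a])
    qed
  qed
  ultimately obtain t a where t: "\<And>k. t k > 0" "t \<longlonglongrightarrow> 0" "a \<longlonglongrightarrow> 0" "\<And>k::nat. f (t k) (a k) = 0"
    by (rule small_zeros[of f F C]) (use C in auto)
  have WAz: "WA 0 = 0" "UA 0 = 0" by (simp_all add: WA_def UA_def)
  have pv: "(\<lambda>k. p (t k) (a k)) \<longlonglongrightarrow> v" using p_lim[OF t(2,3)] WAz by simp
  have qJ: "q (y + t k *\<^sub>R p (t k) (a k)) $ i = (if i \<in> I then 0 else - ((t k)^3))" if "i \<in> J" for i k
  proof -
    have "f (t k) (a k) $ i = 0" using t(4)[of k] by simp
    then have "q (y + t k *\<^sub>R p (t k) (a k)) $ i / (t k)\<^sup>2 = - (if i \<in> I then 0 else t k)"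
      using that by (simp add: f_def)
    then show ?thesis using t(1)[of k]
      by (auto simp: field_simps power2_eq_square power3_eq_cube split: if_splits)
  qed
  have neg: "\<forall>\<^sub>F k in sequentially. i \<notin> J \<longrightarrow> q (y + t k *\<^sub>R p (t k) (a k)) $ i < 0" for i
  proof -
    \<comment> \<open>Off \<open>J\<close> a constraint becomes negative for one of three reasons:
      it is inactive at \<open>y\<close>, it decreases to first order along \<open>v\<close>, or
      \<open>z\<close> makes its second order term negative.\<close>
    consider "i \<in> J" | "i \<notin> active q y" | "i \<in> active q y" "i \<notin> active_dir q y v" | "i \<in> active_dir q y v" "i \<notin> J" by blast
    then show ?thesis
    proof cases
      case 2
      then show ?thesis
        using active_subset_near[OF q_continuous tendsto_along_direction[OF t(1,2) pv] y]
        by (auto elim: eventually_mono)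
    next
      case 3
      then have "grad i y \<bullet> v < 0" using v[of i] by (auto simp: active_dir_def)
      with q_seq[OF t(1,2) pv, of y i]
      have "\<forall>\<^sub>F k in sequentially. (q (y + t k *\<^sub>R p (t k) (a k)) $ i - q y $ i) / t k < 0" by (rule order_tendstoD)
      then show ?thesis
        by eventually_elim (use t(1) 3 in \<open>auto simp: active_def divide_less_0_iff dest: less_asym\<close>)
    next
      case 4
      then have "grad i y \<bullet> z + v \<bullet> (hess i y *v v) < 0"
        using z by (auto simp: second_order_set_def active_second_def active_dir_def order_less_le)
      then have "(v \<bullet> (hess i y *v v)) / 2 + (grad i y \<bullet> z) / 2 < 0" by simp
      moreover have "(\<lambda>k. q (y + t k *\<^sub>R p (t k) (a k)) $ i / (t k)\<^sup>2) \<longlonglongrightarrow>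
          (v \<bullet> (hess i y *v v)) / 2 + (grad i y \<bullet> z) / 2"
        using q_lim[OF 4(1) t(1-3)] WAz by simp
      ultimately have "\<forall>\<^sub>F k in sequentially. q (y + t k *\<^sub>R p (t k) (a k)) $ i / (t k)\<^sup>2 < 0"
        by (rule order_tendstoD(2)[rotated])
      then show ?thesis by eventually_elim (simp add: divide_less_0_iff)
    qed simp
  qed
  have "\<forall>\<^sub>F k in sequentially. \<forall>i. i \<notin> J \<longrightarrow> q (y + t k *\<^sub>R p (t k) (a k)) $ i < 0"
    using neg by (simp add: eventually_all_finite)
  then obtain N where N: "\<And>k i. k \<ge> N \<Longrightarrow> i \<notin> J \<Longrightarrow> q (y + t k *\<^sub>R p (t k) (a k)) $ i < 0"
    unfolding eventually_sequentially by blast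
  show ?thesis
  proof (rule that[of "\<lambda>k. t (k + N)" "\<lambda>k. p (t (k + N)) (a (k + N))"])
    fix k
    have *: "q (y + t (k + N) *\<^sub>R p (t (k + N)) (a (k + N))) $ i \<le> 0 \<and>
      (q (y + t (k + N) *\<^sub>R p (t (k + N)) (a (k + N))) $ i = 0 \<longleftrightarrow> i \<in> I)" for i
      using qJ[of i "k + N"] N[of "k + N" i] I t(1)[of "k + N"] by (cases "i \<in> J") (auto simp: less_imp_le)
    show "y + t (k + N) *\<^sub>R p (t (k + N)) (a (k + N)) \<in> feasible_set q"
      using * by (simp add: feasible_set_def)
    show "active q (y + t (k + N) *\<^sub>R p (t (k + N)) (a (k + N))) = I"
      using * by (auto simp: active_def)
  qed (use t pv in \<open>auto intro: LIMSEQ_ignore_initial_segment LIMSEQ_ignore_initial_segment[OF pv]\<close>)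
qed

text \<open>The gradients at y + t p, applied to the vectors W_j + t U_j, give t times a matrix
  tending to the identity: to first order they annihilate W_j, and the derivative of this term in
  direction v combines with U_j. Inverting the matrix solves for right-hand sides t b with bounds
  independent of t.\<close>

lemma directional_right_inverse:
  assumes reg: "two_regular J (\<lambda>i y. q y $ i) y v"
    and t: "\<And>k. t k > 0" "t \<longlonglongrightarrow> 0" and p: "p \<longlonglongrightarrow> v"
  obtains B where "\<forall>\<^sub>F k in sequentially. \<forall>b :: real^'l. \<exists>u.
    (\<forall>i\<in>J. grad i (y + t k *\<^sub>R p k) \<bullet> u = t k * b $ i) \<and> norm u \<le> B * norm b"
proof -
  obtain U W where U: "\<And>i j. i \<in> J \<Longrightarrow> grad i y \<bullet> U j + v \<bullet> (hess i y *v W j) = (if i = j then 1 else 0)"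
    and W: "\<And>i j. i \<in> J \<Longrightarrow> grad i y \<bullet> W j = 0" by (rule two_regular_right_inverse[OF reg]) blast
  let ?y = "\<lambda>k. y + t k *\<^sub>R p k"
  \<comment> \<open>Rows outside \<open>J\<close> are copied from the identity, which makes
    \<open>c k\<close> square.\<close>
  define c where "c k = (\<chi> i j. if i \<in> J then (grad i (?y k) \<bullet> (W j + t k *\<^sub>R U j)) / t k
    else if i = j then 1 else 0)" for k
  have "c \<longlonglongrightarrow> mat 1"
  proof (intro vec_tendstoI)
    fix i j
    show "(\<lambda>k. c k $ i $ j) \<longlonglongrightarrow> mat 1 $ i $ j"
    proof (cases "i \<in> J")
      case True
      have eq: "c k $ i $ j = ((1 / t k) *\<^sub>R (grad i (?y k) - grad i y)) \<bullet> W j + grad i (?y k) \<bullet> U j" for k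
        using True t(1)[of k] W[OF True, of j] by (simp add: c_def inner_add_right inner_diff_left add_divide_distrib)
      have "(\<lambda>k. c k $ i $ j) \<longlonglongrightarrow> (hess i y *v v) \<bullet> W j + grad i y \<bullet> U j"
        unfolding eq by (intro tendsto_add tendsto_inner grad_seq t p tendsto_const grad_tendsto tendsto_along_direction[OF t p])
      moreover have "(hess i y *v v) \<bullet> W j = v \<bullet> (hess i y *v W j)"
        by (simp add: inner_commute[of _ "W j"] hess_sym[of v])
      ultimately show ?thesis using U[OF True, of j] by (simp add: mat_def add.commute)
    qed (simp add: c_def mat_def)
  qed
  note near = matrix_near_identity[OF this]
  \<comment> \<open>The 2 bounds the inverse of \<open>c k\<close>; the factor in front of
    \<open>U j\<close> is absorbed by \<open>t k < 1\<close>.\<close>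
  define B where "B = 2 * (\<Sum>j\<in>UNIV. norm (W j) + norm (U j))"
  have "\<forall>\<^sub>F k in sequentially. t k < 1" using t(2) by (rule order_tendstoD) simp
  with near have "\<forall>\<^sub>F k in sequentially. \<forall>b :: real^'l. \<exists>u.
    (\<forall>i\<in>J. grad i (?y k) \<bullet> u = t k * b $ i) \<and> norm u \<le> B * norm b"
  proof eventually_elim
    case (elim k)
    show ?case
    proof
      fix b :: "real^'l"
      have "b \<in> range ((*v) (c k))" using elim(1) by simp
      then obtain a where a: "c k *v a = b" by auto
      have na: "norm a \<le> 2 * norm b" using elim(1) a by blast
      let ?u = "\<Sum>j\<in>UNIV. a $ j *\<^sub>R (W j + t k *\<^sub>R U j)"
      have "grad i (?y k) \<bullet> ?u = t k * b $ i" if "i \<in> J" for i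
      proof -
        have "b $ i = (\<Sum>j\<in>UNIV. (grad i (?y k) \<bullet> (W j + t k *\<^sub>R U j)) / t k * a $ j)"
          using that unfolding a[symmetric] by (simp add: c_def matrix_vector_mult_def)
        then have "t k * b $ i = (\<Sum>j\<in>UNIV. t k * ((grad i (?y k) \<bullet> (W j + t k *\<^sub>R U j)) / t k * a $ j))"
          by (simp add: sum_distrib_left)
        also have "\<dots> = (\<Sum>j\<in>UNIV. a $ j * (grad i (?y k) \<bullet> (W j + t k *\<^sub>R U j)))"
          using t(1)[of k] by (intro sum.cong refl) simp
        finally show ?thesis by (simp only: inner_sum_right inner_scaleR_right)
      qed
      moreover have "norm ?u \<le> B * norm b"
      proof -
        have "norm ?u \<le> (\<Sum>j\<in>UNIV. (2 * norm b) * (norm (W j) + norm (U j)))"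
        proof (rule sum_norm_le)
          fix j
          have "norm (W j + t k *\<^sub>R U j) \<le> norm (W j) + norm (t k *\<^sub>R U j)" by (rule norm_triangle_ineq)
          also have "\<dots> \<le> norm (W j) + norm (U j)" using elim(2) t(1)[of k] by (simp add: mult_left_le_one_le)
          finally have 1: "norm (W j + t k *\<^sub>R U j) \<le> norm (W j) + norm (U j)" .
          have 2: "\<bar>a $ j\<bar> \<le> 2 * norm b" using component_le_norm_cart[of a j] na by linarith
          show "norm (a $ j *\<^sub>R (W j + t k *\<^sub>R U j)) \<le> (2 * norm b) * (norm (W j) + norm (U j))"
            using 1 2 by (simp only: norm_scaleR) (intro mult_mono, auto)
        qed
        then show ?thesis by (simp add: B_def sum_distrib_left mult_ac)
      qed
      ultimately show "\<exists>u. (\<forall>i\<in>J. grad i (?y k) \<bullet> u = t k * b $ i) \<and> norm u \<le> B * norm b" by blast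
    qed
  qed
  then show ?thesis by (rule that)
qed

section \<open>The graph of the normal cone mapping at points with independent gradients\<close>


text \<open>Linear independence of the gradients over \<open>A\<close>, in the dual form of
  solvability for all right-hand sides, which is how 2-regularity delivers it.\<close>

definition licq :: "'l set \<Rightarrow> real^'m \<Rightarrow> bool" where
  "licq A y \<longleftrightarrow> (\<forall>b :: real^'l. \<exists>u. \<forall>i\<in>A. grad i y \<bullet> u = b $ i)"

lemma licq_right_inverse:
  assumes "licq A y"
  obtains U where "\<And>i j. i \<in> A \<Longrightarrow> grad i y \<bullet> U j = (if i = j then 1 else 0)"
proof -
  have "\<forall>j. \<exists>u. \<forall>i\<in>A. grad i y \<bullet> u = (if i = j then 1 else 0)"
  proof
    fix j
    obtain u where "\<forall>i\<in>A. grad i y \<bullet> u = (axis j 1 :: real^'l) $ i"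
      using assms unfolding licq_def by blast
    then show "\<exists>u. \<forall>i\<in>A. grad i y \<bullet> u = (if i = j then 1 else 0)"
      by (intro exI[of _ u]) (auto simp: axis_def)
  qed
  from choice[OF this] show ?thesis using that by blast
qed

text \<open>First order counterpart of \<open>feasible_curve\<close>. With independent gradients the
  values t (grad_i v) can be prescribed exactly for all active constraints; they are nonpositive,
  and zero on \<open>I\<close>.\<close>

lemma licq_curve:
  assumes y: "y \<in> feasible_set q" and licq: "licq (active q y) y"
    and I: "I \<subseteq> active q y" and vI: "\<And>i. i \<in> I \<Longrightarrow> grad i y \<bullet> v = 0"
    and v: "\<And>i. i \<in> active q y \<Longrightarrow> grad i y \<bullet> v \<le> 0"
  obtains t p where "\<And>k. t k > 0" "t \<longlonglongrightarrow> 0" "p \<longlonglongrightarrow> v"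
    "\<And>k::nat. y + t k *\<^sub>R p k \<in> feasible_set q" "\<And>k. I \<subseteq> active q (y + t k *\<^sub>R p k)"
proof -
  let ?A = "active q y"
  obtain U where U: "\<And>i j. i \<in> ?A \<Longrightarrow> grad i y \<bullet> U j = (if i = j then 1 else 0)"
    by (rule licq_right_inverse[OF licq]) blast
  define UA where "UA a = (\<Sum>j\<in>UNIV. a $ j *\<^sub>R U j)" for a :: "real^'l"
  have contUA: "continuous_on UNIV UA" unfolding UA_def by (intro continuous_intros)
  have UA1: "grad i y \<bullet> UA a = a $ i" if "i \<in> ?A" for i a
    using U[OF that] by (simp add: UA_def inner_sum_right if_distrib[where f="\<lambda>x. _ * x"] cong: if_cong)
  define p where "p a = v + UA a" for a
  define f where "f t a = (\<chi> i. if i \<in> ?A then (q (y + t *\<^sub>R p a) $ i - t * (grad i y \<bullet> v)) / t else a $ i)" for t a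
  have p_lim: "(\<lambda>k. p (a k)) \<longlonglongrightarrow> v + UA a'" if "a \<longlonglongrightarrow> a'" for a a'
    unfolding p_def using contUA that by (intro tendsto_intros) (auto intro: continuous_on_tendsto_compose)
  have "continuous_on UNIV (f t)" for t
  proof -
    have "continuous_on UNIV (\<lambda>a. y + t *\<^sub>R p a)" unfolding p_def by (intro continuous_intros contUA)
    then have 1: "continuous_on UNIV (\<lambda>a. q (y + t *\<^sub>R p a))"
      by (rule continuous_on_compose2[OF q_continuous[of UNIV] _ subset_UNIV])
    have 2: "continuous_on UNIV (\<lambda>a. (q (y + t *\<^sub>R p a) $ i - t * (grad i y \<bullet> v)) / t)" for i
      unfolding divide_inverse by (intro continuous_intros 1)
    have "continuous_on UNIV (\<lambda>a. if i \<in> ?A then (q (y + t *\<^sub>R p a) $ i - t * (grad i y \<bullet> v)) / t else a $ i)" for i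
      by (cases "i \<in> ?A") (auto intro!: continuous_intros 2)
    then show ?thesis unfolding f_def by (rule continuous_on_vec_lambda)
  qed
  moreover have "(\<lambda>k. f (t k) (a k)) \<longlonglongrightarrow> a'" if t: "\<And>k. t k > 0" "t \<longlonglongrightarrow> 0" and a: "a \<longlonglongrightarrow> a'" for t a a'
  proof (rule vec_tendstoI)
    fix i
    show "(\<lambda>k. f (t k) (a k) $ i) \<longlonglongrightarrow> a' $ i"
    proof (cases "i \<in> ?A")
      case True
      have "f (t k) (a k) $ i = (q (y + t k *\<^sub>R p (a k)) $ i - q y $ i) / t k - grad i y \<bullet> v" for k
        using True t(1)[of k] by (simp add: f_def active_def diff_divide_distrib)
      moreover have "(\<lambda>k. (q (y + t k *\<^sub>R p (a k)) $ i - q y $ i) / t k - grad i y \<bullet> v)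
        \<longlonglongrightarrow> grad i y \<bullet> (v + UA a') - grad i y \<bullet> v"
        by (intro tendsto_diff q_seq t p_lim a tendsto_const)
      ultimately show ?thesis using UA1[OF True] by (simp add: inner_add_right)
    next
      case False
      then show ?thesis by (simp add: f_def) (rule tendsto_vec_nth[OF a])
    qed
  qed
  ultimately obtain t a where t: "\<And>k. t k > 0" "t \<longlonglongrightarrow> 0" "a \<longlonglongrightarrow> 0" "\<And>k::nat. f (t k) (a k) = 0"
    by (rule small_zeros[of f "\<lambda>a. a" 0]) auto
  have pv: "(\<lambda>k. p (a k)) \<longlonglongrightarrow> v" using p_lim[OF t(3)] by (simp add: UA_def)
  have qA: "q (y + t k *\<^sub>R p (a k)) $ i = t k * (grad i y \<bullet> v)" if "i \<in> ?A" for i k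
  proof -
    have "f (t k) (a k) $ i = 0" using t(4)[of k] by simp
    then show ?thesis using t(1)[of k] that by (simp add: f_def)
  qed
  obtain N where N: "\<And>k i. k \<ge> N \<Longrightarrow> i \<notin> ?A \<Longrightarrow> q (y + t k *\<^sub>R p (a k)) $ i < 0"
    using active_subset_near[OF q_continuous tendsto_along_direction[OF t(1,2) pv] y]
    unfolding eventually_sequentially by blast
  show ?thesis
  proof (rule that[of "\<lambda>k. t (k + N)" "\<lambda>k. p (a (k + N))"])
    fix k
    have "q (y + t (k + N) *\<^sub>R p (a (k + N))) $ i \<le> 0" for i
      using qA[of i "k + N"] N[of "k + N" i] v[of i] t(1)[of "k + N"]
      by (cases "i \<in> ?A") (auto simp: less_imp_le mult_nonneg_nonpos)
    then show "y + t (k + N) *\<^sub>R p (a (k + N)) \<in> feasible_set q" by (simp add: feasible_set_def)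
    show "I \<subseteq> active q (y + t (k + N) *\<^sub>R p (a (k + N)))"
      using qA[of _ "k + N"] I vI by (auto simp: active_def)
  qed (use t in \<open>auto intro: LIMSEQ_ignore_initial_segment LIMSEQ_ignore_initial_segment[OF pv]\<close>)
qed

text \<open>With \<open>lam\<close> kept fixed, the gradient of the Lagrangian is a normal at every
  point of the curve, so the tangent only records its derivative in direction
  \<open>v\<close>.\<close>

lemma multiplier_tangent:
  assumes lam: "\<And>k. lam \<in> multiplier_cone q (y + t k *\<^sub>R p k)" and f: "\<And>k. y + t k *\<^sub>R p k \<in> feasible_set q"
    and t: "\<And>k. t k > 0" "t \<longlonglongrightarrow> 0" "p \<longlonglongrightarrow> v"
  shows "(v, hess_lagr q lam y *v v) \<in> contingent_cone (gph (regular_normal_cone (feasible_set q))) (y, adj y lam)"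
proof (rule contingent_coneI_points[OF t(1,2)])
  show "\<forall>\<^sub>F k in sequentially. (y + t k *\<^sub>R p k, adj (y + t k *\<^sub>R p k) lam) \<in> gph (regular_normal_cone (feasible_set q))"
    using multiplier_normal[OF f lam] by (auto simp: gph_def)
  have "(1 / t k) *\<^sub>R ((y + t k *\<^sub>R p k, adj (y + t k *\<^sub>R p k) lam) - (y, adj y lam))
    = (p k, (1 / t k) *\<^sub>R (adj (y + t k *\<^sub>R p k) lam - adj y lam))" for k
    using t(1)[of k] by simp
  then show "(\<lambda>k. (1 / t k) *\<^sub>R ((y + t k *\<^sub>R p k, adj (y + t k *\<^sub>R p k) lam) - (y, adj y lam)))
    \<longlonglongrightarrow> (v, hess_lagr q lam y *v v)"
    by (simp only:) (intro tendsto_Pair t adj_seq)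
qed

text \<open>The normal is tested with two kinds of tangents. Moving the multiplier at fixed
  \<open>y\<close> gives vertical ones, which put \<open>w\<close> into the critical cone; moving
  \<open>y\<close> along a curve with \<open>lam\<close> fixed gives the polar condition.\<close>

lemma licq_normal_imp:
  assumes y: "y \<in> feasible_set q" and licq: "licq (active q y) y" and lam: "lam \<in> multiplier_cone q y"
    and n: "(ws, w) \<in> regular_normal_cone (gph (regular_normal_cone (feasible_set q))) (y, adj y lam)"
  shows "w \<in> K_cone q y {i. lam $ i > 0} (active q y)"
    and "ws + hess_lagr q lam y *v w \<in> negative_polar (K_cone q y {i. lam $ i > 0} (active q y))"
proof -
  let ?G = "gph (regular_normal_cone (feasible_set q))" and ?A = "active q y" and ?Ip = "{i. lam $ i > 0}"
  have sub: "?Ip \<subseteq> ?A" using lam by (force simp: multiplier_cone_def)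
  have vert: "s * (grad i y \<bullet> w) \<le> 0" if i: "i \<in> ?A" and e: "e > 0" and se: "\<And>t. 0 < t \<Longrightarrow> t \<le> e \<Longrightarrow> lam $ i + t * s \<ge> 0" for i s e
  proof -
    define t where "t k = e / real (Suc k)" for k
    have t: "t k > 0" "t k \<le> e" for k using e by (auto simp: t_def field_simps)
    have "(\<lambda>k. e * inverse (real (Suc k))) \<longlonglongrightarrow> e * 0"
      by (rule tendsto_mult[OF tendsto_const LIMSEQ_inverse_real_of_nat])
    then have t0: "t \<longlonglongrightarrow> 0" unfolding t_def divide_inverse by simp
    have "(0, s *\<^sub>R grad i y) \<in> contingent_cone ?G (y, adj y lam)"
    proof (rule contingent_coneI[OF t(1) t0 tendsto_const])
      fix k
      let ?l = "lam + (t k * s) *\<^sub>R axis i 1"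
      have a: "adj y (axis i 1) = grad i y"
        by (simp add: adj_def axis_def if_distrib[where f="\<lambda>x. x *\<^sub>R _"] cong: if_cong)
      have "?l \<in> multiplier_cone q y"
        using lam i se[OF t(1,2), of k] by (auto simp: multiplier_cone_def axis_def)
      then have "adj y ?l \<in> regular_normal_cone (feasible_set q) y" by (rule multiplier_normal[OF y])
      then show "(y, adj y lam) + t k *\<^sub>R (0, s *\<^sub>R grad i y) \<in> ?G"
        by (simp add: gph_def adj_linear a)
    qed
    from regular_normal_dot[OF n this] show ?thesis by (simp add: inner_commute)
  qed
  have a: "grad i y \<bullet> w \<le> 0" if "i \<in> ?A" for i
    using vert[OF that, of 1 1] lam by (simp add: multiplier_cone_def)
  have "grad i y \<bullet> w = 0" if "i \<in> ?Ip" for i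
  proof (rule antisym)
    have iA: "i \<in> ?A" using that sub by blast
    then show "grad i y \<bullet> w \<le> 0" by (rule a)
    \<comment> \<open>Since \<open>lam $ i\<close> is positive, this multiplier may also be
      decreased, by up to its own size.\<close>
    show "0 \<le> grad i y \<bullet> w" using vert[OF iA, of "lam $ i" "- 1"] that by simp
  qed
  then show wK: "w \<in> K_cone q y ?Ip ?A" using a unfolding K_cone_def by blast
  show "ws + hess_lagr q lam y *v w \<in> negative_polar (K_cone q y ?Ip ?A)"
    unfolding negative_polar_def
  proof safe
    fix v assume v: "v \<in> K_cone q y ?Ip ?A"
    have vA: "grad i y \<bullet> v \<le> 0" if "i \<in> ?A" for i
      using v that by (cases "i \<in> ?Ip") (auto simp: K_cone_def)
    \<comment> \<open>Keeping \<open>?Ip\<close> active along the curve makes \<open>lam\<close> a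
      multiplier at all of its points.\<close>
    obtain t p where t: "\<And>k. t k > 0" "t \<longlonglongrightarrow> 0" "p \<longlonglongrightarrow> v" "\<And>k::nat. y + t k *\<^sub>R p k \<in> feasible_set q"
      "\<And>k. ?Ip \<subseteq> active q (y + t k *\<^sub>R p k)"
      by (rule licq_curve[OF y licq sub, of v]) (use v vA in \<open>auto simp: K_cone_def\<close>)
    have "lam \<in> multiplier_cone q (y + t k *\<^sub>R p k)" for k
      using t(5)[of k] lam by (force simp: multiplier_cone_def order_le_less)
    from multiplier_tangent[OF this t(4,1-3)]
    have "ws \<bullet> v + w \<bullet> (hess_lagr q lam y *v v) \<le> 0" using regular_normal_dot[OF n] by fastforce
    then show "(ws + hess_lagr q lam y *v w) \<bullet> v \<le> 0"
      using hess_lagr_sym[of v lam y w] by (simp add: inner_add_left inner_commute[of _ v] inner_add_right)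
  qed
qed

text \<open>Every tangent (v, vs) satisfies vs = H v + \<open>adj y et\<close>, with H the Hessian
  of the Lagrangian, v in the critical cone and et nonnegative where \<open>lam\<close> vanishes on
  the active set; the sign of the inner product is then immediate. Here et is a limit of difference
  quotients of multipliers, which are bounded because the gradients are independent.\<close>

lemma licq_normalI:
  assumes y: "y \<in> feasible_set q" and licq: "licq (active q y) y" and lam: "lam \<in> multiplier_cone q y"
    and rep: "\<And>y' n. y' \<in> feasible_set q \<Longrightarrow> dist y' y < e \<Longrightarrow> n \<in> regular_normal_cone (feasible_set q) y'
        \<Longrightarrow> \<exists>lam\<in>multiplier_cone q y'. adj y' lam = n"
    and "e > 0"
    and w: "w \<in> K_cone q y {i. lam $ i > 0} (active q y)"
    and ws: "ws + hess_lagr q lam y *v w \<in> negative_polar (K_cone q y {i. lam $ i > 0} (active q y))"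
  shows "(ws, w) \<in> regular_normal_cone (gph (regular_normal_cone (feasible_set q))) (y, adj y lam)"
proof (rule regular_normalI)
  let ?G = "gph (regular_normal_cone (feasible_set q))" and ?A = "active q y" and ?Ip = "{i. lam $ i > 0}"
  have sub: "?Ip \<subseteq> ?A" using lam by (force simp: multiplier_cone_def)
  have lamA: "lam $ i = 0" if "i \<notin> ?A" for i using lam that by (simp add: multiplier_cone_def)
  show "(y, adj y lam) \<in> ?G" using multiplier_normal[OF y lam] by (simp add: gph_def)
  fix d assume d: "d \<in> contingent_cone ?G (y, adj y lam)"
  obtain v vs where vvs: "d = (v, vs)" by (cases d)
  obtain t0 w0 where t0: "\<And>k. t0 k > 0" "t0 \<longlonglongrightarrow> 0" "w0 \<longlonglongrightarrow> d" "\<And>k. (y, adj y lam) + t0 k *\<^sub>R w0 k \<in> ?G"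
    using d by (rule contingent_coneE) blast
  have lim0: "(\<lambda>k. y + t0 k *\<^sub>R fst (w0 k)) \<longlonglongrightarrow> y"
    using tendsto_along_direction[OF t0(1,2) tendsto_fst[OF t0(3)]] .
  obtain U where U: "\<And>i j. i \<in> ?A \<Longrightarrow> grad i y \<bullet> U j = (if i = j then 1 else 0)"
    by (rule licq_right_inverse[OF licq]) blast
  \<comment> \<open>For \<open>a\<close> supported on \<open>?A\<close>, the entry with index i in
    \<open>?A\<close> of the product with \<open>a\<close> is \<open>adj y' a \<bullet> U i\<close>.
    Closeness to the identity therefore bounds \<open>a\<close> in terms of
    \<open>adj y' a\<close>.\<close>
  define c where "c y' = (\<chi> i j. if i \<in> ?A \<and> j \<in> ?A then grad j y' \<bullet> U i else if i = j then 1 else 0)" for y'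
  have "(\<lambda>k. c (y + t0 k *\<^sub>R fst (w0 k))) \<longlonglongrightarrow> mat 1"
  proof (intro vec_tendstoI)
    fix i j
    have "(\<lambda>k. grad j (y + t0 k *\<^sub>R fst (w0 k)) \<bullet> U i) \<longlonglongrightarrow> grad j y \<bullet> U i"
      by (intro tendsto_inner grad_tendsto lim0 tendsto_const)
    then show "(\<lambda>k. c (y + t0 k *\<^sub>R fst (w0 k)) $ i $ j) \<longlonglongrightarrow> mat 1 $ i $ j"
      using U[of j i] by (cases "i \<in> ?A \<and> j \<in> ?A") (auto simp: c_def mat_def)
  qed
  from matrix_near_identity[OF this] have
    "\<forall>\<^sub>F k in sequentially. \<forall>a. norm a \<le> 2 * norm (c (y + t0 k *\<^sub>R fst (w0 k)) *v a)"
    by eventually_elim blast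
  moreover have "\<forall>\<^sub>F k in sequentially. dist (y + t0 k *\<^sub>R fst (w0 k)) y < e"
    using lim0 \<open>e > 0\<close> by (rule tendstoD)
  moreover have "\<forall>\<^sub>F k in sequentially. \<forall>i. i \<notin> ?A \<longrightarrow> q (y + t0 k *\<^sub>R fst (w0 k)) $ i < 0"
    by (rule active_subset_near[OF q_continuous lim0 y])
  ultimately have "\<forall>\<^sub>F k in sequentially. (\<forall>a. norm a \<le> 2 * norm (c (y + t0 k *\<^sub>R fst (w0 k)) *v a)) \<and>
     dist (y + t0 k *\<^sub>R fst (w0 k)) y < e \<and> (\<forall>i. i \<notin> ?A \<longrightarrow> q (y + t0 k *\<^sub>R fst (w0 k)) $ i < 0)"
    by eventually_elim blast
  then obtain N where N: "\<And>k a. k \<ge> N \<Longrightarrow> norm a \<le> 2 * norm (c (y + t0 k *\<^sub>R fst (w0 k)) *v a)"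
     "\<And>k. k \<ge> N \<Longrightarrow> dist (y + t0 k *\<^sub>R fst (w0 k)) y < e"
     "\<And>k i. k \<ge> N \<Longrightarrow> i \<notin> ?A \<Longrightarrow> q (y + t0 k *\<^sub>R fst (w0 k)) $ i < 0"
    unfolding eventually_sequentially by blast
  define t p ps where "t k = t0 (k + N)" and "p k = fst (w0 (k + N))" and "ps k = snd (w0 (k + N))" for k
  let ?y = "\<lambda>k. y + t k *\<^sub>R p k"
  have t: "\<And>k. t k > 0" "t \<longlonglongrightarrow> 0" "p \<longlonglongrightarrow> v" "ps \<longlonglongrightarrow> vs"
    unfolding t_def p_def ps_def
    using t0(1) LIMSEQ_ignore_initial_segment[OF t0(2)] tendsto_fst[OF LIMSEQ_ignore_initial_segment[OF t0(3)]]
      tendsto_snd[OF LIMSEQ_ignore_initial_segment[OF t0(3)]] vvs by auto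
  have n: "adj y lam + t k *\<^sub>R ps k \<in> regular_normal_cone (feasible_set q) (?y k)" for k
    using t0(4)[of "k + N"] unfolding gph_def t_def p_def ps_def by (cases "w0 (k + N)") auto
  have f: "?y k \<in> feasible_set q" for k
    using n[of k] by (auto simp: regular_normal_cone_def split: if_splits)
  have cb: "norm a \<le> 2 * norm (c (?y k) *v a)" for k a
    using N(1)[of "k + N"] by (simp add: t_def p_def)
  have inact: "i \<notin> active q (?y k)" if "i \<notin> ?A" for k i
    using N(3)[of "k + N" i] that by (simp add: t_def p_def active_def)
  have "\<forall>k. \<exists>l. l \<in> multiplier_cone q (?y k) \<and> adj (?y k) l = adj y lam + t k *\<^sub>R ps k"
  proof
    fix k
    have "dist (?y k) y < e" using N(2)[of "k + N"] by (simp add: t_def p_def)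
    then show "\<exists>l. l \<in> multiplier_cone q (?y k) \<and> adj (?y k) l = adj y lam + t k *\<^sub>R ps k"
      using rep[OF f _ n] by blast
  qed
  from choice[OF this] obtain l where l: "\<And>k. l k \<in> multiplier_cone q (?y k)"
    "\<And>k. adj (?y k) (l k) = adj y lam + t k *\<^sub>R ps k" by blast
  have lA: "l k $ i = 0" if "i \<notin> ?A" for k i using l(1)[of k] inact[OF that] by (simp add: multiplier_cone_def)
  define eta where "eta k = (1 / t k) *\<^sub>R (l k - lam)" for k
  have etaA: "eta k $ i = 0" if "i \<notin> ?A" for k i using lA lamA that by (simp add: eta_def)
  have adj_eta: "adj (?y k) (eta k) = ps k - (1 / t k) *\<^sub>R (adj (?y k) lam - adj y lam)" for k
    using t(1)[of k] by (simp add: eta_def adj_linear l(2) algebra_simps)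
  have lim_eta: "(\<lambda>k. adj (?y k) (eta k)) \<longlonglongrightarrow> vs - hess_lagr q lam y *v v"
    unfolding adj_eta by (intro tendsto_diff t adj_seq)
  then have "bounded (range (\<lambda>k. adj (?y k) (eta k)))" by (rule convergent_imp_bounded)
  then obtain B where B: "\<And>k. norm (adj (?y k) (eta k)) \<le> B" by (auto simp: bounded_iff)
  have "norm (eta k) \<le> 2 * (\<Sum>i\<in>UNIV. B * norm (U i))" for k
  proof -
    have B0: "B \<ge> 0" using B[of k] norm_ge_zero order_trans by blast
    have "\<bar>(c (?y k) *v eta k) $ i\<bar> \<le> B * norm (U i)" for i
    proof (cases "i \<in> ?A")
      case True
      have "(c (?y k) *v eta k) $ i = (\<Sum>j\<in>?A. (grad j (?y k) \<bullet> U i) * eta k $ j)"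
        unfolding matrix_vector_mult_def using True etaA
        by (simp add: c_def) (intro sum.mono_neutral_cong_right, auto)
      also have "\<dots> = adj (?y k) (eta k) \<bullet> U i"
        using etaA by (subst adj_inner_active[of ?A]) (auto simp: mult.commute)
      finally have "\<bar>(c (?y k) *v eta k) $ i\<bar> \<le> norm (adj (?y k) (eta k)) * norm (U i)"
        using Cauchy_Schwarz_ineq2 by metis
      also have "\<dots> \<le> B * norm (U i)" using B by (intro mult_right_mono) auto
      finally show ?thesis .
    next
      case False
      then have "(c (?y k) *v eta k) $ i = eta k $ i"
        unfolding matrix_vector_mult_def by (simp add: c_def if_distrib[where f="\<lambda>x. x * _"] cong: if_cong)
      then show ?thesis using etaA[OF False] B0 by simp
    qed
    then have "norm (c (?y k) *v eta k) \<le> (\<Sum>i\<in>UNIV. B * norm (U i))"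
      by (intro order_trans[OF norm_le_l1_cart] sum_mono)
    then show ?thesis using cb[of "eta k" k] by linarith
  qed
  then have "bounded (range eta)" by (auto simp: bounded_iff)
  then obtain et r where r: "strict_mono (r :: nat \<Rightarrow> nat)" "(\<lambda>k. eta (r k)) \<longlonglongrightarrow> et"
    by (rule bounded_subsequence)
  have tr: "(\<lambda>k. t (r k)) \<longlonglongrightarrow> 0" "(\<lambda>k. p (r k)) \<longlonglongrightarrow> v"
    using LIMSEQ_subseq_LIMSEQ[OF t(2) r(1)] LIMSEQ_subseq_LIMSEQ[OF t(3) r(1)] by (simp_all add: o_def)
  have yr: "(\<lambda>k. ?y (r k)) \<longlonglongrightarrow> y" by (rule tendsto_along_direction[of "\<lambda>k. t (r k)", OF t(1) tr])
  have "(\<lambda>k. adj (?y (r k)) (eta (r k))) \<longlonglongrightarrow> adj y et" by (rule adj_tendsto[OF yr r(2)])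
  moreover have "(\<lambda>k. adj (?y (r k)) (eta (r k))) \<longlonglongrightarrow> vs - hess_lagr q lam y *v v"
    using LIMSEQ_subseq_LIMSEQ[OF lim_eta r(1)] by (simp add: o_def)
  ultimately have "adj y et = vs - hess_lagr q lam y *v v" by (rule LIMSEQ_unique)
  then have vs: "vs = hess_lagr q lam y *v v + adj y et" by simp
  have etA: "et $ i = 0" if "i \<notin> ?A" for i
    using tendsto_vec_nth[OF r(2), of i] etaA[OF that] by (simp add: LIMSEQ_const_iff)
  have et_pos: "et $ i \<ge> 0" if "i \<notin> ?Ip" for i
  proof (rule tendsto_lowerbound[OF tendsto_vec_nth[OF r(2), of i]])
    have "lam $ i = 0" using that lam by (force simp: multiplier_cone_def intro: antisym)
    then have "0 \<le> eta k $ i" for k using l(1)[of k] t(1)[of k] by (simp add: eta_def multiplier_cone_def)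
    then show "\<forall>\<^sub>F k in sequentially. 0 \<le> eta (r k) $ i" by simp
  qed simp
  have vA: "grad i y \<bullet> v \<le> 0" if "i \<in> ?A" for i
  proof (rule tendsto_upperbound[OF q_seq[OF t(1-3)]])
    have "(q (?y k) $ i - q y $ i) / t k \<le> 0" for k
      using f[of k] that t(1)[of k] by (simp add: feasible_set_def active_def divide_le_0_iff)
    then show "\<forall>\<^sub>F k in sequentially. (q (?y k) $ i - q y $ i) / t k \<le> 0" by simp
  qed simp
  \<comment> \<open>Multipliers close to a positive entry of \<open>lam\<close> stay positive, so by
    complementarity the constraint remains active along the subsequence.\<close>
  have vI: "grad i y \<bullet> v = 0" if i: "i \<in> ?Ip" for i
  proof -
    have "(\<lambda>k. lam $ i + t (r k) * eta (r k) $ i) \<longlonglongrightarrow> lam $ i + 0 * et $ i"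
      by (intro tendsto_intros tr r tendsto_vec_nth[OF r(2)])
    then have "\<forall>\<^sub>F k in sequentially. lam $ i + t (r k) * eta (r k) $ i > 0"
      using i by (intro order_tendstoD(1)) auto
    then have "\<forall>\<^sub>F k in sequentially. (q (?y (r k)) $ i - q y $ i) / t (r k) = 0"
    proof eventually_elim
      case (elim k)
      then have "l (r k) $ i \<noteq> 0" using t(1)[of "r k"] by (simp add: eta_def)
      then have "i \<in> active q (?y (r k))" using l(1)[of "r k"] by (auto simp: multiplier_cone_def)
      then show ?case using i sub by (auto simp: active_def)
    qed
    then have "(\<lambda>k. (q (?y (r k)) $ i - q y $ i) / t (r k)) \<longlonglongrightarrow> 0" by (rule tendsto_eventually)
    with q_seq[of "\<lambda>k. t (r k)", OF t(1) tr, of y i] show ?thesis by (rule LIMSEQ_unique)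
  qed
  have "v \<in> K_cone q y ?Ip ?A" using vA vI by (simp add: K_cone_def)
  then have 1: "(ws + hess_lagr q lam y *v w) \<bullet> v \<le> 0" using ws by (simp add: negative_polar_def)
  have "adj y et \<bullet> w = (\<Sum>i\<in>?A. et $ i * (grad i y \<bullet> w))" by (rule adj_inner_active[OF etA])
  also have "\<dots> \<le> 0"
  proof (rule sum_nonpos)
    fix i assume "i \<in> ?A"
    then show "et $ i * (grad i y \<bullet> w) \<le> 0"
      using w et_pos[of i] by (cases "i \<in> ?Ip") (auto simp: K_cone_def mult_nonneg_nonpos)
  qed
  finally have 2: "adj y et \<bullet> w \<le> 0" .
  have "(ws, w) \<bullet> d = (ws + hess_lagr q lam y *v w) \<bullet> v + adj y et \<bullet> w"
    using hess_lagr_sym[of v lam y w] by (simp add: vvs vs inner_add_left inner_add_right inner_commute)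
  then show "(ws, w) \<bullet> d \<le> 0" using 1 2 by simp
qed

section \<open>Limits of the critical cones along a direction\<close>

lemma K_cone_closed: "closed (K_cone q y Ip I)"
proof -
  have "K_cone q y Ip I = (\<Inter>i\<in>Ip. {w. grad i y \<bullet> w = 0}) \<inter> (\<Inter>i\<in>I - Ip. {w. grad i y \<bullet> w \<le> 0})"
    by (auto simp: K_cone_def)
  then show ?thesis by (simp add: closed_INT closed_hyperplane closed_halfspace_le closed_Int)
qed

lemma K_cone_convex_cone: "convex_cone (K_cone q y Ip I)"
  unfolding convex_cone_iff
  by (auto simp: K_cone_def inner_add_right mult_nonneg_nonpos add_nonpos_nonpos)

text \<open>Divided by t, the conditions at y + t p say that w / t solves a linear system whose
  constant terms converge to v H_i w'. These vectors may be unbounded;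
  \<open>solvable_rhs_limit\<close> supplies the auxiliary z.\<close>

lemma K_cone_outer_limit:
  assumes t: "\<And>k. t k > 0" "t \<longlonglongrightarrow> 0" "p \<longlonglongrightarrow> v"
    and w: "\<And>k::nat. w k \<in> K_cone q (y + t k *\<^sub>R p k) Ip I" "w \<longlonglongrightarrow> w'"
  shows "w' \<in> K_cone_dir q y v Ip I"
proof -
  let ?y = "\<lambda>k. y + t k *\<^sub>R p k"
  have yl: "?y \<longlonglongrightarrow> y" by (rule tendsto_along_direction[OF t])
  have g: "(\<lambda>k. grad i (?y k) \<bullet> w k) \<longlonglongrightarrow> grad i y \<bullet> w'" for i
    by (intro tendsto_inner grad_tendsto yl w)
  have "grad i y \<bullet> w' = 0" if "i \<in> Ip" for i
    using g[of i] w(1) that by (simp add: K_cone_def LIMSEQ_const_iff)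
  moreover have "grad i y \<bullet> w' \<le> 0" if "i \<in> I - Ip" for i
    using g[of i] by (rule tendsto_upperbound) (use w(1) that in \<open>auto simp: K_cone_def\<close>)
  ultimately have "w' \<in> K_cone q y Ip I" by (simp add: K_cone_def)
  moreover define s where "s k i = ((1 / t k) *\<^sub>R (grad i (?y k) - grad i y)) \<bullet> w k" for k i
  have "\<exists>z. (\<forall>i\<in>Ip. grad i y \<bullet> z + v \<bullet> (hess i y *v w') = 0) \<and>
     (\<forall>i\<in>I - Ip. grad i y \<bullet> z + v \<bullet> (hess i y *v w') \<le> 0)"
  proof (rule solvable_rhs_limit[where s = s and z = "\<lambda>k. (1 / t k) *\<^sub>R w k"])
    fix i
    have "(\<lambda>k. s k i) \<longlonglongrightarrow> (hess i y *v v) \<bullet> w'" unfolding s_def by (intro tendsto_inner grad_seq t w)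
    then show "(\<lambda>k. s k i) \<longlonglongrightarrow> v \<bullet> (hess i y *v w')" by (simp add: inner_commute[of _ w'] hess_sym[of v])
  next
    fix k
    have eq: "grad i y \<bullet> ((1 / t k) *\<^sub>R w k) + s k i = (grad i (?y k) \<bullet> w k) / t k" for i
      by (simp add: s_def inner_diff_left diff_divide_distrib)
    show "(\<forall>i\<in>Ip. grad i y \<bullet> ((1 / t k) *\<^sub>R w k) + s k i = 0) \<and>
      (\<forall>i\<in>I - Ip. grad i y \<bullet> ((1 / t k) *\<^sub>R w k) + s k i \<le> 0)"
      unfolding eq using w(1)[of k] t(1)[of k] by (auto simp: K_cone_def divide_le_0_iff)
  qed
  ultimately show ?thesis by (simp add: K_cone_dir_def)
qed

text \<open>The vector w + t z meets the conditions at y + t p up to o(t), and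
  \<open>directional_right_inverse\<close> removes this error by a correction tending to 0.\<close>

lemma K_cone_inner_limit:
  assumes reg: "two_regular I (\<lambda>i y. q y $ i) y v" and sub: "Ip \<subseteq> I"
    and t: "\<And>k. t k > 0" "t \<longlonglongrightarrow> 0" "p \<longlonglongrightarrow> v"
    and w: "w \<in> K_cone_dir q y v Ip I"
  shows "\<exists>u. (\<forall>\<^sub>F k in sequentially. u k \<in> K_cone q (y + t k *\<^sub>R p k) Ip I) \<and> u \<longlonglongrightarrow> w"
proof -
  let ?y = "\<lambda>k. y + t k *\<^sub>R p k"
  obtain B where B: "\<forall>\<^sub>F k in sequentially. \<forall>b :: real^'l. \<exists>u.
    (\<forall>i\<in>I. grad i (?y k) \<bullet> u = t k * b $ i) \<and> norm u \<le> B * norm b"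
    by (rule directional_right_inverse[OF reg t])
  obtain z where z: "\<forall>i\<in>Ip. grad i y \<bullet> z + v \<bullet> (hess i y *v w) = 0"
     "\<forall>i\<in>I - Ip. grad i y \<bullet> z + v \<bullet> (hess i y *v w) \<le> 0" and wK: "w \<in> K_cone q y Ip I"
    using w unfolding K_cone_dir_def by blast
  define s where "s i = grad i y \<bullet> z + v \<bullet> (hess i y *v w)" for i
  \<comment> \<open>The change of the constraint gradient's value from w at \<open>y\<close> to w +
    t z at \<open>?y k\<close>, divided by t. It tends to \<open>s i\<close>, and \<open>b\<close>
    is the remaining defect.\<close>
  define e where "e k i = ((1 / t k) *\<^sub>R (grad i (?y k) - grad i y)) \<bullet> w + grad i (?y k) \<bullet> z" for k i
  define b where "b k = (\<chi> i. s i - e k i)" for k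
  have yl: "?y \<longlonglongrightarrow> y" by (rule tendsto_along_direction[OF t])
  have e: "(\<lambda>k. e k i) \<longlonglongrightarrow> s i" for i
  proof -
    have "(\<lambda>k. e k i) \<longlonglongrightarrow> (hess i y *v v) \<bullet> w + grad i y \<bullet> z"
      unfolding e_def by (intro tendsto_add tendsto_inner grad_seq t tendsto_const grad_tendsto yl)
    then show ?thesis by (simp add: s_def inner_commute[of _ w] hess_sym[of v] add.commute)
  qed
  have "(\<lambda>k. s i - e k i) \<longlonglongrightarrow> s i - s i" for i by (intro tendsto_intros e)
  then have b0: "b \<longlonglongrightarrow> 0" by (intro vec_tendstoI) (simp add: b_def)
  have "\<forall>k. \<exists>u. (\<exists>u. (\<forall>i\<in>I. grad i (?y k) \<bullet> u = t k * b k $ i) \<and> norm u \<le> B * norm (b k)) \<longrightarrow>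
      (\<forall>i\<in>I. grad i (?y k) \<bullet> u = t k * b k $ i) \<and> norm u \<le> B * norm (b k)" by blast
  from choice[OF this] obtain u where u: "\<And>k. (\<exists>u. (\<forall>i\<in>I. grad i (?y k) \<bullet> u = t k * b k $ i) \<and> norm u \<le> B * norm (b k)) \<longrightarrow>
      (\<forall>i\<in>I. grad i (?y k) \<bullet> u k = t k * b k $ i) \<and> norm (u k) \<le> B * norm (b k)" by blast
  have uB: "\<forall>\<^sub>F k in sequentially. (\<forall>i\<in>I. grad i (?y k) \<bullet> u k = t k * b k $ i) \<and> norm (u k) \<le> B * norm (b k)"
    using B by eventually_elim (use u in blast)
  have u0: "u \<longlonglongrightarrow> 0"
  proof (rule Lim_null_comparison)
    show "\<forall>\<^sub>F k in sequentially. norm (u k) \<le> B * norm (b k)" using uB by eventually_elim blast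
    have "(\<lambda>k. B * norm (b k)) \<longlonglongrightarrow> B * norm (0 :: real^'l)" by (intro tendsto_intros b0)
    then show "(\<lambda>k. B * norm (b k)) \<longlonglongrightarrow> 0" by simp
  qed
  show ?thesis
  proof (intro exI conjI)
    have "(\<lambda>k. w + t k *\<^sub>R z + u k) \<longlonglongrightarrow> w + 0 *\<^sub>R z + 0" by (intro tendsto_intros t u0)
    then show "(\<lambda>k. w + t k *\<^sub>R z + u k) \<longlonglongrightarrow> w" by simp
    show "\<forall>\<^sub>F k in sequentially. w + t k *\<^sub>R z + u k \<in> K_cone q (?y k) Ip I"
      using uB
    proof eventually_elim
      case (elim k)
      have "grad i (?y k) \<bullet> (w + t k *\<^sub>R z + u k) = grad i y \<bullet> w + t k * s i" if i: "i \<in> I" for i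
      proof -
        have "grad i (?y k) \<bullet> (w + t k *\<^sub>R z) = grad i y \<bullet> w + t k * e k i"
          using t(1)[of k] by (simp add: e_def inner_add_right inner_diff_left algebra_simps)
        moreover have "grad i (?y k) \<bullet> u k = t k * (s i - e k i)" using elim i by (simp add: b_def)
        ultimately show ?thesis unfolding inner_add_right[of _ _ "u k"] by (simp add: right_diff_distrib)
      qed
      then show ?case using wK z sub t(1)[of k]
        by (auto simp: K_cone_def s_def subset_iff mult_nonneg_nonpos add_nonpos_nonpos less_imp_le)
    qed
  qed
qed

end

section \<open>Limiting normals to the graph of the normal cone mapping\<close>

text \<open>The limiting (Mordukhovich) normal cone; applied to a graph it defines the
  coderivative.\<close>

definition limiting_normal_cone :: "'a::real_inner set \<Rightarrow> 'a \<Rightarrow> 'a set" where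
  "limiting_normal_cone G z = {n. \<exists>g m. (\<forall>k. g k \<in> G \<and> m k \<in> regular_normal_cone G (g k)) \<and>
     g \<longlonglongrightarrow> z \<and> m \<longlonglongrightarrow> n}"

text \<open>Written literally as the union in the theorem, so that it can be folded there.\<close>

definition directional_normals ::
    "(real^'m \<Rightarrow> real^'l) \<Rightarrow> real^'m \<Rightarrow> real^'m \<Rightarrow> ((real^'m) \<times> (real^'m)) set" where
  "directional_normals q y ys = (\<Union>(v, vs) \<in> {(v, vs). (v, vs) \<in> contingent_cone
                  (gph (regular_normal_cone (feasible_set q))) (y, ys) \<and> v \<noteq> 0}.
              \<Union>(lam, mu) \<in> multiplier_pairs q y ys v vs.
              \<Union>J \<in> index_sets q y v.
              \<Union>(Ip, I) \<in> {(Ip, I). I_plus lam mu \<subseteq> Ip \<and> Ip \<subseteq> I \<and> I \<subseteq> J}.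
                Q_set q y v lam Ip I)"

lemma directional_normalsI:
  assumes "(v, vs) \<in> contingent_cone (gph (regular_normal_cone (feasible_set q))) (y, ys)" "v \<noteq> 0"
    "(lam, mu) \<in> multiplier_pairs q y ys v vs" "J \<in> index_sets q y v"
    "I_plus lam mu \<subseteq> Ip" "Ip \<subseteq> I" "I \<subseteq> J" "n \<in> Q_set q y v lam Ip I"
  shows "n \<in> directional_normals q y ys"
  using assms unfolding directional_normals_def by blast

lemma directional_normalsE:
  assumes "n \<in> directional_normals q y ys"
  obtains v vs lam mu J Ip I where
    "(v, vs) \<in> contingent_cone (gph (regular_normal_cone (feasible_set q))) (y, ys)" "v \<noteq> 0"
    "(lam, mu) \<in> multiplier_pairs q y ys v vs" "J \<in> index_sets q y v"
    "I_plus lam mu \<subseteq> Ip" "Ip \<subseteq> I" "I \<subseteq> J" "n \<in> Q_set q y v lam Ip I"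
  using assms unfolding directional_normals_def by blast

context c2_system
begin

lemma mem_multipliers: "lam \<in> multipliers q y n \<longleftrightarrow> lam \<in> multiplier_cone q y \<and> adj y lam = n"
  unfolding multipliers_def transpose_jacobian by blast

text \<open>The vectors 2 p / t solve the system whose constant terms are twice the second order
  difference quotients: feasibility gives the inequalities, activity along the sequence the
  equalities. They may diverge, so only solvability is passed to the limit.\<close>

lemma second_order_solution:
  assumes y: "y \<in> feasible_set q"
    and t: "\<And>k. t k > 0" "t \<longlonglongrightarrow> 0" "p \<longlonglongrightarrow> v" and f: "\<And>k::nat. y + t k *\<^sub>R p k \<in> feasible_set q"
    and I: "\<And>k. I \<subseteq> active q (y + t k *\<^sub>R p k)" "I \<subseteq> active q y"
  shows "\<exists>z\<in>second_order_set q y v. \<forall>i\<in>I. grad i y \<bullet> z + v \<bullet> (hess i y *v v) = 0"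
proof -
  define s where "s k i = 2 * ((q (y + t k *\<^sub>R p k) $ i - q y $ i - t k * (grad i y \<bullet> p k)) / (t k)\<^sup>2)" for k i
  have "\<exists>z. (\<forall>i\<in>I. grad i y \<bullet> z + v \<bullet> (hess i y *v v) = 0) \<and>
     (\<forall>i\<in>active q y. grad i y \<bullet> z + v \<bullet> (hess i y *v v) \<le> 0)"
  proof (rule solvable_rhs_limit[where s = s and z = "\<lambda>k. (2 / t k) *\<^sub>R p k"])
    fix i
    have "(\<lambda>k. s k i) \<longlonglongrightarrow> 2 * ((v \<bullet> (hess i y *v v)) / 2)"
      unfolding s_def by (intro tendsto_mult tendsto_const q_seq2 t)
    then show "(\<lambda>k. s k i) \<longlonglongrightarrow> v \<bullet> (hess i y *v v)" by simp
  next
    fix k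
    have eq: "grad i y \<bullet> ((2 / t k) *\<^sub>R p k) + s k i = 2 * q (y + t k *\<^sub>R p k) $ i / (t k)\<^sup>2"
      if "i \<in> active q y" for i
      using t(1)[of k] that by (simp add: s_def active_def field_simps power2_eq_square)
    show "(\<forall>i\<in>I. grad i y \<bullet> ((2 / t k) *\<^sub>R p k) + s k i = 0) \<and>
      (\<forall>i\<in>active q y. grad i y \<bullet> ((2 / t k) *\<^sub>R p k) + s k i \<le> 0)"
    proof (intro conjI ballI)
      fix i assume "i \<in> I"
      then have "i \<in> active q y" "q (y + t k *\<^sub>R p k) $ i = 0" using I(1)[of k] I(2) by (auto simp: active_def)
      then show "grad i y \<bullet> ((2 / t k) *\<^sub>R p k) + s k i = 0" by (simp only: eq)
    next
      fix i assume "i \<in> active q y"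
      then show "grad i y \<bullet> ((2 / t k) *\<^sub>R p k) + s k i \<le> 0"
        using f[of k] by (simp only: eq) (simp add: feasible_set_def divide_le_0_iff)
    qed
  qed
  then show ?thesis by (auto simp: second_order_set_def)
qed

lemma active_along_direction:
  assumes t: "\<And>k. t k > 0" "t \<longlonglongrightarrow> 0" "p \<longlonglongrightarrow> v" and I: "\<And>k::nat. I \<subseteq> active q (y + t k *\<^sub>R p k)"
  shows "I \<subseteq> active_dir q y v"
proof
  fix i assume i: "i \<in> I"
  have "(\<lambda>k. q (y + t k *\<^sub>R p k) $ i) \<longlonglongrightarrow> q y $ i"
    by (intro tendsto_vec_nth q_tendsto tendsto_along_direction[OF t])
  moreover have z: "q (y + t k *\<^sub>R p k) $ i = 0" for k using I[of k] i by (auto simp: active_def)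
  ultimately have 1: "q y $ i = 0" by (simp add: LIMSEQ_const_iff)
  have "grad i y \<bullet> v = 0" using q_seq[OF t, of y i] by (simp add: z 1 LIMSEQ_const_iff)
  then show "i \<in> active_dir q y v" using 1 by (simp add: active_dir_def active_def)
qed

text \<open>For two multipliers of the same normal the first order terms of lam' - lam cancel. Along
  the sequence lam q = 0 and lam' q <= 0, so division by t^2 leaves the inequality between the
  second order terms.\<close>

lemma multipliers_dir_of_limit:
  assumes lam: "lam \<in> multipliers q y n" and off: "\<And>i. i \<notin> I \<Longrightarrow> lam $ i = 0"
    and t: "\<And>k. t k > 0" "t \<longlonglongrightarrow> 0" "p \<longlonglongrightarrow> v" and f: "\<And>k::nat. y + t k *\<^sub>R p k \<in> feasible_set q"
    and I: "\<And>k. I \<subseteq> active q (y + t k *\<^sub>R p k)"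
  shows "lam \<in> multipliers_dir q y n v"
  unfolding multipliers_dir_def
proof safe
  fix lam' assume lam': "lam' \<in> multipliers q y n"
  define c where "c i = lam' $ i - lam $ i" for i
  have c_grad: "(\<Sum>i\<in>UNIV. c i * (grad i y \<bullet> x)) = 0" for x
    using lam lam' unfolding mem_multipliers c_def left_diff_distrib sum_subtractf adj_inner[symmetric] by simp
  have cq: "c i * q y $ i = 0" for i
    using lam lam' by (auto simp: mem_multipliers multiplier_cone_def c_def active_def)
  have "(\<Sum>i\<in>UNIV. c i * ((q (y + t k *\<^sub>R p k) $ i - q y $ i - t k * (grad i y \<bullet> p k)) / (t k)\<^sup>2)) \<le> 0" for k
  proof -
    have "(\<Sum>i\<in>UNIV. c i * ((q (y + t k *\<^sub>R p k) $ i - q y $ i - t k * (grad i y \<bullet> p k)) / (t k)\<^sup>2))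
      = (\<Sum>i\<in>UNIV. c i * q (y + t k *\<^sub>R p k) $ i / (t k)\<^sup>2 - t k / (t k)\<^sup>2 * (c i * (grad i y \<bullet> p k)))"
    proof (intro sum.cong refl)
      fix i
      have "c i * ((q (y + t k *\<^sub>R p k) $ i - q y $ i - t k * (grad i y \<bullet> p k)) / (t k)\<^sup>2)
        = (c i * q (y + t k *\<^sub>R p k) $ i - c i * q y $ i - c i * (t k * (grad i y \<bullet> p k))) / (t k)\<^sup>2"
        by (simp only: times_divide_eq_right right_diff_distrib)
      then show "c i * ((q (y + t k *\<^sub>R p k) $ i - q y $ i - t k * (grad i y \<bullet> p k)) / (t k)\<^sup>2)
        = c i * q (y + t k *\<^sub>R p k) $ i / (t k)\<^sup>2 - t k / (t k)\<^sup>2 * (c i * (grad i y \<bullet> p k))"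
        by (simp only: cq) (simp add: diff_divide_distrib mult_ac)
    qed
    also have "\<dots> = (\<Sum>i\<in>UNIV. c i * q (y + t k *\<^sub>R p k) $ i / (t k)\<^sup>2)"
      by (simp only: sum_subtractf c_grad flip: sum_distrib_left)
    also have "\<dots> \<le> 0"
    proof (rule sum_nonpos)
      fix i
      have "lam $ i * q (y + t k *\<^sub>R p k) $ i = 0" using off[of i] I[of k] by (auto simp: active_def)
      moreover have "lam' $ i * q (y + t k *\<^sub>R p k) $ i \<le> 0"
        using lam' f[of k] by (simp add: mem_multipliers multiplier_cone_def feasible_set_def mult_nonneg_nonpos)
      ultimately have "c i * q (y + t k *\<^sub>R p k) $ i \<le> 0" unfolding c_def left_diff_distrib by linarith
      then show "c i * q (y + t k *\<^sub>R p k) $ i / (t k)\<^sup>2 \<le> 0" by (simp add: divide_nonpos_nonneg)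
    qed
    finally show ?thesis .
  qed
  moreover have "(\<lambda>k. \<Sum>i\<in>UNIV. c i * ((q (y + t k *\<^sub>R p k) $ i - q y $ i - t k * (grad i y \<bullet> p k)) / (t k)\<^sup>2))
    \<longlonglongrightarrow> (\<Sum>i\<in>UNIV. c i * ((v \<bullet> (hess i y *v v)) / 2))"
    by (intro tendsto_sum tendsto_mult tendsto_const q_seq2 t)
  ultimately have "(\<Sum>i\<in>UNIV. c i * ((v \<bullet> (hess i y *v v)) / 2)) \<le> 0"
    by (intro tendsto_upperbound) auto
  then have "(\<Sum>i\<in>UNIV. c i * (v \<bullet> (hess i y *v v))) \<le> 0"
    by (simp flip: sum_divide_distrib)
  then show "v \<bullet> (hess_lagr q lam' y *v v) \<le> v \<bullet> (hess_lagr q lam y *v v)"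
    by (simp add: hess_lagr_inner c_def left_diff_distrib sum_subtractf)
qed (rule lam)

lemma zero_multiplier_pair:
  assumes "lam \<in> multipliers_dir q y n v"
  shows "(lam, 0) \<in> multiplier_pairs q y n v (hess_lagr q lam y *v v)"
proof -
  have "lam \<in> multiplier_cone q y" using assms by (simp add: multipliers_dir_def mem_multipliers)
  then have "0 \<in> contingent_cone (multiplier_cone q y) lam"
    by (intro contingent_coneI[where t = "\<lambda>k. inverse (real (Suc k))" and w = "\<lambda>k. 0"])
      (auto intro: LIMSEQ_inverse_real_of_nat simp del: of_nat_Suc)
  then show ?thesis using assms by (simp add: multiplier_pairs_def)
qed

end

section \<open>Limiting normals at the reference pair: local closedness and the two
  inclusions\<close>

locale reference_pair = c2_system q
  for q :: "real^'m \<Rightarrow> real^'l" +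
  fixes yb ys :: "real^'m"
  assumes subregular: "metrically_subregular_at (constraint_mf q) yb 0"
    and vicinity: "regular_in_vicinity q yb"
    and two_reg: "\<And>u J. u \<in> critical_cone q yb ys \<Longrightarrow> u \<noteq> 0 \<Longrightarrow>
          J \<in> maximal_index_sets q yb u \<Longrightarrow> two_regular J (\<lambda>i y. q y $ i) yb u"
    and null_space: "active_null_space q yb \<noteq> {0}"
    and ys: "ys \<in> regular_normal_cone (feasible_set q) yb"
begin

abbreviation "\<Gamma> \<equiv> feasible_set q"
abbreviation "N \<equiv> regular_normal_cone \<Gamma>"
abbreviation "G \<equiv> gph N"

lemma yb: "yb \<in> \<Gamma>" and eb: "error_bound q yb"
  using subregular_error_bound[OF subregular] by auto

text \<open>Existence of multipliers includes the reference point, where subregularity provides it.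
  The bound excludes that point, where the multiplier set may be unbounded.\<close>

lemma vicinityE:
  obtains \<rho> \<kappa> where "\<rho> > 0"
    "\<And>y n. y \<in> \<Gamma> \<Longrightarrow> dist y yb < \<rho> \<Longrightarrow> n \<in> N y \<Longrightarrow> \<exists>lam\<in>multiplier_cone q y. adj y lam = n"
    "\<And>y lam. y \<in> \<Gamma> \<Longrightarrow> dist y yb < \<rho> \<Longrightarrow> y \<noteq> yb \<Longrightarrow> lam \<in> multiplier_cone q y \<Longrightarrow> norm lam \<le> \<kappa> * norm (adj y lam)"
proof -
  obtain V \<kappa> where V: "open V" "yb \<in> V"
    "\<And>y. y \<in> \<Gamma> \<Longrightarrow> y \<in> V \<Longrightarrow> y \<noteq> yb \<Longrightarrow> metrically_regular_near (constraint_mf q) \<kappa> y 0"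
    using vicinity unfolding regular_in_vicinity_def by blast
  obtain \<rho> where \<rho>: "\<rho> > 0" "ball yb \<rho> \<subseteq> V" using V(1,2) open_contains_ball by blast
  then have reg: "metrically_regular_near (constraint_mf q) \<kappa> y 0" if "y \<in> \<Gamma>" "dist y yb < \<rho>" "y \<noteq> yb" for y
    using V(3) that by (auto simp: dist_commute subset_iff)
  show ?thesis
  proof (rule that[OF \<rho>(1), of \<kappa>])
    fix y n assume "y \<in> \<Gamma>" "dist y yb < \<rho>" "n \<in> N y"
    moreover have "error_bound q y"
      using eb reg[OF \<open>y \<in> \<Gamma>\<close> \<open>dist y yb < \<rho>\<close>] regular_error_bound by (cases "y = yb") auto
    ultimately show "\<exists>lam\<in>multiplier_cone q y. adj y lam = n" using normal_multiplier by blast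
  next
    fix y lam assume "y \<in> \<Gamma>" "dist y yb < \<rho>" "y \<noteq> yb" "lam \<in> multiplier_cone q y"
    then show "norm lam \<le> \<kappa> * norm (adj y lam)" using regular_multiplier_bound[OF reg] by blast
  qed
qed

lemma gphD: "(y, n) \<in> G \<Longrightarrow> n \<in> N y" "(y, n) \<in> G \<Longrightarrow> y \<in> \<Gamma>"
  by (auto simp: gph_def regular_normal_cone_def split: if_splits)

text \<open>Normals over points other than \<open>yb\<close> have bounded multipliers, which
  converge along a subsequence. If the sequence returns to \<open>yb\<close> infinitely often,
  closedness of the single cone \<open>N yb\<close> suffices.\<close>

lemma graph_locally_closed:
  obtains \<rho> where "\<rho> > 0" "closed (G \<inter> (cball yb \<rho> \<times> UNIV))"
proof -
  obtain \<rho> \<kappa> where \<rho>: "\<rho> > 0"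
    "\<And>y n. y \<in> \<Gamma> \<Longrightarrow> dist y yb < \<rho> \<Longrightarrow> n \<in> N y \<Longrightarrow> \<exists>lam\<in>multiplier_cone q y. adj y lam = n"
    "\<And>y lam. y \<in> \<Gamma> \<Longrightarrow> dist y yb < \<rho> \<Longrightarrow> y \<noteq> yb \<Longrightarrow> lam \<in> multiplier_cone q y \<Longrightarrow> norm lam \<le> \<kappa> * norm (adj y lam)"
    by (rule vicinityE) blast
  have "closed (G \<inter> (cball yb (\<rho> / 2) \<times> UNIV))"
    unfolding closed_sequential_limits
  proof safe
    fix x a b assume x: "\<forall>k. x k \<in> G \<inter> cball yb (\<rho> / 2) \<times> UNIV" and lim: "x \<longlonglongrightarrow> (a, b)"
    define y n where "y k = fst (x k)" and "n k = snd (x k)" for k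
    have yn: "y \<longlonglongrightarrow> a" "n \<longlonglongrightarrow> b" unfolding y_def n_def using tendsto_fst[OF lim] tendsto_snd[OF lim] by auto
    have G: "(y k, n k) \<in> G" and yk: "dist (y k) yb \<le> \<rho> / 2" for k
      using x[rule_format, of k] by (auto simp: y_def n_def dist_commute)
    show a: "a \<in> cball yb (\<rho> / 2)"
      using closed_sequentially[OF closed_cball _ yn(1), of yb "\<rho> / 2"] yk by (simp add: dist_commute)
    have a\<Gamma>: "a \<in> \<Gamma>" unfolding feasible_set_def
    proof safe
      fix i
      show "q a $ i \<le> 0"
        by (rule tendsto_upperbound[OF tendsto_vec_nth[OF q_tendsto[OF yn(1)]]])
          (use gphD(2)[OF G] in \<open>auto simp: feasible_set_def\<close>)
    qed
    have ex: "\<exists>l. l \<in> multiplier_cone q (y k) \<and> adj (y k) l = n k \<and> (y k \<noteq> yb \<longrightarrow> norm l \<le> \<kappa> * norm (n k))" for k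
      using \<rho>(2)[OF gphD(2)[OF G] _ gphD(1)[OF G], of k] \<rho>(3)[OF gphD(2)[OF G], of k] yk[of k] \<rho>(1) by fastforce
    show "b \<in> UNIV" ..
    show "(a, b) \<in> G"
    proof (cases "\<forall>\<^sub>F k in sequentially. y k \<noteq> yb")
      case True
      then obtain M where M: "\<And>k. k \<ge> M \<Longrightarrow> y k \<noteq> yb" unfolding eventually_sequentially by blast
      have "\<forall>k. \<exists>l. l \<in> multiplier_cone q (y (k + M)) \<and> adj (y (k + M)) l = n (k + M) \<and> norm l \<le> \<kappa> * norm (n (k + M))"
      proof
        fix k
        show "\<exists>l. l \<in> multiplier_cone q (y (k + M)) \<and> adj (y (k + M)) l = n (k + M) \<and> norm l \<le> \<kappa> * norm (n (k + M))"
          using ex[of "k + M"] M[of "k + M"] by auto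
      qed
      from choice[OF this] obtain l where l: "\<And>k. l k \<in> multiplier_cone q (y (k + M))"
        "\<And>k. adj (y (k + M)) (l k) = n (k + M)" "\<And>k. norm (l k) \<le> \<kappa> * norm (n (k + M))" by blast
      have "bounded (range n)" using yn(2) by (rule convergent_imp_bounded)
      then obtain B where B: "\<And>k. norm (n k) \<le> B" by (auto simp: bounded_iff)
      have "norm (l k) \<le> \<bar>\<kappa>\<bar> * B" for k
      proof -
        have "norm (l k) \<le> \<bar>\<kappa>\<bar> * norm (n (k + M))" using l(3)[of k] by (rule order_trans) (simp add: mult_right_mono)
        also have "\<dots> \<le> \<bar>\<kappa>\<bar> * B" using B by (intro mult_left_mono) auto
        finally show ?thesis .
      qed
      then have "bounded (range l)" by (auto simp: bounded_iff)
      then obtain l' r where r: "strict_mono (r :: nat \<Rightarrow> nat)" "(\<lambda>k. l (r k)) \<longlonglongrightarrow> l'"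
        by (rule bounded_subsequence)
      have yr: "(\<lambda>k. y (r k + M)) \<longlonglongrightarrow> a" "(\<lambda>k. n (r k + M)) \<longlonglongrightarrow> b"
        using LIMSEQ_subseq_LIMSEQ[OF LIMSEQ_ignore_initial_segment[OF yn(1), of M] r(1)]
          LIMSEQ_subseq_LIMSEQ[OF LIMSEQ_ignore_initial_segment[OF yn(2), of M] r(1)] by (simp_all add: o_def)
      have "(\<lambda>k. adj (y (r k + M)) (l (r k))) \<longlonglongrightarrow> adj a l'" by (rule adj_tendsto[OF yr(1) r(2)])
      then have "adj a l' = b" unfolding l(2) using yr(2) LIMSEQ_unique by blast
      moreover have "l' \<in> multiplier_cone q a"
        unfolding multiplier_cone_def
      proof safe
        fix i show "l' $ i \<ge> 0"
          by (rule tendsto_lowerbound[OF tendsto_vec_nth[OF r(2)]]) (use l(1) in \<open>auto simp: multiplier_cone_def\<close>)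
      next
        fix i assume i: "i \<notin> active q a"
        have "\<forall>\<^sub>F k in sequentially. l (r k) $ i = 0"
          using active_subset_near[OF q_continuous yr(1) a\<Gamma>]
        proof eventually_elim
          case (elim k)
          then have "i \<notin> active q (y (r k + M))" using i by (auto simp: active_def)
          then show ?case using l(1)[of "r k"] by (simp add: multiplier_cone_def)
        qed
        then have "(\<lambda>k. l (r k) $ i) \<longlonglongrightarrow> 0" by (rule tendsto_eventually)
        then show "l' $ i = 0" using tendsto_vec_nth[OF r(2), of i] LIMSEQ_unique by blast
      qed
      ultimately show ?thesis using multiplier_normal[OF a\<Gamma>] by (auto simp: gph_def)
    next
      case False
      then have "infinite {k. y k = yb}"
        by (simp add: eventually_sequentially infinite_nat_iff_unbounded_le)
      from infinite_enumerate[OF this] obtain r :: "nat \<Rightarrow> nat" where r: "strict_mono r" "\<forall>k. r k \<in> {k. y k = yb}" by blast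
      have yr: "(\<lambda>k. y (r k)) \<longlonglongrightarrow> a" "(\<lambda>k. n (r k)) \<longlonglongrightarrow> b"
        using LIMSEQ_subseq_LIMSEQ[OF yn(1) r(1)] LIMSEQ_subseq_LIMSEQ[OF yn(2) r(1)] by (simp_all add: o_def)
      then have "a = yb" using r(2) by (simp add: LIMSEQ_const_iff)
      moreover have "b \<in> N yb"
      proof (rule regular_normalI[OF yb])
        fix u assume u: "u \<in> contingent_cone \<Gamma> yb"
        have "n (r k) \<bullet> u \<le> 0" for k using regular_normal_dot[OF gphD(1)[OF G[of "r k"]]] r(2) u by simp
        then show "b \<bullet> u \<le> 0" by (intro tendsto_upperbound[OF tendsto_inner[OF yr(2) tendsto_const]]) auto
      qed
      ultimately show ?thesis by (simp add: gph_def)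
    qed
  qed
  then show ?thesis using that[of "\<rho> / 2"] \<rho>(1) by simp
qed

lemma licq_along_direction:
  assumes reg: "two_regular I (\<lambda>i y. q y $ i) yb v"
    and t: "\<And>k. t k > 0" "t \<longlonglongrightarrow> 0" and p: "p \<longlonglongrightarrow> v"
  shows "\<forall>\<^sub>F k in sequentially. licq I (yb + t k *\<^sub>R p k)"
proof -
  obtain B where "\<forall>\<^sub>F k in sequentially. \<forall>b :: real^'l. \<exists>u.
    (\<forall>i\<in>I. grad i (yb + t k *\<^sub>R p k) \<bullet> u = t k * b $ i) \<and> norm u \<le> B * norm b"
    by (rule directional_right_inverse[OF reg t p])
  then show ?thesis
  proof eventually_elim
    case (elim k)
    show ?case unfolding licq_def
    proof
      fix b :: "real^'l"
      obtain u where "\<forall>i\<in>I. grad i (yb + t k *\<^sub>R p k) \<bullet> u = t k * ((1 / t k) *\<^sub>R b) $ i"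
        using elim by blast
      then show "\<exists>u. \<forall>i\<in>I. grad i (yb + t k *\<^sub>R p k) \<bullet> u = b $ i" using t(1)[of k] by auto
    qed
  qed
qed

text \<open>Along a subsequence directions and multipliers converge, while the active set
  \<open>I\<close> and the positivity set \<open>Ip\<close> are constant. Every ingredient of the
  union is read off from this subsequence, and \<open>licq_normal_imp\<close> describes the normals
  along it.\<close>

lemma limit_of_normals_off_reference:
  assumes G: "\<And>k. (y k, n k) \<in> G" and ne: "\<And>k. y k \<noteq> yb" and lim: "y \<longlonglongrightarrow> yb" "n \<longlonglongrightarrow> ys"
    and m: "\<And>k. m k \<in> regular_normal_cone G (y k, n k)" and mlim: "m \<longlonglongrightarrow> m'"
  shows "m' \<in> directional_normals q yb ys"
proof -
  obtain \<rho> \<kappa> where \<rho>: "\<rho> > 0"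
    "\<And>y n. y \<in> \<Gamma> \<Longrightarrow> dist y yb < \<rho> \<Longrightarrow> n \<in> N y \<Longrightarrow> \<exists>lam\<in>multiplier_cone q y. adj y lam = n"
    "\<And>y lam. y \<in> \<Gamma> \<Longrightarrow> dist y yb < \<rho> \<Longrightarrow> y \<noteq> yb \<Longrightarrow> lam \<in> multiplier_cone q y \<Longrightarrow> norm lam \<le> \<kappa> * norm (adj y lam)"
    by (rule vicinityE) blast
  obtain M where M: "\<And>k. k \<ge> M \<Longrightarrow> dist (y k) yb < \<rho>"
    using tendstoD[OF lim(1) \<rho>(1)] unfolding eventually_sequentially by blast
  have "\<forall>k. \<exists>l. l \<in> multiplier_cone q (y (k + M)) \<and> adj (y (k + M)) l = n (k + M) \<and> norm l \<le> \<kappa> * norm (n (k + M))"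
  proof
    fix k
    obtain lam where "lam \<in> multiplier_cone q (y (k + M))" "adj (y (k + M)) lam = n (k + M)"
      using \<rho>(2)[OF gphD(2)[OF G] M gphD(1)[OF G], of "k + M"] by auto
    then show "\<exists>l. l \<in> multiplier_cone q (y (k + M)) \<and> adj (y (k + M)) l = n (k + M) \<and> norm l \<le> \<kappa> * norm (n (k + M))"
      using \<rho>(3)[OF gphD(2)[OF G] M ne, of "k + M" lam] by auto
  qed
  from choice[OF this] obtain l where l: "\<And>k. l k \<in> multiplier_cone q (y (k + M))"
    "\<And>k. adj (y (k + M)) (l k) = n (k + M)" "\<And>k. norm (l k) \<le> \<kappa> * norm (n (k + M))" by blast
  have "bounded (range n)" using lim(2) by (rule convergent_imp_bounded)
  then obtain B where B: "\<And>k. norm (n k) \<le> B" by (auto simp: bounded_iff)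
  have l_bd: "norm (l k) \<le> \<bar>\<kappa>\<bar> * B" for k
  proof -
    have "norm (l k) \<le> \<bar>\<kappa>\<bar> * norm (n (k + M))" using l(3)[of k] by (rule order_trans) (simp add: mult_right_mono)
    also have "\<dots> \<le> \<bar>\<kappa>\<bar> * B" using B by (intro mult_left_mono) auto
    finally show ?thesis .
  qed
  define t0 p0 where "t0 k = norm (y (k + M) - yb)" and "p0 k = (1 / t0 k) *\<^sub>R (y (k + M) - yb)" for k
  have t0: "t0 k > 0" for k using ne by (simp add: t0_def)
  have p0: "norm (p0 k) = 1" for k using t0[of k] by (simp add: p0_def t0_def)
  have "bounded (range p0)" "bounded (range l)" using p0 l_bd by (auto simp: bounded_iff)
  from bounded_Times[OF this] have "bounded (range (\<lambda>k. (p0 k, l k)))" by (rule bounded_subset) auto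
  then obtain vl r1 where r1: "strict_mono (r1 :: nat \<Rightarrow> nat)" "(\<lambda>k. (p0 (r1 k), l (r1 k))) \<longlonglongrightarrow> vl"
    by (rule bounded_subsequence)
  obtain r2 c where r2: "strict_mono (r2 :: nat \<Rightarrow> nat)"
    "\<And>k. (\<lambda>k. (active q (y (r1 k + M)), {i. l (r1 k) $ i > 0})) (r2 k) = c"
    using constant_subsequence[of "\<lambda>k. (active q (y (r1 k + M)), {i. l (r1 k) $ i > 0})"] by blast
  obtain I Ip where c: "c = (I, Ip)" by (cases c)
  obtain v lam where vl: "vl = (v, lam)" by (cases vl)
  define r where "r k = r1 (r2 k)" for k
  have r: "strict_mono r" using r1(1) r2(1) by (simp add: r_def strict_mono_def)
  define Y T P L W where "Y k = y (r k + M)" and "T k = t0 (r k)" and "P k = p0 (r k)" and "L k = l (r k)"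
    and "W k = m (r k + M)" for k
  have lims: "Y \<longlonglongrightarrow> yb" "(\<lambda>k. n (r k + M)) \<longlonglongrightarrow> ys" "W \<longlonglongrightarrow> m'"
    unfolding Y_def W_def
    using LIMSEQ_subseq_LIMSEQ[OF LIMSEQ_ignore_initial_segment[OF lim(1), of M] r]
      LIMSEQ_subseq_LIMSEQ[OF LIMSEQ_ignore_initial_segment[OF lim(2), of M] r]
      LIMSEQ_subseq_LIMSEQ[OF LIMSEQ_ignore_initial_segment[OF mlim, of M] r] by (simp_all add: o_def)
  have PL: "P \<longlonglongrightarrow> v" "L \<longlonglongrightarrow> lam"
    using tendsto_fst[OF LIMSEQ_subseq_LIMSEQ[OF r1(2) r2(1)]] tendsto_snd[OF LIMSEQ_subseq_LIMSEQ[OF r1(2) r2(1)]]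
    by (simp_all add: o_def P_def[abs_def] L_def[abs_def] r_def vl)
  have T: "T k > 0" for k using t0 by (simp add: T_def)
  have YT: "Y k = yb + T k *\<^sub>R P k" for k using t0[of "r k"] by (simp add: Y_def T_def P_def p0_def)
  have T0: "T \<longlonglongrightarrow> 0"
  proof -
    have "(\<lambda>k. norm (Y k - yb)) \<longlonglongrightarrow> norm (yb - yb)" by (intro tendsto_intros lims)
    then show ?thesis by (simp add: T_def[abs_def] t0_def Y_def)
  qed
  have Y\<Gamma>: "Y k \<in> \<Gamma>" for k unfolding Y_def using gphD(2)[OF G] .
  have act: "active q (Y k) = I" and Lpos: "{i. L k $ i > 0} = Ip" for k
    using r2(2)[of k] unfolding c by (auto simp: Y_def L_def r_def)
  have Lc: "L k \<in> multiplier_cone q (Y k)" for k using l(1) by (simp add: L_def Y_def)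
  have v1: "norm v = 1"
    using tendsto_norm[OF PL(1)] p0 by (simp add: P_def LIMSEQ_const_iff)
  then have v0: "v \<noteq> 0" by auto
  have Idir: "I \<subseteq> active_dir q yb v"
    by (rule active_along_direction[OF T T0 PL(1)]) (simp add: act flip: YT)
  then have Iact: "I \<subseteq> active q yb" by (auto simp: active_dir_def)
  have lam_off: "lam $ i = 0" if "i \<notin> I" for i
  proof -
    have "L k $ i = 0" for k using Lc[of k] that by (simp add: multiplier_cone_def act)
    then show ?thesis using tendsto_vec_nth[OF PL(2), of i] by (simp add: LIMSEQ_const_iff)
  qed
  have lam_pos: "lam $ i \<ge> 0" for i
    by (rule tendsto_lowerbound[OF tendsto_vec_nth[OF PL(2)]]) (use Lc in \<open>auto simp: multiplier_cone_def\<close>)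
  \<comment> \<open>As the active set is constant, the limit \<open>lam\<close> is itself a
    multiplier at each \<open>Y k\<close>; this gives the tangent belonging to
    \<open>mu = 0\<close>.\<close>
  have lam_cone: "lam \<in> multiplier_cone q (Y k)" for k using lam_off lam_pos by (simp add: multiplier_cone_def act)
  have lam_yb: "lam \<in> multiplier_cone q yb" using lam_off lam_pos Iact by (auto simp: multiplier_cone_def)
  have "(\<lambda>k. adj (Y k) (L k)) \<longlonglongrightarrow> adj yb lam" by (rule adj_tendsto[OF lims(1) PL(2)])
  moreover have adjL: "adj (Y k) (L k) = n (r k + M)" for k by (simp add: Y_def L_def l(2))
  ultimately have adj_lam: "adj yb lam = ys" using lims(2) LIMSEQ_unique by auto
  have lam_mult: "lam \<in> multipliers q yb ys" using lam_yb adj_lam by (simp add: mem_multipliers)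
  have YTf: "yb + T k *\<^sub>R P k \<in> \<Gamma>" "active q (yb + T k *\<^sub>R P k) = I" "lam \<in> multiplier_cone q (yb + T k *\<^sub>R P k)" for k
    using Y\<Gamma>[of k] act[of k] lam_cone[of k] by (simp_all add: YT)
  have "v \<in> contingent_cone \<Gamma> yb" by (rule contingent_coneI[OF T T0 PL(1) YTf(1)])
  moreover have "ys \<bullet> v = 0"
    unfolding adj_lam[symmetric] using Idir
    by (subst adj_inner_active[of I]) (auto simp: lam_off active_dir_def intro!: sum.neutral)
  ultimately have crit: "v \<in> critical_cone q yb ys" by (simp add: critical_cone_def)
  obtain z where z: "z \<in> second_order_set q yb v" "\<forall>i\<in>I. grad i yb \<bullet> z + v \<bullet> (hess i yb *v v) = 0"
    using second_order_solution[OF yb T T0 PL(1) YTf(1), of I] YTf(2) Iact by blast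
  define J where "J = active_second q yb v z"
  have J: "J \<in> index_sets q yb v" using z(1) by (simp add: J_def index_sets_def)
  have IJ: "I \<subseteq> J" using z(2) Idir by (auto simp: J_def active_second_def)
  \<comment> \<open>2-regularity is given for maximal index sets and is inherited by the subset
    \<open>I\<close>.\<close>
  obtain Jm where Jm: "Jm \<in> maximal_index_sets q yb v" "J \<subseteq> Jm" by (rule maximal_superset[OF J])
  have reg: "two_regular I (\<lambda>i y. q y $ i) yb v"
    by (rule two_regular_subset[OF two_reg[OF crit v0 Jm(1)]]) (use IJ Jm(2) in blast)
  have IpI: "Ip \<subseteq> I"
    using Lc[of 0] Lpos[of 0] by (force simp: multiplier_cone_def act)
  have ev: "\<forall>\<^sub>F k in sequentially. snd (W k) \<in> K_cone q (Y k) Ip I \<and>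
     fst (W k) + hess_lagr q (L k) (Y k) *v snd (W k) \<in> negative_polar (K_cone q (Y k) Ip I)"
    using licq_along_direction[OF reg T T0 PL(1)]
  proof eventually_elim
    case (elim k)
    have "(fst (W k), snd (W k)) \<in> regular_normal_cone G (Y k, adj (Y k) (L k))"
      using m[of "r k + M"] by (simp add: W_def Y_def L_def l(2))
    from licq_normal_imp[OF Y\<Gamma> _ Lc this] elim show ?case by (simp add: act Lpos flip: YT)
  qed
  then obtain M' where M': "\<And>k. k \<ge> M' \<Longrightarrow> snd (W k) \<in> K_cone q (Y k) Ip I"
    unfolding eventually_sequentially by blast
  have Wlim: "(\<lambda>k. fst (W k)) \<longlonglongrightarrow> fst m'" "(\<lambda>k. snd (W k)) \<longlonglongrightarrow> snd m'"
    using tendsto_fst[OF lims(3)] tendsto_snd[OF lims(3)] by auto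
  have w: "snd m' \<in> K_cone_dir q yb v Ip I"
  proof (rule K_cone_outer_limit)
    show "T (k + M') > 0" for k by (rule T)
    show "(\<lambda>k. T (k + M')) \<longlonglongrightarrow> 0" by (rule LIMSEQ_ignore_initial_segment[OF T0])
    show "(\<lambda>k. P (k + M')) \<longlonglongrightarrow> v" by (rule LIMSEQ_ignore_initial_segment[OF PL(1)])
    show "(\<lambda>k. snd (W (k + M'))) \<longlonglongrightarrow> snd m'" by (rule LIMSEQ_ignore_initial_segment[OF Wlim(2)])
    show "snd (W (k + M')) \<in> K_cone q (yb + T (k + M') *\<^sub>R P (k + M')) Ip I" for k
      using M'[of "k + M'"] by (simp add: YT)
  qed
  have ws: "fst m' + hess_lagr q lam yb *v snd m' \<in> negative_polar (K_cone_dir q yb v Ip I)"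
  proof (rule polar_in_limit)
    show "\<forall>\<^sub>F k in sequentially. fst (W k) + hess_lagr q (L k) (Y k) *v snd (W k) \<in> negative_polar (K_cone q (Y k) Ip I)"
      using ev by eventually_elim blast
    show "(\<lambda>k. fst (W k) + hess_lagr q (L k) (Y k) *v snd (W k)) \<longlonglongrightarrow> fst m' + hess_lagr q lam yb *v snd m'"
      by (intro tendsto_add Wlim hess_lagr_tendsto PL lims)
    show "\<exists>u. (\<forall>\<^sub>F k in sequentially. u k \<in> K_cone q (Y k) Ip I) \<and> u \<longlonglongrightarrow> w" if "w \<in> K_cone_dir q yb v Ip I" for w
      unfolding YT by (rule K_cone_inner_limit[OF reg IpI T T0 PL(1) that])
  qed
  have lam_dir: "lam \<in> multipliers_dir q yb ys v"
  proof (rule multipliers_dir_of_limit[OF lam_mult _ T T0 PL(1) YTf(1)])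
    show "lam $ i = 0" if "i \<notin> I" for i using that by (rule lam_off)
    show "I \<subseteq> active q (yb + T k *\<^sub>R P k)" for k by (simp only: YTf(2))
  qed
  have tan: "(v, hess_lagr q lam yb *v v) \<in> contingent_cone G (yb, ys)"
    using multiplier_tangent[OF YTf(3,1) T T0 PL(1)] adj_lam by simp
  \<comment> \<open>Positivity of a limit entry passes back to the sequence. Positive entries may
    vanish in the limit, which is why \<open>Ip\<close> can be larger.\<close>
  have Iplus: "I_plus lam 0 \<subseteq> Ip"
  proof
    fix i assume "i \<in> I_plus lam 0"
    then have "lam $ i > 0" by (simp add: I_plus_def)
    with tendsto_vec_nth[OF PL(2)] have "\<forall>\<^sub>F k in sequentially. L k $ i > 0" by (rule order_tendstoD)
    then obtain k where "L k $ i > 0" using eventually_happens'[OF sequentially_bot] by blast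
    then show "i \<in> Ip" using Lpos[of k] by blast
  qed
  show ?thesis
    by (rule directional_normalsI[OF tan v0 zero_multiplier_pair[OF lam_dir] J Iplus IpI IJ])
      (use w ws in \<open>simp add: Q_set_def case_prod_beta\<close>)
qed


text \<open>Every normal at \<open>yb\<close> is a combination of active gradients, hence orthogonal
  to the null space.\<close>

lemma critical_of_null:
  assumes "v \<in> active_null_space q yb"
  shows "v \<in> critical_cone q yb ys"
proof -
  have v: "grad i yb \<bullet> v = 0" if "i \<in> active q yb" for i
    using assms that by (simp add: active_null_space_def)
  then have "v \<in> contingent_cone \<Gamma> yb" by (intro linearized_tangent[OF eb yb]) simp
  moreover obtain l where "l \<in> multiplier_cone q yb" "adj yb l = ys"
    using normal_multiplier[OF eb yb ys] by blast
  then have "ys \<bullet> v = 0" using v adj_inner_active[of "active q yb" l yb v] by (auto simp: multiplier_cone_def)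
  ultimately show ?thesis by (simp add: critical_cone_def)
qed

text \<open>The radius concerns only the point and is the same for all \<open>n\<close>, as needed
  for normals over \<open>yb\<close> other than \<open>ys\<close>.\<close>

lemma graph_closed_near_reference:
  obtains \<rho> where "\<rho> > 0" "\<And>n. closed (G \<inter> cball (yb, n) \<rho>)"
proof -
  obtain \<rho> where \<rho>: "\<rho> > 0" "closed (G \<inter> (cball yb \<rho> \<times> UNIV))" by (rule graph_locally_closed)
  have "G \<inter> cball (yb, n) \<rho> = (G \<inter> (cball yb \<rho> \<times> UNIV)) \<inter> cball (yb, n) \<rho>" for n
    using dist_fst_le[of "(yb, n)"] by (fastforce intro: order_trans)
  then have "closed (G \<inter> cball (yb, n) \<rho>)" for n using \<rho>(2) by (metis closed_Int closed_cball)
  with \<rho>(1) show ?thesis by (rule that)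
qed

text \<open>For \<open>v\<close> in the null space both \<open>v\<close> and \<open>- v\<close> give rise to tangents to the graph, with opposite
  second components. So \<open>m\<close> is orthogonal to the first of them, and regular_normal_along_tangent
  applies.\<close>

lemma normal_at_reference:
  assumes n: "n \<in> N yb" and m: "m \<in> regular_normal_cone G (yb, n)" and "e > 0"
  shows "\<exists>y n' m'. (y, n') \<in> G \<and> y \<noteq> yb \<and> m' \<in> regular_normal_cone G (y, n') \<and>
    dist (y, n') (yb, n) < e \<and> dist m' m < e"
proof -
  have "0 \<in> active_null_space q yb" by (simp add: active_null_space_def)
  then obtain v where v: "v \<in> active_null_space q yb" "v \<noteq> 0" using null_space by blast
  have gv: "grad i yb \<bullet> v = 0" if "i \<in> active q yb" for i
    using v(1) that by (simp add: active_null_space_def)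
  define h where "h i = v \<bullet> (hess i yb *v v)" for i
  have "v \<in> contingent_cone \<Gamma> yb" using critical_of_null[OF v(1)] by (simp add: critical_cone_def)
  then obtain t w where "\<And>k. t k > 0" "t \<longlonglongrightarrow> 0" "w \<longlonglongrightarrow> v" "\<And>k. yb + t k *\<^sub>R w k \<in> \<Gamma>"
    by (rule contingent_coneE) blast
  \<comment> \<open>With no equalities imposed, this says that the linear program with constants
    \<open>h\<close> is feasible.\<close>
  from second_order_solution[OF yb this, of "{}"]
  have feas: "\<exists>z. \<forall>i\<in>active q yb. grad i yb \<bullet> z + h i \<le> 0"
    by (auto simp: second_order_set_def h_def)
  obtain l where l: "l \<in> multiplier_cone q yb" "adj yb l = n"
    using normal_multiplier[OF eb yb n] by blast
  have nl: "n = (\<Sum>i\<in>active q yb. l $ i *\<^sub>R grad i yb)"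
    unfolding l(2)[symmetric] adj_def using l(1)
    by (intro sum.mono_neutral_right) (auto simp: multiplier_cone_def)
  have l0: "l $ i \<ge> 0" for i using l(1) by (simp add: multiplier_cone_def)
  \<comment> \<open>A multiplier of \<open>n\<close> supported on the constraints that
    \<open>z\<close> makes active: it remains a multiplier along a curve on which exactly these are
    active.\<close>
  obtain z \<mu> where
    z: "\<And>i. i \<in> active q yb \<Longrightarrow> grad i yb \<bullet> z + h i \<le> 0" and
    \<mu>: "\<And>i. \<mu> i \<ge> 0" "\<And>i. i \<notin> active q yb \<Longrightarrow> \<mu> i = 0"
      "\<And>i. \<mu> i > 0 \<Longrightarrow> grad i yb \<bullet> z + h i = 0"
      "n = (\<Sum>i\<in>active q yb. \<mu> i *\<^sub>R grad i yb)"
  proof (rule linear_program_multiplier[OF feas l0 nl])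
    fix z m
    assume "\<And>i. i \<in> active q yb \<Longrightarrow> grad i yb \<bullet> z + h i \<le> 0" "\<And>i. m i \<ge> 0"
      "\<And>i. i \<notin> active q yb \<Longrightarrow> m i = 0" "\<And>i. m i > 0 \<Longrightarrow> grad i yb \<bullet> z + h i = 0"
      "n = (\<Sum>i\<in>active q yb. m i *\<^sub>R grad i yb)"
    then show thesis by (rule that)
  qed
  define lam where "lam = (\<chi> i. \<mu> i)"
  have adj: "adj yb lam = n"
    unfolding \<mu>(4) adj_def lam_def using \<mu>(2) by (auto intro: sum.mono_neutral_right)
  \<comment> \<open>\<open>u\<close> enters only through its quadratic forms, so the same
    \<open>z\<close> and \<open>lam\<close> serve for \<open>v\<close> and
    \<open>- v\<close>.\<close>
  have tangent: "(u, hess_lagr q lam yb *v u) \<in> contingent_cone G (yb, n)"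
    if u: "u \<in> active_null_space q yb" "u \<noteq> 0" and hu: "\<And>i. u \<bullet> (hess i yb *v u) = h i" for u
  proof -
    have gu: "grad i yb \<bullet> u = 0" if "i \<in> active q yb" for i
      using u(1) that by (simp add: active_null_space_def)
    let ?J = "active_second q yb u z"
    have "?J \<in> index_sets q yb u" using z by (auto simp: index_sets_def second_order_set_def hu)
    then obtain Jm where Jm: "Jm \<in> maximal_index_sets q yb u" "?J \<subseteq> Jm" by (rule maximal_superset)
    obtain t p where t: "\<And>k. t k > 0" "t \<longlonglongrightarrow> 0" "p \<longlonglongrightarrow> u" "\<And>k::nat. yb + t k *\<^sub>R p k \<in> \<Gamma>"
      "\<And>k. active q (yb + t k *\<^sub>R p k) = ?J"
      by (rule feasible_curve[OF yb _ Jm(1) two_reg[OF critical_of_null[OF u(1)] u(2) Jm(1)] Jm(2)]) (use gu in auto)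
    have J: "i \<in> ?J" if "\<mu> i > 0" for i
      using \<mu>(2)[of i] \<mu>(3)[OF that] that gu by (force simp: active_second_def active_dir_def hu)
    have "lam \<in> multiplier_cone q (yb + t k *\<^sub>R p k)" for k
      using \<mu>(1) J by (force simp: multiplier_cone_def lam_def t(5) order_le_less)
    from multiplier_tangent[OF this t(4,1-3)] adj show ?thesis by simp
  qed
  have mv: "- v \<in> active_null_space q yb" "- v \<noteq> 0" using v by (simp_all add: active_null_space_def)
  have neg: "A *v (- v) = - (A *v v)" for A :: "real^'m^'m"
    by (rule linear_neg[OF matrix_vector_mul_linear])
  have "(- v) \<bullet> (hess i yb *v (- v)) = h i" for i
    by (simp add: h_def neg)
  note tan1 = tangent[OF v h_def[symmetric]] and tan2 = tangent[OF mv this]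
  let ?u = "(v, hess_lagr q lam yb *v v)"
  have "hess_lagr q lam yb *v (- v) = - (hess_lagr q lam yb *v v)"
    by (rule neg)
  then have "- ?u \<in> contingent_cone G (yb, n)" using tan2 by simp
  from regular_normal_dot[OF m this] have "m \<bullet> ?u \<ge> 0" by (simp only: inner_minus_right neg_le_0_iff_le)
  then have orth: "m \<bullet> ?u = 0" using regular_normal_dot[OF m tan1] by simp
  obtain \<rho> where \<rho>: "\<rho> > 0" "\<And>n. closed (G \<inter> cball (yb, n) \<rho>)" by (rule graph_closed_near_reference) blast
  obtain t g m' where t: "\<And>k. t k > 0" "t \<longlonglongrightarrow> 0" and g: "\<And>k::nat. g k \<in> G"
    "\<And>k. m' k \<in> regular_normal_cone G (g k)" "(\<lambda>k. (1 / t k) *\<^sub>R (g k - (yb, n))) \<longlonglongrightarrow> ?u" "m' \<longlonglongrightarrow> m"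
    by (rule regular_normal_along_tangent[OF \<rho>(2) \<rho>(1) m tan1 orth]) blast
  have "(yb, n) + t k *\<^sub>R (1 / t k) *\<^sub>R (g k - (yb, n)) = g k" for k using t(1)[of k] by simp
  then have "g \<longlonglongrightarrow> (yb, n)" using tendsto_along_direction[OF t g(3), of "(yb, n)"] by simp
  then have "\<forall>\<^sub>F k in sequentially. dist (g k) (yb, n) < e" using \<open>e > 0\<close> by (rule tendstoD)
  moreover have "\<forall>\<^sub>F k in sequentially. dist (m' k) m < e" using g(4) \<open>e > 0\<close> by (rule tendstoD)
  moreover have "(\<lambda>k. (1 / t k) *\<^sub>R (fst (g k) - yb)) \<longlonglongrightarrow> v" using tendsto_fst[OF g(3)] by simp
  then have "\<forall>\<^sub>F k in sequentially. (1 / t k) *\<^sub>R (fst (g k) - yb) \<noteq> 0"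
    using v(2) by (rule tendsto_imp_eventually_ne)
  ultimately have "\<forall>\<^sub>F k in sequentially. dist (g k) (yb, n) < e \<and> dist (m' k) m < e \<and> fst (g k) \<noteq> yb"
    by eventually_elim auto
  then obtain k where k: "dist (g k) (yb, n) < e" "dist (m' k) m < e" "fst (g k) \<noteq> yb"
    using eventually_happens'[OF sequentially_bot] by blast
  then show ?thesis using g(1,2)[of k] by (intro exI[of _ "fst (g k)"] exI[of _ "snd (g k)"] exI[of _ "m' k"]) simp
qed

text \<open>By \<open>normal_at_reference\<close> each normal over \<open>yb\<close> can be
  exchanged, up to an error 1 / (k + 1), for one over another point.\<close>

lemma limiting_normal_subset: "limiting_normal_cone G (yb, ys) \<subseteq> directional_normals q yb ys"
proof
  fix m' assume "m' \<in> limiting_normal_cone G (yb, ys)"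
  then obtain g m where g: "\<And>k. g k \<in> G" "\<And>k. m k \<in> regular_normal_cone G (g k)"
    "g \<longlonglongrightarrow> (yb, ys)" "m \<longlonglongrightarrow> m'" unfolding limiting_normal_cone_def by blast
  let ?e = "\<lambda>k. inverse (real (Suc k))"
  have "\<forall>k. \<exists>x. fst x \<in> G \<and> fst (fst x) \<noteq> yb \<and> snd x \<in> regular_normal_cone G (fst x) \<and>
    dist (fst x) (g k) < ?e k \<and> dist (snd x) (m k) < ?e k"
  proof
    fix k
    show "\<exists>x. fst x \<in> G \<and> fst (fst x) \<noteq> yb \<and> snd x \<in> regular_normal_cone G (fst x) \<and>
      dist (fst x) (g k) < ?e k \<and> dist (snd x) (m k) < ?e k"
    proof (cases "fst (g k) = yb")
      case False
      then show ?thesis using g(1,2)[of k] by (intro exI[of _ "(g k, m k)"]) simp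
    next
      case True
      then have gk: "g k = (yb, snd (g k))" by (simp add: prod_eq_iff)
      then have "snd (g k) \<in> N yb" using g(1)[of k] gphD(1) by metis
      moreover have "m k \<in> regular_normal_cone G (yb, snd (g k))" using g(2)[of k] gk by simp
      ultimately obtain y n' m'' where *: "(y, n') \<in> G" "y \<noteq> yb" "m'' \<in> regular_normal_cone G (y, n')"
        "dist (y, n') (yb, snd (g k)) < ?e k" "dist m'' (m k) < ?e k"
        using normal_at_reference[of "snd (g k)" "m k" "?e k"] by auto
      then show ?thesis using gk by (intro exI[of _ "((y, n'), m'')"]) auto
    qed
  qed
  from choice[OF this] obtain x where x: "\<And>k. fst (x k) \<in> G" "\<And>k. fst (fst (x k)) \<noteq> yb"
    "\<And>k. snd (x k) \<in> regular_normal_cone G (fst (x k))"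
    "\<And>k. dist (fst (x k)) (g k) < ?e k" "\<And>k. dist (snd (x k)) (m k) < ?e k" by blast
  have near: "a \<longlonglongrightarrow> l" if "b \<longlonglongrightarrow> l" "\<And>k. dist (a k) (b k) < ?e k"
    for a b :: "nat \<Rightarrow> (real^'m) \<times> (real^'m)" and l
  proof -
    have "(\<lambda>k. a k - b k) \<longlonglongrightarrow> 0"
      by (rule Lim_null_comparison[OF _ LIMSEQ_inverse_real_of_nat])
        (use that(2) in \<open>auto simp: dist_norm intro!: always_eventually less_imp_le\<close>)
    from tendsto_add[OF this that(1)] show ?thesis by simp
  qed
  note xl = near[OF g(3) x(4)] and xm = near[OF g(4) x(5)]
  show "m' \<in> directional_normals q yb ys"
  proof (rule limit_of_normals_off_reference)
    show "(fst (fst (x k)), snd (fst (x k))) \<in> G" for k using x(1) by simp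
    show "snd (x k) \<in> regular_normal_cone G (fst (fst (x k)), snd (fst (x k)))" for k using x(3) by simp
    show "(\<lambda>k. fst (fst (x k))) \<longlonglongrightarrow> yb" "(\<lambda>k. snd (fst (x k))) \<longlonglongrightarrow> ys"
      using tendsto_fst[OF xl] tendsto_snd[OF xl] by simp_all
  qed (fact x(2) xm)+
qed

text \<open>A given element is realized along a curve whose active set is exactly \<open>I\<close>,
  with multipliers positive exactly on \<open>Ip\<close>. The vectors w and ws + H w, with H the
  Hessian of the Lagrangian, are approximated in the cones along it and in their polars, and
  \<open>licq_normalI\<close> turns the approximations into regular normals.\<close>

lemma directional_subset: "directional_normals q yb ys \<subseteq> limiting_normal_cone G (yb, ys)"
proof
  fix m' assume "m' \<in> directional_normals q yb ys"
  then obtain v vs lam mu J Ip I where d: "(v, vs) \<in> contingent_cone G (yb, ys)" "v \<noteq> 0"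
    "(lam, mu) \<in> multiplier_pairs q yb ys v vs" "J \<in> index_sets q yb v"
    "I_plus lam mu \<subseteq> Ip" "Ip \<subseteq> I" "I \<subseteq> J" "m' \<in> Q_set q yb v lam Ip I"
    by (rule directional_normalsE)
  obtain ws w where m': "m' = (ws, w)" by (cases m')
  have w: "w \<in> K_cone_dir q yb v Ip I"
    and ws: "ws + hess_lagr q lam yb *v w \<in> negative_polar (K_cone_dir q yb v Ip I)"
    using d(8) by (auto simp: m' Q_set_def)
  have lam: "lam \<in> multiplier_cone q yb" "adj yb lam = ys"
    using d(3) by (auto simp: multiplier_pairs_def multipliers_dir_def mem_multipliers)
  have lam_Ip: "lam $ i = 0" if "i \<notin> Ip" for i
  proof -
    have "\<not> lam $ i > 0" using d(5) that by (auto simp: I_plus_def)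
    then show ?thesis using lam(1) by (auto simp: multiplier_cone_def not_less intro: antisym)
  qed
  have Jdir: "J \<subseteq> active_dir q yb v" using d(4) by (auto simp: index_sets_def active_second_def)
  have tan: "v \<in> contingent_cone \<Gamma> yb"
  proof -
    obtain t x where t: "\<And>k. t k > 0" "t \<longlonglongrightarrow> 0" "x \<longlonglongrightarrow> (v, vs)" "\<And>k. (yb, ys) + t k *\<^sub>R x k \<in> G"
      using d(1) by (rule contingent_coneE) blast
    show ?thesis
    proof (rule contingent_coneI[OF t(1,2)])
      show "(\<lambda>k. fst (x k)) \<longlonglongrightarrow> v" using tendsto_fst[OF t(3)] by simp
      show "yb + t k *\<^sub>R fst (x k) \<in> \<Gamma>" for k using t(4)[of k] gphD(2) by (cases "x k") auto
    qed
  qed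
  have "ys \<bullet> v = 0"
    unfolding lam(2)[symmetric]
  proof (subst adj_inner_active[of Ip])
    show "(\<Sum>i\<in>Ip. lam $ i * (grad i yb \<bullet> v)) = 0"
      using d(6,7) Jdir by (intro sum.neutral) (auto simp: active_dir_def)
  qed (rule lam_Ip)
  then have crit: "v \<in> critical_cone q yb ys" using tan by (simp add: critical_cone_def)
  obtain Jm where Jm: "Jm \<in> maximal_index_sets q yb v" "J \<subseteq> Jm" by (rule maximal_superset[OF d(4)])
  have regm: "two_regular Jm (\<lambda>i y. q y $ i) yb v" by (rule two_reg[OF crit d(2) Jm(1)])
  have reg: "two_regular I (\<lambda>i y. q y $ i) yb v" by (rule two_regular_subset[OF regm]) (use d(7) Jm(2) in blast)
  obtain t p where t: "\<And>k. t k > 0" "t \<longlonglongrightarrow> 0" "p \<longlonglongrightarrow> v" and f: "\<And>k::nat. yb + t k *\<^sub>R p k \<in> \<Gamma>"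
    and act: "\<And>k. active q (yb + t k *\<^sub>R p k) = I"
    by (rule feasible_curve[OF yb tangent_linearized[OF tan] Jm(1) regm, of I]) (use d(7) Jm(2) in auto)
  let ?y = "\<lambda>k. yb + t k *\<^sub>R p k"
  let ?K = "\<lambda>k. K_cone q (?y k) Ip I"
  have yl: "?y \<longlonglongrightarrow> yb" by (rule tendsto_along_direction[OF t])
  \<comment> \<open>Adding t times the indicator of \<open>Ip\<close> makes the positive entries
    exactly \<open>Ip\<close> without changing the limit; \<open>lam\<close> vanishes off
    \<open>Ip\<close> because \<open>I_plus lam mu\<close> is contained in it.\<close>
  define l where "l k = lam + t k *\<^sub>R (\<chi> i. if i \<in> Ip then 1 else 0)" for k
  have "l \<longlonglongrightarrow> lam + 0 *\<^sub>R (\<chi> i. if i \<in> Ip then 1 else 0)" unfolding l_def by (intro tendsto_intros t)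
  then have ll: "l \<longlonglongrightarrow> lam" by simp
  have l_nonneg: "lam $ i \<ge> 0" for i using lam(1) by (simp add: multiplier_cone_def)
  have l_pos: "{i. l k $ i > 0} = Ip" for k
    using lam_Ip l_nonneg t(1)[of k] by (auto simp: l_def add_nonneg_pos split: if_splits)
  have l_cone: "l k \<in> multiplier_cone q (?y k)" for k
    using lam_Ip l_nonneg t(1)[of k] d(6) by (auto simp: multiplier_cone_def act l_def less_imp_le)
  obtain u where u: "\<forall>\<^sub>F k in sequentially. u k \<in> ?K k" "u \<longlonglongrightarrow> w"
    using K_cone_inner_limit[OF reg d(6) t w] by blast
  obtain x where x: "\<And>k. x k \<in> negative_polar (?K k)" "x \<longlonglongrightarrow> ws + hess_lagr q lam yb *v w"
  proof (rule polar_approximable[OF K_cone_convex_cone K_cone_closed _ ws])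
    fix r w w' assume r: "strict_mono (r :: nat \<Rightarrow> nat)" and w: "\<And>k. w k \<in> ?K (r k)" "w \<longlonglongrightarrow> w'"
    show "w' \<in> K_cone_dir q yb v Ip I"
      by (rule K_cone_outer_limit[of "\<lambda>k. t (r k)" "\<lambda>k. p (r k)", OF t(1) _ _ w])
        (use LIMSEQ_subseq_LIMSEQ[OF t(2) r] LIMSEQ_subseq_LIMSEQ[OF t(3) r] in \<open>simp_all add: o_def\<close>)
  qed blast
  define m where "m k = (x k - hess_lagr q (l k) (?y k) *v u k, u k)" for k
  have "(\<lambda>k. x k - hess_lagr q (l k) (?y k) *v u k) \<longlonglongrightarrow> (ws + hess_lagr q lam yb *v w) - hess_lagr q lam yb *v w"
    by (intro tendsto_diff x hess_lagr_tendsto ll yl u)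
  then have ml: "m \<longlonglongrightarrow> m'" unfolding m_def m' by (intro tendsto_Pair u) simp
  obtain \<rho> \<kappa> where \<rho>: "\<rho> > 0"
    "\<And>y n. y \<in> \<Gamma> \<Longrightarrow> dist y yb < \<rho> \<Longrightarrow> n \<in> N y \<Longrightarrow> \<exists>lam\<in>multiplier_cone q y. adj y lam = n"
    by (rule vicinityE) blast
  have "\<forall>\<^sub>F k in sequentially. m k \<in> regular_normal_cone G (?y k, adj (?y k) (l k))"
    using licq_along_direction[OF reg t] u(1) tendstoD[OF yl \<rho>(1)]
  proof eventually_elim
    case (elim k)
    have rep: "\<exists>lam\<in>multiplier_cone q y. adj y lam = n"
      if "y \<in> \<Gamma>" "dist y (?y k) < \<rho> - dist (?y k) yb" "n \<in> N y" for y n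
      using that dist_triangle[of y yb "?y k"] by (intro \<rho>(2)) auto
    have pos: "\<rho> - dist (?y k) yb > 0" using elim(3) by linarith
    show ?case unfolding m_def
      by (rule licq_normalI[OF f _ l_cone rep pos])
        (use elim x(1) in \<open>simp_all add: act l_pos\<close>)
  qed
  then obtain M where M: "\<And>k. k \<ge> M \<Longrightarrow> m k \<in> regular_normal_cone G (?y k, adj (?y k) (l k))"
    unfolding eventually_sequentially by blast
  have gl: "(\<lambda>k. (?y k, adj (?y k) (l k))) \<longlonglongrightarrow> (yb, ys)"
    unfolding lam(2)[symmetric] by (intro tendsto_Pair yl adj_tendsto ll)
  show "m' \<in> limiting_normal_cone G (yb, ys)"
    unfolding limiting_normal_cone_def
  proof (intro CollectI exI conjI allI)
    show "(?y (k + M), adj (?y (k + M)) (l (k + M))) \<in> G" for k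
      using multiplier_normal[OF f l_cone] by (simp add: gph_def)
    show "m (k + M) \<in> regular_normal_cone G (?y (k + M), adj (?y (k + M)) (l (k + M)))" for k by (rule M) simp
    show "(\<lambda>k. (?y (k + M), adj (?y (k + M)) (l (k + M)))) \<longlonglongrightarrow> (yb, ys)"
      by (rule LIMSEQ_ignore_initial_segment[OF gl])
    show "(\<lambda>k. m (k + M)) \<longlonglongrightarrow> m'" by (rule LIMSEQ_ignore_initial_segment[OF ml])
  qed
qed

lemma limiting_normal_eq: "limiting_normal_cone G (yb, ys) = directional_normals q yb ys"
  using limiting_normal_subset directional_subset by blast

end

section \<open>The coderivative criterion for the Aubin property\<close>

text \<open>The criterion sees the normal cone mapping only through its graph, so \<open>G\<close>
  is an arbitrary set here.\<close>

locale generalized_equation =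
  fixes F :: "'x::euclidean_space \<times> 'y::euclidean_space \<Rightarrow> 'y"
    and F' :: "'x \<times> 'y \<Rightarrow> ('x \<times> 'y) \<Rightarrow>\<^sub>L 'y" and G :: "('y \<times> 'y) set"
    and xb :: 'x and yb :: 'y
  assumes deriv: "\<And>z. (F has_derivative blinfun_apply (F' z)) (at z)"
    and cont: "continuous_on UNIV F'"
    and ref: "(yb, - F (xb, yb)) \<in> G"
begin

definition S :: "'x \<Rightarrow> 'y set" where "S x = {y. (y, - F (x, y)) \<in> G}"

abbreviation "z0 \<equiv> (xb, yb)"
abbreviation "g0 \<equiv> (yb, - F (xb, yb))"

definition adjoint_y :: "'x \<times> 'y \<Rightarrow> 'y \<Rightarrow> 'y" where
  "adjoint_y z p = (\<Sum>b\<in>Basis. (p \<bullet> F' z (0, b)) *\<^sub>R b)"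

lemma F'_add: "F' z (h, v) = F' z (h, 0) + F' z (0, v)"
  by (simp flip: blinfun.add_right)

lemma F'_lim: "z \<longlonglongrightarrow> z' \<Longrightarrow> h \<longlonglongrightarrow> h' \<Longrightarrow> (\<lambda>k. F' (z k) (h k)) \<longlonglongrightarrow> F' z' h'"
  using cont by (intro tendsto_intros) (auto intro: continuous_on_tendsto_compose)

lemma adjoint_y_inner: "adjoint_y z p \<bullet> v = p \<bullet> F' z (0, v)"
proof -
  have lin: "linear (\<lambda>v. F' z (0, v))"
    by (intro bounded_linear.linear bounded_linear_compose[OF blinfun.bounded_linear_right] bounded_linear_intros)
  have "F' z (0, v) = F' z (0, \<Sum>b\<in>Basis. (v \<bullet> b) *\<^sub>R b)" by (simp add: euclidean_representation)
  also have "\<dots> = (\<Sum>b\<in>Basis. (v \<bullet> b) *\<^sub>R F' z (0, b))"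
    by (simp only: linear_sum[OF lin] linear_scale[OF lin])
  finally show ?thesis
    by (simp add: adjoint_y_def inner_sum_left inner_sum_right inner_commute[of _ v] mult.commute)
qed

lemma adjoint_y_lim: "z \<longlonglongrightarrow> z' \<Longrightarrow> p \<longlonglongrightarrow> p' \<Longrightarrow> (\<lambda>k. adjoint_y (z k) (p k)) \<longlonglongrightarrow> adjoint_y z' p'"
  unfolding adjoint_y_def by (intro tendsto_intros F'_lim)

lemma F_continuous: "continuous_on A F"
  by (rule continuous_at_imp_continuous_on) (use has_derivative_continuous[OF deriv] in blast)

section \<open>Sufficiency: from failure of the Aubin property to a kernel element\<close>

lemma local_lipschitz:
  obtains L d where "L > 0" "d > 0" "\<And>z1 z2. dist z1 z0 < d \<Longrightarrow> dist z2 z0 < d \<Longrightarrow> norm (F z1 - F z2) \<le> L * norm (z1 - z2)"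
proof -
  define L where "L = norm (F' z0) + 1"
  have "L > 0" unfolding L_def by (simp add: add_nonneg_pos)
  have "isCont F' z0" using cont by (simp add: continuous_on_eq_continuous_at)
  then obtain d where d: "d > 0" "\<And>z. dist z z0 < d \<Longrightarrow> dist (F' z) (F' z0) < 1"
    unfolding continuous_at_eps_delta using zero_less_one by blast
  have B: "norm (F' z) \<le> L" if "dist z z0 < d" for z
    using d(2)[OF that] norm_triangle_sub[of "F' z" "F' z0"] by (simp add: L_def dist_norm)
  show ?thesis
  proof (rule that[OF \<open>L > 0\<close> d(1)])
    fix z1 z2 assume "dist z1 z0 < d" "dist z2 z0 < d"
    then show "norm (F z1 - F z2) \<le> L * norm (z1 - z2)"
      by (intro differentiable_bound[OF convex_ball[of z0 d] has_derivative_at_withinI[OF deriv]])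
        (use B in \<open>auto simp: dist_commute norm_blinfun.rep_eq\<close>)
  qed
qed

text \<open>If the Aubin property fails for the constant \<open>j * L\<close>, the residual of the equation, penalized
  quadratically, has a minimizer over the graph with nonzero residual. The optimality condition
  there gives a normal which up to \<open>2 / j\<close> lies in the kernel of the coderivative inclusion.\<close>

lemma almost_kernel_normal:
  assumes closed: "closed (G \<inter> cball g0 \<rho>)" and "\<rho> > 0" and no: "\<not> aubin_property S xb yb"
    and lip: "L > 0" "d > 0"
    "\<And>z1 z2. dist z1 z0 < d \<Longrightarrow> dist z2 z0 < d \<Longrightarrow> norm (F z1 - F z2) \<le> L * norm (z1 - z2)"
    and j: "j > 0"
  shows "\<exists>x g p m. g \<in> G \<and> m \<in> regular_normal_cone G g \<and> norm p = 1 \<and> dist x xb < 1 / j \<and> dist g g0 < 1 / j \<and>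
    dist m (- (adjoint_y (x, fst g) p, p)) \<le> 2 / j"
proof -
  define \<epsilon> where "\<epsilon> = min \<rho> (1 / j)"
  \<comment> \<open>The three terms of the denominator account for \<open>y1\<close> against
    \<open>yb\<close>, for the change of \<open>F\<close> at \<open>?g1\<close>, and for the
    distance from \<open>?g1\<close> to the minimizer. Together they stay within
    \<open>\<epsilon>\<close>, which keeps the minimizer inside the ball.\<close>
  define \<delta> where "\<delta> = min (d / 2) (\<epsilon> / (1 + 2 * L + 2 * j * L))"
  have pos: "1 + 2 * L + 2 * j * L > 0" using lip j by (intro add_pos_nonneg) auto
  have \<epsilon>: "\<epsilon> > 0" "\<epsilon> \<le> \<rho>" "\<epsilon> \<le> 1 / j" using \<open>\<rho> > 0\<close> j by (auto simp: \<epsilon>_def)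
  have \<delta>: "\<delta> > 0" using \<epsilon>(1) lip(2) pos by (simp add: \<delta>_def)
  have \<delta>d: "\<delta> \<le> d / 2" unfolding \<delta>_def by (rule min.cobounded1)
  have "\<delta> * (1 + 2 * L + 2 * j * L) \<le> \<epsilon>"
    using pos pos_le_divide_eq[OF pos, of \<delta> \<epsilon>] by (simp add: \<delta>_def)
  then have \<delta>\<epsilon>: "\<delta> + L * (2 * \<delta>) + j * L * (2 * \<delta>) \<le> \<epsilon>" by (simp add: algebra_simps)
  have "\<delta> * 1 \<le> \<delta> * (1 + 2 * L + 2 * j * L)" using lip j \<delta> by (intro mult_left_mono) auto
  then have \<delta>j: "\<delta> \<le> 1 / j" using \<open>\<delta> * (1 + 2 * L + 2 * j * L) \<le> \<epsilon>\<close> \<epsilon>(3) by linarith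
  have yS: "(xb, yb) \<in> gph S" using ref by (simp add: gph_def S_def)
  have "\<not> (\<forall>x1\<in>ball xb \<delta>. \<forall>x2\<in>ball xb \<delta>. S x1 \<inter> ball yb \<delta> \<subseteq>
           {s + ((j * L) * norm (x1 - x2)) *\<^sub>R b | s b. s \<in> S x2 \<and> b \<in> cball 0 1})"
  proof
    assume all: "\<forall>x1\<in>ball xb \<delta>. \<forall>x2\<in>ball xb \<delta>. S x1 \<inter> ball yb \<delta> \<subseteq>
           {s + ((j * L) * norm (x1 - x2)) *\<^sub>R b | s b. s \<in> S x2 \<and> b \<in> cball 0 1}"
    have "aubin_property S xb yb"
      unfolding aubin_property_def
      by (intro conjI yS exI[of _ "ball xb \<delta>"] exI[of _ "ball yb \<delta>"] exI[of _ "j * L"])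
        (use all \<delta> lip(1) j in auto)
    with no show False by blast
  qed
  then obtain x1 x2 where xb: "x1 \<in> ball xb \<delta>" "x2 \<in> ball xb \<delta>" and
    "\<not> S x1 \<inter> ball yb \<delta> \<subseteq> {s + ((j * L) * norm (x1 - x2)) *\<^sub>R b | s b. s \<in> S x2 \<and> b \<in> cball 0 1}" by blast
  then obtain y1 where y1b: "y1 \<in> S x1" "y1 \<in> ball yb \<delta>"
    and notin: "y1 \<notin> {s + ((j * L) * norm (x1 - x2)) *\<^sub>R b | s b. s \<in> S x2 \<and> b \<in> cball 0 1}" by blast
  have x: "dist x1 xb < \<delta>" "dist x2 xb < \<delta>" and y1: "y1 \<in> S x1" "dist y1 yb < \<delta>"
    using xb y1b by (simp_all add: dist_commute)
  have far: "norm (y1 - s) > j * L * norm (x1 - x2)" if s: "s \<in> S x2" for s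
  proof (rule ccontr)
    assume le: "\<not> ?thesis"
    have "\<exists>b\<in>cball 0 1. y1 = s + ((j * L) * norm (x1 - x2)) *\<^sub>R b"
    proof (cases "j * L * norm (x1 - x2) = 0")
      case True
      then show ?thesis using le by (intro bexI[of _ 0]) auto
    next
      case False
      then have "j * L * norm (x1 - x2) > 0" using j lip(1) by (simp add: order_le_less)
      then show ?thesis using le False
        by (intro bexI[of _ "(1 / (j * L * norm (x1 - x2))) *\<^sub>R (y1 - s)"]) (auto simp: divide_le_eq)
    qed
    then show False using notin s by blast
  qed
  define e where "e = norm (x1 - x2)"
  have e0: "e > 0"
  proof -
    have "x1 \<noteq> x2" using far[of y1] y1(1) by auto
    then show ?thesis by (simp add: e_def)
  qed
  have e2: "e < 2 * \<delta>"
    using x dist_triangle2[of x1 x2 xb] by (simp add: e_def dist_norm)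
  have close: "norm ((x', y') - z0) < 2 * \<delta>" if "dist x' xb < \<delta>" "dist y' yb < \<delta>" for x' y'
    using that norm_Pair_le[of "x' - xb" "y' - yb"] by (simp add: dist_norm)
  have zz: "dist (x1, y1) z0 < d" "dist (x2, y1) z0 < d"
    using close[OF x(1) y1(2)] close[OF x(2) y1(2)] \<delta>d by (simp_all add: dist_norm)
  let ?g1 = "(y1, - F (x1, y1))"
  have g1: "?g1 \<in> G" using y1(1) by (simp add: S_def)
  have g1_close: "norm (?g1 - g0) < \<delta> + L * (2 * \<delta>)"
  proof -
    have "norm (F (x1, y1) - F z0) \<le> L * norm ((x1, y1) - z0)" using zz lip(2) by (intro lip(3)) auto
    also have "\<dots> \<le> L * (2 * \<delta>)" using close[OF x(1) y1(2)] lip(1) by (intro mult_left_mono) auto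
    finally have "norm (F (x1, y1) - F z0) \<le> L * (2 * \<delta>)" .
    moreover have "norm (y1 - yb) < \<delta>" using y1(2) by (simp add: dist_norm)
    ultimately show ?thesis
      using norm_Pair_le[of "y1 - yb" "F z0 - F (x1, y1)"] by (simp add: norm_minus_commute)
  qed
  \<comment> \<open>Serves two bounds at once: as the minimum is at most L e, the minimizer lies
    within sqrt(c L e) = j L e of \<open>?g1\<close>, and the gradient of the penalty there has norm
    at most (2 / c) j L e = 2 / j.\<close>
  define c where "c = j\<^sup>2 * L * e"
  have c0: "c > 0" using j lip(1) e0 by (simp add: c_def)
  define \<phi> where "\<phi> g = norm (F (x2, fst g) + snd g) + (g - ?g1) \<bullet> (g - ?g1) / c" for g
  let ?C = "G \<inter> cball g0 \<rho>"
  have "j * L * (2 * \<delta>) > 0" using j lip(1) \<delta> by simp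
  then have "dist g0 ?g1 \<le> \<rho>"
    using g1_close \<delta>\<epsilon> \<epsilon>(2) unfolding dist_norm norm_minus_commute[of g0] by linarith
  then have g1C: "?g1 \<in> ?C" using g1 by simp
  have "compact ?C" using closed by (simp add: compact_eq_bounded_closed bounded_Int)
  moreover have "continuous_on ?C \<phi>"
    unfolding \<phi>_def divide_inverse
    by (intro continuous_intros continuous_on_compose2[OF F_continuous[of UNIV]]) auto
  ultimately obtain g where g: "g \<in> ?C" "\<And>g'. g' \<in> ?C \<Longrightarrow> \<phi> g \<le> \<phi> g'"
    using continuous_attains_inf[of ?C \<phi>] g1C by blast
  obtain y2 s2 where gy: "g = (y2, s2)" by (cases g)
  have "\<phi> ?g1 \<le> L * e"
  proof -
    have "\<phi> ?g1 = norm (F (x2, y1) - F (x1, y1))" by (simp add: \<phi>_def)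
    also have "\<dots> \<le> L * norm ((x2, y1) - (x1, y1))" using zz by (intro lip(3))
    also have "\<dots> = L * e" by (simp add: e_def norm_minus_commute)
    finally show ?thesis .
  qed
  then have \<phi>g: "\<phi> g \<le> L * e" using g(2)[OF g1C] by simp
  have "(norm (g - ?g1))\<^sup>2 / c \<le> L * e"
    using \<phi>g norm_ge_zero[of "F (x2, fst g) + snd g"] unfolding \<phi>_def power2_norm_eq_inner by linarith
  then have "(norm (g - ?g1))\<^sup>2 \<le> (j * L * e)\<^sup>2"
    using c0 by (simp add: pos_divide_le_eq c_def power2_eq_square mult_ac)
  then have gg1: "norm (g - ?g1) \<le> j * L * e"
    by (rule power2_le_imp_le) (use j lip(1) e0 in auto)
  define r where "r = F (x2, y2) + s2"
  \<comment> \<open>A zero residual would give a solution for \<open>x2\<close> within j L e of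
    \<open>y1\<close>, against \<open>far\<close>. Hence the norm is differentiable at
    \<open>r\<close>.\<close>
  have r0: "r \<noteq> 0"
  proof
    assume "r = 0"
    then have "s2 = - F (x2, y2)" by (simp add: r_def eq_neg_iff_add_eq_0 add.commute)
    then have "y2 \<in> S x2" using g(1) gy by (simp add: S_def)
    from far[OF this] have "j * L * e < norm (y1 - y2)" by (simp add: e_def)
    also have "\<dots> \<le> norm (g - ?g1)"
      using norm_fst_le[of "y2 - y1" "s2 - - F (x1, y1)"] by (simp add: gy norm_minus_commute[of y1])
    finally show False using gg1 by simp
  qed
  define p where "p = (1 / norm r) *\<^sub>R r"
  have p1: "norm p = 1" using r0 by (simp add: p_def)
  have gg0: "norm (g - g0) < \<epsilon>"
  proof -
    have "norm (g - g0) \<le> norm (g - ?g1) + norm (?g1 - g0)"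
      using dist_triangle[of g g0 ?g1] by (simp only: dist_norm)
    moreover have "j * L * e \<le> j * L * (2 * \<delta>)" using e2 j lip(1) by (intro mult_left_mono) auto
    ultimately show ?thesis using gg1 g1_close \<delta>\<epsilon> by linarith
  qed
  \<comment> \<open>The gradient of \<open>- \<phi>\<close> at \<open>g\<close>: the kernel form
    plus the contribution of the penalty.\<close>
  define m where "m = - (adjoint_y (x2, y2) p, p) - (2 / c) *\<^sub>R (g - ?g1)"
  have "m \<in> regular_normal_cone G g"
  proof (rule regular_normal_of_maximizer)
    show "g \<in> G" using g by blast
    have dF: "((\<lambda>g. F (x2, fst g)) has_derivative (\<lambda>h. F' (x2, y2) (0, fst h))) (at g)"
    proof -
      have 1: "((\<lambda>g. (x2, fst g)) has_derivative (\<lambda>h. (0, fst h))) (at g)"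
        by (auto intro!: derivative_eq_intros)
      have 2: "(F has_derivative F' (x2, y2)) (at (x2, fst g))" using deriv by (simp add: gy)
      from has_derivative_compose[OF 1 2] show ?thesis .
    qed
    have dr: "((\<lambda>g. F (x2, fst g) + snd g) has_derivative (\<lambda>h. F' (x2, y2) (0, fst h) + snd h)) (at g)"
      by (intro has_derivative_add dF has_derivative_snd has_derivative_ident)
    have "(norm has_derivative (\<lambda>h. h \<bullet> sgn r)) (at (F (x2, fst g) + snd g))"
      using has_derivative_norm[of r] r0 by (simp add: r_def gy inner_commute)
    from has_derivative_compose[OF dr this]
    have dn: "((\<lambda>g. norm (F (x2, fst g) + snd g)) has_derivative (\<lambda>h. (F' (x2, y2) (0, fst h) + snd h) \<bullet> p)) (at g)"
      by (simp add: p_def sgn_div_norm divide_inverse)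
    have dp: "((\<lambda>g. (g - ?g1) \<bullet> (g - ?g1) / c) has_derivative (\<lambda>h. (2 / c) * ((g - ?g1) \<bullet> h))) (at g)"
    proof -
      have 1: "((\<lambda>g. g - ?g1) has_derivative (\<lambda>h. h)) (at g)"
        by (auto intro!: derivative_eq_intros)
      have "((\<lambda>g. (g - ?g1) \<bullet> (g - ?g1) / c) has_derivative (\<lambda>h. ((g - ?g1) \<bullet> h + h \<bullet> (g - ?g1)) / c)) (at g)"
        unfolding divide_inverse
        by (intro has_derivative_mult_left has_derivative_inner[OF 1 1])
      moreover have "((g - ?g1) \<bullet> h + h \<bullet> (g - ?g1)) / c = (2 / c) * ((g - ?g1) \<bullet> h)" for h
        by (simp only: inner_commute[of h]) simp
      ultimately show ?thesis by simp
    qed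
    have "((\<lambda>g. - \<phi> g) has_derivative (\<lambda>h. - ((F' (x2, y2) (0, fst h) + snd h) \<bullet> p + (2 / c) * ((g - ?g1) \<bullet> h)))) (at g)"
      unfolding \<phi>_def by (intro has_derivative_minus has_derivative_add dn dp)
    moreover have "m \<bullet> h = - ((F' (x2, y2) (0, fst h) + snd h) \<bullet> p + (2 / c) * ((g - ?g1) \<bullet> h))" for h
    proof -
      have "(adjoint_y (x2, y2) p, p) \<bullet> h = (F' (x2, y2) (0, fst h) + snd h) \<bullet> p"
        by (cases h) (simp add: adjoint_y_inner inner_add_right inner_commute[of _ p])
      then show ?thesis unfolding m_def inner_diff_left inner_minus_left inner_scaleR_left by simp
    qed
    ultimately show "((\<lambda>g. - \<phi> g) has_derivative (\<lambda>h. m \<bullet> h)) (at g)" by simp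
    show "\<rho> - norm (g - g0) > 0" using gg0 \<epsilon>(2) by simp
    fix g' assume g': "g' \<in> G" "dist g' g < \<rho> - norm (g - g0)"
    have "dist g0 g' \<le> dist g' g + dist g g0" by (metis dist_commute dist_triangle)
    then have "g' \<in> ?C" using g' by (simp add: dist_norm[of g g0])
    then show "- \<phi> g' \<le> - \<phi> g" using g(2) by simp
  qed
  moreover have "dist m (- (adjoint_y (x2, fst g) p, p)) \<le> 2 / j"
  proof -
    have "dist m (- (adjoint_y (x2, fst g) p, p)) = (2 / c) * norm (g - ?g1)"
    proof -
      have "m - (- (adjoint_y (x2, fst g) p, p)) = - ((2 / c) *\<^sub>R (g - ?g1))" by (simp add: m_def gy)
      then have "dist m (- (adjoint_y (x2, fst g) p, p)) = norm ((2 / c) *\<^sub>R (g - ?g1))"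
        by (simp only: dist_norm norm_minus_cancel)
      then show ?thesis using c0 by simp
    qed
    also have "\<dots> \<le> (2 / c) * (j * L * e)" using gg1 c0 by (intro mult_left_mono) auto
    also have "\<dots> = 2 / j" using j lip(1) e0 by (simp add: c_def power2_eq_square)
    finally show ?thesis .
  qed
  moreover have "dist x2 xb < 1 / j" using x(2) \<delta>j by simp
  moreover have "dist g g0 < 1 / j" using gg0 \<epsilon>(3) by (simp add: dist_norm)
  ultimately show ?thesis using g(1) p1 by blast
qed

text \<open>Sufficiency half of the Mordukhovich criterion: the almost kernel elements for j = 1, 2,
  ... carry unit vectors \<open>p\<close>, and a cluster point of these is a unit vector excluded by
  \<open>ker\<close>.\<close>

theorem aubin_sufficient:
  assumes closed: "closed (G \<inter> cball g0 \<rho>)" and "\<rho> > 0"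
    and ker: "\<And>p. - (adjoint_y z0 p, p) \<in> limiting_normal_cone G g0 \<Longrightarrow> p = 0"
  shows "aubin_property S xb yb"
proof (rule ccontr)
  assume no: "\<not> aubin_property S xb yb"
  obtain L d where lip: "L > 0" "d > 0" "\<And>z1 z2. dist z1 z0 < d \<Longrightarrow> dist z2 z0 < d \<Longrightarrow> norm (F z1 - F z2) \<le> L * norm (z1 - z2)"
    by (rule local_lipschitz) blast
  have "\<forall>k. \<exists>w. fst (snd w) \<in> G \<and> snd (snd (snd w)) \<in> regular_normal_cone G (fst (snd w)) \<and>
      norm (fst (snd (snd w))) = 1 \<and> dist (fst w) xb < 1 / real (Suc k) \<and> dist (fst (snd w)) g0 < 1 / real (Suc k) \<and>
    dist (snd (snd (snd w))) (- (adjoint_y (fst w, fst (fst (snd w))) (fst (snd (snd w))), fst (snd (snd w)))) \<le> 2 / real (Suc k)"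
    using almost_kernel_normal[OF closed \<open>\<rho> > 0\<close> no lip] by (simp del: of_nat_Suc)
  from choice[OF this] obtain w where w: "\<And>k. fst (snd (w k)) \<in> G" "\<And>k. snd (snd (snd (w k))) \<in> regular_normal_cone G (fst (snd (w k)))"
      "\<And>k. norm (fst (snd (snd (w k)))) = 1" "\<And>k. dist (fst (w k)) xb < 1 / real (Suc k)" "\<And>k. dist (fst (snd (w k))) g0 < 1 / real (Suc k)"
    "\<And>k. dist (snd (snd (snd (w k)))) (- (adjoint_y (fst (w k), fst (fst (snd (w k)))) (fst (snd (snd (w k)))), fst (snd (snd (w k))))) \<le> 2 / real (Suc k)"
    by blast
  define x g p m where "x k = fst (w k)" and "g k = fst (snd (w k))" and "p k = fst (snd (snd (w k)))" and "m k = snd (snd (snd (w k)))" for k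
  note w = w[folded x_def g_def p_def m_def]
  have inv: "(\<lambda>k. 1 / real (Suc k)) \<longlonglongrightarrow> 0" using LIMSEQ_inverse_real_of_nat by (simp add: inverse_eq_divide)
  have inv2: "(\<lambda>k. 2 / real (Suc k)) \<longlonglongrightarrow> 0" using tendsto_mult[OF tendsto_const[of 2] inv] by simp
  have lim: "x \<longlonglongrightarrow> xb" "g \<longlonglongrightarrow> g0"
    by (rule metric_tendsto_imp_tendsto[OF inv]; use w(4,5) in \<open>auto intro!: always_eventually less_imp_le\<close>)+
  have "bounded (range p)" using w(3) by (auto simp: bounded_iff)
  then obtain p' r where r: "strict_mono (r :: nat \<Rightarrow> nat)" "(\<lambda>k. p (r k)) \<longlonglongrightarrow> p'" by (rule bounded_subsequence)
  note sub = LIMSEQ_subseq_LIMSEQ[OF _ r(1), unfolded o_def]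
  have lr: "(\<lambda>k. x (r k)) \<longlonglongrightarrow> xb" "(\<lambda>k. g (r k)) \<longlonglongrightarrow> g0" by (rule sub[OF lim(1)], rule sub[OF lim(2)])
  have zr: "(\<lambda>k. (x (r k), fst (g (r k)))) \<longlonglongrightarrow> z0" using tendsto_Pair[OF lr(1) tendsto_fst[OF lr(2)]] by simp
  have al: "(\<lambda>k. - (adjoint_y (x (r k), fst (g (r k))) (p (r k)), p (r k))) \<longlonglongrightarrow> - (adjoint_y z0 p', p')"
    by (intro tendsto_minus tendsto_Pair adjoint_y_lim zr r)
  have "(\<lambda>k. m (r k) - (- (adjoint_y (x (r k), fst (g (r k))) (p (r k)), p (r k)))) \<longlonglongrightarrow> 0"
    by (rule Lim_null_comparison[OF _ sub[OF inv2]])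
      (use w(6) in \<open>auto intro!: always_eventually simp: dist_norm[symmetric] simp del: of_nat_Suc\<close>)
  from tendsto_add[OF this al] have mr: "(\<lambda>k. m (r k)) \<longlonglongrightarrow> - (adjoint_y z0 p', p')" by simp
  have "- (adjoint_y z0 p', p') \<in> limiting_normal_cone G g0"
    unfolding limiting_normal_cone_def
    by (intro CollectI exI[of _ "\<lambda>k. g (r k)"] exI[of _ "\<lambda>k. m (r k)"] conjI allI w(1,2) lr(2) mr)
  then have "p' = 0" by (rule ker)
  moreover have "norm p' = 1" using tendsto_norm[OF r(2)] w(3) by (simp add: LIMSEQ_const_iff)
  ultimately show False by simp
qed

section \<open>Necessity when the parameter derivative has a right inverse\<close>

text \<open>When the parameter moves by t h, the Aubin property yields a solution within \<kappa> t
  |h|; difference quotients of these solutions cluster at v. The point \<open>(x, y)\<close> is not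
  the reference pair in general, because the regular normals approximating a limiting one sit at
  nearby points.\<close>

lemma aubin_tangent:
  assumes U: "open U" "x \<in> U" and y: "y \<in> V" "y \<in> S x" and "\<kappa> \<ge> 0"
    and aub: "\<And>x1 x2. x1 \<in> U \<Longrightarrow> x2 \<in> U \<Longrightarrow> S x1 \<inter> V \<subseteq> {s + (\<kappa> * norm (x1 - x2)) *\<^sub>R b | s b. s \<in> S x2 \<and> b \<in> cball 0 1}"
  shows "\<exists>v. norm v \<le> \<kappa> * norm h \<and> (v, - F' (x, y) (h, v)) \<in> contingent_cone G (y, - F (x, y))"
proof -
  have "((\<lambda>t. x + t *\<^sub>R h) \<longlongrightarrow> x + 0 *\<^sub>R h) (at_right 0)" by (intro tendsto_intros)
  then have "\<forall>\<^sub>F t in at_right 0. x + t *\<^sub>R h \<in> U" using U by (intro topological_tendstoD) auto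
  then obtain e where e: "e > 0" "\<And>t. 0 < t \<Longrightarrow> t < e \<Longrightarrow> x + t *\<^sub>R h \<in> U"
    unfolding eventually_at_right_field by auto
  \<comment> \<open>As before, the shift by two keeps \<open>t k\<close> strictly below
    \<open>e\<close>.\<close>
  define t where "t k = e * inverse (real (Suc (Suc k)))" for k
  have t: "t k > 0" "t k < e" for k using e(1) by (auto simp: t_def field_simps add_pos_nonneg)
  have "(\<lambda>k. e * inverse (real (Suc (Suc k)))) \<longlonglongrightarrow> e * 0"
    by (rule tendsto_mult[OF tendsto_const LIMSEQ_Suc[OF LIMSEQ_inverse_real_of_nat]])
  then have t0: "t \<longlonglongrightarrow> 0" unfolding t_def by simp
  have "\<forall>k. \<exists>s. s \<in> S (x + t k *\<^sub>R h) \<and> norm (s - y) \<le> t k * (\<kappa> * norm h)"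
  proof
    fix k
    obtain s b where "y = s + (\<kappa> * norm (x - (x + t k *\<^sub>R h))) *\<^sub>R b" "s \<in> S (x + t k *\<^sub>R h)" "norm b \<le> 1"
      using aub[OF U(2) e(2)[OF t]] y by fastforce
    moreover from this have "norm (s - y) = t k * (\<kappa> * norm h) * norm b"
      using t(1)[of k] \<open>\<kappa> \<ge> 0\<close> by (simp add: norm_minus_commute)
    moreover have "t k * (\<kappa> * norm h) * norm b \<le> t k * (\<kappa> * norm h) * 1"
      using t(1)[of k] \<open>\<kappa> \<ge> 0\<close> \<open>norm b \<le> 1\<close> by (intro mult_left_mono) auto
    ultimately show "\<exists>s. s \<in> S (x + t k *\<^sub>R h) \<and> norm (s - y) \<le> t k * (\<kappa> * norm h)" by auto
  qed
  from choice[OF this] obtain s where s: "\<And>k. s k \<in> S (x + t k *\<^sub>R h)" "\<And>k. norm (s k - y) \<le> t k * (\<kappa> * norm h)" by blast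
  define v where "v k = (1 / t k) *\<^sub>R (s k - y)" for k
  have sv: "s k = y + t k *\<^sub>R v k" for k using t(1)[of k] by (simp add: v_def)
  have vle: "norm (v k) \<le> \<kappa> * norm h" for k
    using s(2)[of k] t(1)[of k] by (simp add: v_def pos_divide_le_eq mult.commute)
  then have "bounded (range v)" by (auto simp: bounded_iff)
  then obtain v' r where r: "strict_mono (r :: nat \<Rightarrow> nat)" "(\<lambda>k. v (r k)) \<longlonglongrightarrow> v'" by (rule bounded_subsequence)
  have tr: "(\<lambda>k. t (r k)) \<longlonglongrightarrow> 0" using LIMSEQ_subseq_LIMSEQ[OF t0 r(1)] by (simp add: o_def)
  have "norm v' \<le> \<kappa> * norm h" by (rule tendsto_upperbound[OF tendsto_norm[OF r(2)]]) (use vle in auto)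
  moreover have "(v', - F' (x, y) (h, v')) \<in> contingent_cone G (y, - F (x, y))"
  proof (rule contingent_coneI_points[of "\<lambda>k. t (r k)" "\<lambda>k. (s (r k), - F (x + t (r k) *\<^sub>R h, s (r k)))"])
    show "\<forall>\<^sub>F k in sequentially. (s (r k), - F (x + t (r k) *\<^sub>R h, s (r k))) \<in> G"
      using s(1) by (simp add: S_def)
    have "(\<lambda>k. (1 / t (r k)) *\<^sub>R (F ((x, y) + t (r k) *\<^sub>R (h, v (r k))) - F (x, y))) \<longlonglongrightarrow> F' (x, y) (h, v')"
      by (rule derivative_seq[OF deriv t(1) tr]) (intro tendsto_Pair tendsto_const r)
    from tendsto_Pair[OF r(2) tendsto_minus[OF this]]
    have "(\<lambda>k. (v (r k), - ((1 / t (r k)) *\<^sub>R (F ((x, y) + t (r k) *\<^sub>R (h, v (r k))) - F (x, y))))) \<longlonglongrightarrow> (v', - F' (x, y) (h, v'))" .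
    moreover have "(1 / t (r k)) *\<^sub>R ((s (r k), - F (x + t (r k) *\<^sub>R h, s (r k))) - (y, - F (x, y)))
      = (v (r k), - ((1 / t (r k)) *\<^sub>R (F ((x, y) + t (r k) *\<^sub>R (h, v (r k))) - F (x, y))))" for k
      by (simp add: v_def sv[symmetric] scaleR_diff_right algebra_simps)
    ultimately show "(\<lambda>k. (1 / t (r k)) *\<^sub>R ((s (r k), - F (x + t (r k) *\<^sub>R h, s (r k))) - (y, - F (x, y))))
      \<longlonglongrightarrow> (v', - F' (x, y) (h, v'))" by simp
  qed (use t(1) tr in auto)
  ultimately show ?thesis by blast
qed

text \<open>Every pair near \<open>g0\<close> has the form (y, - F(x, y)) with x near
  \<open>xb\<close>, so each graph point near \<open>g0\<close> belongs to a solution for a nearby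
  parameter. The map (a, y) to (F(xb + A a, y), y) has a derivative with a bounded right inverse,
  and an open mapping theorem applies.\<close>

lemma solvable_parameter:
  assumes A: "linear A" "\<And>s. F' z0 (A s, 0) = s" and "e > 0"
  shows "\<exists>d>0. \<forall>y s. dist (y, s) g0 < d \<longrightarrow> (\<exists>x. dist x xb < e \<and> F (x, y) = - s)"
proof -
  let ?f = "\<lambda>u. (F (xb + A (fst u), snd u), snd u)"
  have bA: "bounded_linear A" using A(1) by (simp add: linear_conv_bounded_linear)
  have contA: "continuous_on UNIV (\<lambda>u :: 'y \<times> 'y. A (fst u))"
    by (intro bounded_linear.continuous_on[OF bA] continuous_intros)
  let ?T = "{u. dist (xb + A (fst u)) xb < e} :: ('y \<times> 'y) set"
  have "open ?T" by (intro open_Collect_less continuous_intros contA)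
  then have T: "(0, yb) \<in> interior ?T" using \<open>e > 0\<close> linear_0[OF A(1)] by (simp add: interior_open)
  let ?f' = "\<lambda>h. (F' z0 (A (fst h), snd h), snd h)"
  have df: "(?f has_derivative ?f') (at (0, yb))"
  proof (rule has_derivative_Pair)
    have "((\<lambda>u. (xb + A (fst u), snd u)) has_derivative (\<lambda>h. (A (fst h), snd h))) (at (0, yb))"
      using bounded_linear.has_derivative[OF bA has_derivative_fst[OF has_derivative_ident]]
      by (auto intro!: derivative_eq_intros)
    moreover have "(F has_derivative blinfun_apply (F' z0)) (at (xb + A (fst (0, yb)), snd (0::'y, yb)))"
      using deriv linear_0[OF A(1)] by simp
    ultimately show "((\<lambda>u. F (xb + A (fst u), snd u)) has_derivative (\<lambda>h. F' z0 (A (fst h), snd h))) (at (0, yb))"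
      by (rule has_derivative_compose)
  qed (intro has_derivative_snd has_derivative_ident)
  \<comment> \<open>Right inverse of \<open>?f'\<close>: the effect of the y-component is subtracted
    before \<open>A\<close> is applied.\<close>
  let ?g' = "\<lambda>h. (fst h - F' z0 (0, snd h), snd h)"
  have "bounded_linear ?g'"
    by (intro bounded_linear_intros bounded_linear_compose[OF blinfun.bounded_linear_right])
  moreover have "?f' \<circ> ?g' = id"
  proof
    fix h
    have "F' z0 (A (fst h - F' z0 (0, snd h)), snd h) = fst h"
      by (subst F'_add) (simp add: A(2))
    then show "(?f' \<circ> ?g') h = id h" by (simp add: o_def)
  qed
  moreover have "continuous_on UNIV ?f"
    by (intro continuous_intros continuous_on_compose2[OF F_continuous[of UNIV]] contA) auto
  ultimately have "?f (0, yb) \<in> interior (?f ` ?T)"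
    by (intro sussmann_open_mapping[OF open_UNIV _ UNIV_I df _ _ subset_UNIV T])
  then obtain d where d: "d > 0" "ball (F z0, yb) d \<subseteq> ?f ` ?T"
    unfolding mem_interior using linear_0[OF A(1)] by auto
  show ?thesis
  proof (intro exI[of _ d] conjI d(1) allI impI)
    fix y s assume "dist (y, s) g0 < d"
    moreover have "dist (F z0) (- s) = dist s (- F z0)" by (simp add: dist_norm add.commute)
    ultimately have "(- s, y) \<in> ball (F z0, yb) d"
      by (simp add: dist_Pair_Pair dist_commute[of yb] add.commute)
    then obtain u where "u \<in> ?T" "(- s, y) = ?f u" using d(2) by blast
    then show "\<exists>x. dist x xb < e \<and> F (x, y) = - s" by (intro exI[of _ "xb + A (fst u)"]) auto
  qed
qed

text \<open>The normals (a, c) are tested with the tangents of \<open>aubin_tangent\<close> for h =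
  - A c, which gives d v + c F'(A c, 0) <= 0 with v bounded, where d is a minus the adjoint of c. In
  the limit d vanishes and c becomes - b, so |b|^2 <= 0.\<close>

theorem aubin_necessary:
  assumes A: "linear A" "\<And>s. F' z0 (A s, 0) = s" and aubin: "aubin_property S xb yb"
    and b: "- (adjoint_y z0 b, b) \<in> limiting_normal_cone G g0"
  shows "b = 0"
proof -
  obtain g m where g: "\<And>k. g k \<in> G" "\<And>k. m k \<in> regular_normal_cone G (g k)"
    "g \<longlonglongrightarrow> g0" "m \<longlonglongrightarrow> - (adjoint_y z0 b, b)"
    using b unfolding limiting_normal_cone_def by blast
  from aubin[unfolded aubin_property_def, THEN conjunct2] obtain U V \<kappa> where UV0:
    "open U \<and> xb \<in> U \<and> open V \<and> yb \<in> V \<and> (\<kappa>::real) \<ge> 0 \<and> (\<forall>x1\<in>U. \<forall>x2\<in>U.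
      S x1 \<inter> V \<subseteq> {s + (\<kappa> * norm (x1 - x2)) *\<^sub>R b | s b. s \<in> S x2 \<and> b \<in> cball 0 1})"
    by (elim exE)
  then have UV: "open U" "xb \<in> U" "open V" "yb \<in> V" "\<kappa> \<ge> 0" by simp_all
  have aub: "S x1 \<inter> V \<subseteq> {s + (\<kappa> * norm (x1 - x2)) *\<^sub>R b | s b. s \<in> S x2 \<and> b \<in> cball 0 1}"
    if "x1 \<in> U" "x2 \<in> U" for x1 x2
    using UV0 that by (elim conjE) (drule (1) bspec, drule (1) bspec, assumption)
  let ?e = "\<lambda>j. 1 / real (Suc j)"
  have "\<forall>j. \<exists>w. F (fst w, fst (g (snd w))) = - snd (g (snd w)) \<and> dist (fst w) xb < ?e j \<and>
      dist (g (snd w)) g0 < ?e j \<and> dist (m (snd w)) (- (adjoint_y z0 b, b)) < ?e j"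
  proof
    fix j
    have ej: "?e j > 0" by simp
    obtain d where d: "d > 0" "\<And>y s. dist (y, s) g0 < d \<Longrightarrow> \<exists>x. dist x xb < ?e j \<and> F (x, y) = - s"
      using solvable_parameter[OF A ej] by blast
    have "\<forall>\<^sub>F k in sequentially. dist (g k) g0 < d \<and> dist (g k) g0 < ?e j \<and> dist (m k) (- (adjoint_y z0 b, b)) < ?e j"
      using tendstoD[OF g(3) d(1)] tendstoD[OF g(3) ej] tendstoD[OF g(4) ej] by eventually_elim blast
    from eventually_happens'[OF sequentially_bot this]
    obtain k where k: "dist (g k) g0 < d" "dist (g k) g0 < ?e j" "dist (m k) (- (adjoint_y z0 b, b)) < ?e j"
      by blast
    moreover obtain x where "dist x xb < ?e j" "F (x, fst (g k)) = - snd (g k)"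
      using d(2)[of "fst (g k)" "snd (g k)"] k(1) by auto
    ultimately show "\<exists>w. F (fst w, fst (g (snd w))) = - snd (g (snd w)) \<and> dist (fst w) xb < ?e j \<and>
      dist (g (snd w)) g0 < ?e j \<and> dist (m (snd w)) (- (adjoint_y z0 b, b)) < ?e j"
      by (intro exI[of _ "(x, k)"]) simp
  qed
  from choice[OF this] obtain w where w: "\<And>j. F (fst (w j), fst (g (snd (w j)))) = - snd (g (snd (w j)))"
    "\<And>j. dist (fst (w j)) xb < ?e j" "\<And>j. dist (g (snd (w j))) g0 < ?e j"
    "\<And>j. dist (m (snd (w j))) (- (adjoint_y z0 b, b)) < ?e j" by blast
  define x y s a c where "x j = fst (w j)" and "y j = fst (g (snd (w j)))" and "s j = snd (g (snd (w j)))"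
    and "a j = fst (m (snd (w j)))" and "c j = snd (m (snd (w j)))" for j
  have inv: "?e \<longlonglongrightarrow> 0" using LIMSEQ_inverse_real_of_nat by (simp add: inverse_eq_divide)
  have lim0: "x \<longlonglongrightarrow> xb" "(\<lambda>j. g (snd (w j))) \<longlonglongrightarrow> g0" "(\<lambda>j. m (snd (w j))) \<longlonglongrightarrow> - (adjoint_y z0 b, b)"
    unfolding x_def by (rule metric_tendsto_imp_tendsto[OF inv]; use w(2-4) in \<open>auto intro!: always_eventually less_imp_le\<close>)+
  have lim: "y \<longlonglongrightarrow> yb" "a \<longlonglongrightarrow> - adjoint_y z0 b" "c \<longlonglongrightarrow> - b"
    using tendsto_fst[OF lim0(2)] tendsto_fst[OF lim0(3)] tendsto_snd[OF lim0(3)]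
    by (simp_all add: y_def[abs_def] a_def[abs_def] c_def[abs_def])
  have s: "s j = - F (x j, y j)" for j using w(1)[of j] by (simp add: x_def y_def s_def)
  have yS: "y j \<in> S (x j)" for j
    using g(1)[of "snd (w j)"] w(1)[of j] by (simp add: S_def x_def y_def)
  have nrm: "(a j, c j) \<in> regular_normal_cone G (y j, - F (x j, y j))" for j
  proof -
    have "g (snd (w j)) = (y j, - F (x j, y j))" "m (snd (w j)) = (a j, c j)"
      using s[of j] by (simp_all add: y_def s_def a_def c_def prod_eq_iff)
    then show ?thesis using g(2)[of "snd (w j)"] by simp
  qed
  have zl: "(\<lambda>j. (x j, y j)) \<longlonglongrightarrow> z0" by (intro tendsto_Pair lim0 lim)
  have "\<forall>\<^sub>F j in sequentially. x j \<in> U \<and> y j \<in> V"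
    using topological_tendstoD[OF lim0(1) UV(1,2)] topological_tendstoD[OF lim(1) UV(3,4)] by eventually_elim blast
  then obtain M where M: "\<And>j. j \<ge> M \<Longrightarrow> x j \<in> U \<and> y j \<in> V" unfolding eventually_sequentially by blast
  have "\<forall>j. \<exists>v. j \<ge> M \<longrightarrow> norm v \<le> \<kappa> * norm (- A (c j)) \<and>
     (v, - F' (x j, y j) (- A (c j), v)) \<in> contingent_cone G (y j, - F (x j, y j))"
  proof
    fix j
    show "\<exists>v. j \<ge> M \<longrightarrow> norm v \<le> \<kappa> * norm (- A (c j)) \<and>
     (v, - F' (x j, y j) (- A (c j), v)) \<in> contingent_cone G (y j, - F (x j, y j))"
    proof (cases "j \<ge> M")
      case True
      then have "x j \<in> U" "y j \<in> V" using M by auto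
      from aubin_tangent[OF UV(1) this yS UV(5) aub, of "- A (c j)"] show ?thesis by blast
    qed simp
  qed
  from choice[OF this] obtain v where v: "\<And>j. j \<ge> M \<Longrightarrow> norm (v j) \<le> \<kappa> * norm (A (c j))"
     "\<And>j. j \<ge> M \<Longrightarrow> (v j, - F' (x j, y j) (- A (c j), v j)) \<in> contingent_cone G (y j, - F (x j, y j))" by auto
  have bA: "bounded_linear A" using A(1) by (simp add: linear_conv_bounded_linear)
  have Ac: "(\<lambda>j. A (c j)) \<longlonglongrightarrow> A (- b)" by (rule bounded_linear.tendsto[OF bA lim(3)])
  \<comment> \<open>Measures how far the normal is from the form (\<open>adjoint_y\<close> of c, c);
    the limit has exactly this form with c = - b.\<close>
  define d where "d j = a j - adjoint_y (x j, y j) (c j)" for j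
  have adj_neg: "adjoint_y z0 (- b) = - adjoint_y z0 b" by (simp add: adjoint_y_def sum_negf)
  have "d \<longlonglongrightarrow> - adjoint_y z0 b - adjoint_y z0 (- b)"
    unfolding d_def by (intro tendsto_diff lim adjoint_y_lim zl)
  then have d0: "d \<longlonglongrightarrow> 0" by (simp add: adj_neg)
  have ineq: "d j \<bullet> v j + c j \<bullet> F' (x j, y j) (A (c j), 0) \<le> 0" if "j \<ge> M" for j
  proof -
    have "F' (x j, y j) (- A (c j), v j) = F' (x j, y j) (0, v j) - F' (x j, y j) (A (c j), 0)"
      by (simp flip: blinfun.diff_right)
    then show ?thesis
      using regular_normal_dot[OF nrm v(2)[OF that]]
      by (simp add: d_def inner_diff_left inner_diff_right adjoint_y_inner)
  qed
  have "(\<lambda>j. norm (d j) * (\<kappa> * norm (A (c j)))) \<longlonglongrightarrow> norm (0::'y) * (\<kappa> * norm (A (- b)))"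
    by (intro tendsto_intros d0 Ac)
  then have bnd: "(\<lambda>j. norm (d j) * (\<kappa> * norm (A (c j)))) \<longlonglongrightarrow> 0" by simp
  have "(\<lambda>j. d j \<bullet> v j) \<longlonglongrightarrow> 0"
  proof (rule Lim_null_comparison[OF _ bnd])
    show "\<forall>\<^sub>F j in sequentially. norm (d j \<bullet> v j) \<le> norm (d j) * (\<kappa> * norm (A (c j)))"
      using eventually_ge_at_top[of M]
    proof eventually_elim
      case (elim j)
      have "norm (d j \<bullet> v j) \<le> norm (d j) * norm (v j)" by (simp add: Cauchy_Schwarz_ineq2)
      also have "\<dots> \<le> norm (d j) * (\<kappa> * norm (A (c j)))" using v(1)[OF elim] by (intro mult_left_mono) auto
      finally show ?case .
    qed
  qed
  moreover have "(\<lambda>j. c j \<bullet> F' (x j, y j) (A (c j), 0)) \<longlonglongrightarrow> (- b) \<bullet> F' z0 (A (- b), 0)"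
    by (intro tendsto_inner lim F'_lim zl tendsto_Pair Ac tendsto_const)
  ultimately have "(\<lambda>j. d j \<bullet> v j + c j \<bullet> F' (x j, y j) (A (c j), 0)) \<longlonglongrightarrow> 0 + (- b) \<bullet> F' z0 (A (- b), 0)"
    by (rule tendsto_add)
  then have "0 + (- b) \<bullet> F' z0 (A (- b), 0) \<le> 0"
    by (rule tendsto_upperbound) (use ineq in \<open>auto simp: eventually_sequentially\<close>)
  then have "b \<bullet> b \<le> 0" by (simp add: A(2))
  then have "b \<bullet> b = 0" using inner_ge_zero[of b] by linarith
  then show "b = 0" by simp
qed

end

section \<open>The theorem, with the union identified as the limiting normal cone of the
  graph\<close>

theorem theorem5:
  fixes q :: "real^'m \<Rightarrow> real^'l"
    and F :: "(real^'n) \<times> (real^'m) \<Rightarrow> real^'m"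
    and xbar :: "real^'n" and ybar ystar :: "real^'m"
  assumes q_C2: "twice_continuously_differentiable q"
    and F_C1: "continuously_differentiable F"
    and ref_point: "(xbar, ybar) \<in> gph (solution_map F q)"
    and ystar: "ystar = - F (xbar, ybar)"
    and subregular: "metrically_subregular_at (constraint_mf q) ybar 0"
    and vicinity: "regular_in_vicinity q ybar"
    and two_reg: "\<And>u J. u \<in> critical_cone q ybar ystar \<Longrightarrow> u \<noteq> 0 \<Longrightarrow>
          J \<in> maximal_index_sets q ybar u \<Longrightarrow> two_regular J (\<lambda>i y. q y $ i) ybar u"
    and null_space: "active_null_space q ybar \<noteq> {0}"
  shows "let condition =
      (\<forall>b. - (transpose (jacobian (\<lambda>y. F (xbar, y)) (at ybar)) *v b, b)
          \<in> (\<Union>(v, vs) \<in> {(v, vs). (v, vs) \<in> contingent_cone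
                  (gph (regular_normal_cone (feasible_set q))) (ybar, ystar) \<and> v \<noteq> 0}.
              \<Union>(lam, mu) \<in> multiplier_pairs q ybar ystar v vs.
              \<Union>J \<in> index_sets q ybar v.
              \<Union>(Ip, I) \<in> {(Ip, I). I_plus lam mu \<subseteq> Ip \<and> Ip \<subseteq> I \<and> I \<subseteq> J}.
                Q_set q ybar v lam Ip I)
          \<longrightarrow> b = 0)
    in (condition \<longrightarrow> aubin_property (solution_map F q) xbar ybar) \<and>
       (surj (\<lambda>h. jacobian (\<lambda>x. F (x, ybar)) (at xbar) *v h) \<longrightarrow>
          (condition \<longleftrightarrow> aubin_property (solution_map F q) xbar ybar))"
proof -
  have mem: "y \<in> solution_map F q x \<longleftrightarrow> - F (x, y) \<in> regular_normal_cone (feasible_set q) y" for x y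
  proof
    assume "y \<in> solution_map F q x"
    then obtain s where "s \<in> regular_normal_cone (feasible_set q) y" "0 = F (x, y) + s"
      by (auto simp: solution_map_def)
    then show "- F (x, y) \<in> regular_normal_cone (feasible_set q) y" by (simp add: minus_unique)
  next
    assume "- F (x, y) \<in> regular_normal_cone (feasible_set q) y"
    then show "y \<in> solution_map F q x"
      unfolding solution_map_def by (intro CollectI image_eqI[where x = "- F (x, y)"]) simp_all
  qed
  have normal: "- F (xbar, ybar) \<in> regular_normal_cone (feasible_set q) ybar"
    using ref_point by (simp add: gph_def mem)
  interpret reference_pair q ybar ystar
    using q_C2 subregular vicinity two_reg null_space normal unfolding ystar
    by unfold_locales auto
  obtain F' where F': "\<And>z. (F has_derivative blinfun_apply (F' z)) (at z)" "continuous_on UNIV F'"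
    using F_C1 unfolding continuously_differentiable_def by blast
  interpret generalized_equation F F' G xbar ybar
    by unfold_locales (use F' normal in \<open>auto simp: gph_def\<close>)
  have S: "S = solution_map F q" 
    by (intro ext set_eqI, unfold S_def, unfold gph_def) (simp add: mem)
  have dy: "((\<lambda>y. F (xbar, y)) has_derivative (\<lambda>v. F' (xbar, ybar) (0, v))) (at ybar)"
    by (rule has_derivative_compose[where g = F, OF _ F'(1)]) (auto intro!: derivative_eq_intros)
  have dx: "((\<lambda>x. F (x, ybar)) has_derivative (\<lambda>h. F' (xbar, ybar) (h, 0))) (at xbar)"
    by (rule has_derivative_compose[where g = F, OF _ F'(1)]) (auto intro!: derivative_eq_intros)
  have adjoint: "transpose (jacobian (\<lambda>y. F (xbar, y)) (at ybar)) *v b = adjoint_y (xbar, ybar) b" for b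
  proof (rule vector_eq_rdot[THEN iffD1], intro allI)
    fix h
    have "(transpose (jacobian (\<lambda>y. F (xbar, y)) (at ybar)) *v b) \<bullet> h = b \<bullet> F' (xbar, ybar) (0, h)"
      unfolding transpose_mult_inner jacobian_mult[OF dy] ..
    then show "(transpose (jacobian (\<lambda>y. F (xbar, y)) (at ybar)) *v b) \<bullet> h = adjoint_y (xbar, ybar) b \<bullet> h"
      by (simp only: adjoint_y_inner)
  qed
  let ?cond = "\<forall>b. - (adjoint_y (xbar, ybar) b, b) \<in> directional_normals q ybar ystar \<longrightarrow> b = 0"
  have suff: "aubin_property (solution_map F q) xbar ybar" if "?cond"
  proof -
    obtain \<rho> where "\<rho> > 0" "\<And>n. closed (G \<inter> cball (ybar, n) \<rho>)" by (rule graph_closed_near_reference) blast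
    then show ?thesis
      unfolding S[symmetric] using that[folded limiting_normal_eq, unfolded ystar]
      by (intro aubin_sufficient) auto
  qed
  have nec: "?cond" if surj: "surj (\<lambda>h. jacobian (\<lambda>x. F (x, ybar)) (at xbar) *v h)"
    and aubin: "aubin_property (solution_map F q) xbar ybar"
  proof -
    obtain A where A: "linear A" "(\<lambda>h. jacobian (\<lambda>x. F (x, ybar)) (at xbar) *v h) \<circ> A = id"
      using linear_surjective_right_inverse[OF matrix_vector_mul_linear surj] by blast
    have "F' (xbar, ybar) (A s, 0) = s" for s
      using fun_cong[OF A(2), of s] by (simp add: jacobian_mult[OF dx])
    from aubin_necessary[OF A(1) this aubin[folded S]] show ?thesis
      unfolding limiting_normal_eq[symmetric] unfolding ystar by blast
  qed
  show ?thesis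
    unfolding Let_def adjoint directional_normals_def[symmetric] using suff nec by blast
qed

end
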